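(* Let $G$ be a simple, simply connected, compact matrix Lie group with Lie algebra $\mathcal{G}$, inner product $\langle X,Y\rangle=-\rho K(X,Y)$ on $\mathcal{G}$ ($K$ the Killing form, $\rho>0$ a constant) and Cartan subalgebra $\mathcal{T}$. Let $R_1,\dots,R_m\in\mathcal{T}$ be the simple roots, $R^*$ the highest root, and $P_R=\frac{2\pi R}{\|R\|^2}$ for a root $R$. Then $$\|R^*\|=\max\frac{4\pi}{\|n_1 2P_{R_1}+\cdots+n_m 2P_{R_m}\|},$$ where the maximum is over all relatively prime $n_1,\dots,n_m\in\mathbb{N}\cup\{0\}$.
   Context: $\mathcal{T}$ is the Lie algebra of a maximal torus of $G$, with a fixed ordered orthonormal basis $\{T_1,\dots,T_r\}$. The inner product is extended bilinearly to $\mathcal{G}_{\mathbb{C}}=\mathcal{G}\oplus i\mathcal{G}$. Roots are viewed as elements of $\mathcal{T}$: $R\in\mathcal{T}$, $R\neq0$, is a root if there is a nonzero $Z\in\mathcal{G}_{\mathbb{C}}$ with $[T,Z]=i\langle R,T\rangle Z$ for all $T\in\mathcal{T}$. Roots are ordered by $R>R'$ if the first non-zero coordinate of $R-R'$ relative to the ordered basis is positive; a root is positive if its first non-zero coordinate is positive; the simple roots are those of this positive system, and $R^*$ is the highest root for this ordering. Numbers $n_1,\dots,n_m\in\mathbb{N}\cup\{0\}$ are called relatively prime if at least one of them is non-zero and the greatest common factor of the non-zero numbers is $1$ (in particular, if only one is non-zero, it must be $1$). *)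

theory Defs
  imports "HOL-Analysis.Analysis"
begin

type_synonym 'n cmat = "complex ^ 'n ^ 'n"

text \<open>A matrix Lie group is a subgroup of the complex general linear group that is closed in it.\<close>

definition matrix_lie_group :: "'n::finite cmat set \<Rightarrow> bool" where
  "matrix_lie_group G \<longleftrightarrow>
     mat 1 \<in> G \<and>
     (\<forall>A\<in>G. \<forall>B\<in>G. A ** B \<in> G) \<and>
     (\<forall>A\<in>G. invertible A \<and> matrix_inv A \<in> G) \<and>
     closedin (top_of_set {A. invertible A}) G"

text \<open>On this type the class operations \<open>*\<close> and \<open>^\<close> act entrywise, so powers and the
  exponential are built from the matrix product.\<close>

primrec mat_power :: "'n::finite cmat \<Rightarrow> nat \<Rightarrow> 'n cmat" where
  "mat_power A 0 = mat 1"
| "mat_power A (Suc k) = A ** mat_power A k"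

definition mat_exp :: "'n::finite cmat \<Rightarrow> 'n cmat" where
  "mat_exp A = (\<Sum>k. (1 / fact k) *\<^sub>R mat_power A k)"

definition lie_algebra :: "'n::finite cmat set \<Rightarrow> 'n cmat set" where
  "lie_algebra G = {X. \<forall>t::real. mat_exp (t *\<^sub>R X) \<in> G}"

definition bracket :: "'n::finite cmat \<Rightarrow> 'n cmat \<Rightarrow> 'n cmat" where
  "bracket X Y = X ** Y - Y ** X"

definition lie_ideal :: "'n::finite cmat set \<Rightarrow> 'n cmat set \<Rightarrow> bool" where
  "lie_ideal \<g> I \<longleftrightarrow> subspace I \<and> I \<subseteq> \<g> \<and> (\<forall>X\<in>\<g>. \<forall>Y\<in>I. bracket X Y \<in> I)"

definition simple_lie_algebra :: "'n::finite cmat set \<Rightarrow> bool" where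
  "simple_lie_algebra \<g> \<longleftrightarrow>
     (\<exists>X\<in>\<g>. \<exists>Y\<in>\<g>. bracket X Y \<noteq> 0) \<and>
     (\<forall>I. lie_ideal \<g> I \<longrightarrow> I = {0} \<or> I = \<g>)"

text \<open>The centre of a simple Lie group may be nontrivial: simplicity means that the group is
  connected and its Lie algebra is simple.\<close>

definition simple_lie_group :: "'n::finite cmat set \<Rightarrow> bool" where
  "simple_lie_group G \<longleftrightarrow> connected G \<and> simple_lie_algebra (lie_algebra G)"

definition torus_in :: "'n::finite cmat set \<Rightarrow> 'n cmat set \<Rightarrow> bool" where
  "torus_in G H \<longleftrightarrow>
     matrix_lie_group H \<and> H \<subseteq> G \<and> compact H \<and> connected H \<and>
     (\<forall>A\<in>H. \<forall>B\<in>H. A ** B = B ** A)"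

definition maximal_torus :: "'n::finite cmat set \<Rightarrow> 'n cmat set \<Rightarrow> bool" where
  "maximal_torus G H \<longleftrightarrow>
     torus_in G H \<and> (\<forall>H'. torus_in G H' \<longrightarrow> H \<subseteq> H' \<longrightarrow> H' = H)"

text \<open>The trace of a real-linear map sending the subspace \<open>V\<close> to itself: the sum of the diagonal
  coefficients with respect to a basis of \<open>V\<close>, which does not depend on the basis.\<close>

definition trace_on :: "'a::euclidean_space set \<Rightarrow> ('a \<Rightarrow> 'a) \<Rightarrow> real" where
  "trace_on V f =
     (let B = (SOME B. independent B \<and> span B = V) in \<Sum>b\<in>B. representation B (f b) b)"

definition killing :: "'n::finite cmat set \<Rightarrow> 'n cmat \<Rightarrow> 'n cmat \<Rightarrow> real" where
  "killing \<g> X Y = trace_on \<g> (\<lambda>Z. bracket X (bracket Y Z))"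

definition lie_inner :: "real \<Rightarrow> 'n::finite cmat set \<Rightarrow> 'n cmat \<Rightarrow> 'n cmat \<Rightarrow> real" where
  "lie_inner \<rho> \<g> X Y = - \<rho> * killing \<g> X Y"

definition lie_norm :: "real \<Rightarrow> 'n::finite cmat set \<Rightarrow> 'n cmat \<Rightarrow> real" where
  "lie_norm \<rho> \<g> X = sqrt (lie_inner \<rho> \<g> X X)"

text \<open>The pair \<open>(X, Y)\<close> in \<open>\<g> \<times> \<g>\<close> stands for \<open>X + iY\<close> in the complexification of \<open>\<g>\<close>. Its
  imaginary unit is formal, not the one in the entries of the matrices.\<close>

definition cplx_scale :: "complex \<Rightarrow> 'n::finite cmat \<times> 'n cmat \<Rightarrow> 'n cmat \<times> 'n cmat" where
  "cplx_scale c Z = (Re c *\<^sub>R fst Z - Im c *\<^sub>R snd Z, Re c *\<^sub>R snd Z + Im c *\<^sub>R fst Z)"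

definition cplx_bracket ::
  "'n::finite cmat \<times> 'n cmat \<Rightarrow> 'n cmat \<times> 'n cmat \<Rightarrow> 'n cmat \<times> 'n cmat" where
  "cplx_bracket Z W =
     (bracket (fst Z) (fst W) - bracket (snd Z) (snd W),
      bracket (fst Z) (snd W) + bracket (snd Z) (fst W))"

definition roots :: "real \<Rightarrow> 'n::finite cmat set \<Rightarrow> 'n cmat set \<Rightarrow> 'n cmat set" where
  "roots \<rho> \<g> \<t> =
     {R\<in>\<t>. R \<noteq> 0 \<and>
        (\<exists>Z\<in>\<g> \<times> \<g>. Z \<noteq> 0 \<and>
           (\<forall>T\<in>\<t>. cplx_bracket (T, 0) Z = cplx_scale (\<i> * complex_of_real (lie_inner \<rho> \<g> R T)) Z))}"

definition ordered_orthonormal_basis ::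
  "real \<Rightarrow> 'n::finite cmat set \<Rightarrow> 'n cmat set \<Rightarrow> 'n cmat list \<Rightarrow> bool" where
  "ordered_orthonormal_basis \<rho> \<g> \<t> Ts \<longleftrightarrow>
     distinct Ts \<and> independent (set Ts) \<and> span (set Ts) = \<t> \<and>
     (\<forall>i<length Ts. \<forall>j<length Ts. lie_inner \<rho> \<g> (Ts ! i) (Ts ! j) = (if i = j then 1 else 0))"

definition coordinate :: "'n::finite cmat list \<Rightarrow> 'n cmat \<Rightarrow> nat \<Rightarrow> real" where
  "coordinate Ts X k = representation (set Ts) X (Ts ! k)"

definition positive_vector :: "'n::finite cmat list \<Rightarrow> 'n cmat \<Rightarrow> bool" where
  "positive_vector Ts X \<longleftrightarrow>
     (\<exists>k<length Ts. (\<forall>j<k. coordinate Ts X j = 0) \<and> coordinate Ts X k > 0)"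

definition root_greater :: "'n::finite cmat list \<Rightarrow> 'n cmat \<Rightarrow> 'n cmat \<Rightarrow> bool" where
  "root_greater Ts R R' \<longleftrightarrow> positive_vector Ts (R - R')"

definition positive_roots ::
  "real \<Rightarrow> 'n::finite cmat set \<Rightarrow> 'n cmat set \<Rightarrow> 'n cmat list \<Rightarrow> 'n cmat set" where
  "positive_roots \<rho> \<g> \<t> Ts = {R\<in>roots \<rho> \<g> \<t>. positive_vector Ts R}"

definition simple_roots ::
  "real \<Rightarrow> 'n::finite cmat set \<Rightarrow> 'n cmat set \<Rightarrow> 'n cmat list \<Rightarrow> 'n cmat set" where
  "simple_roots \<rho> \<g> \<t> Ts =
     {R\<in>positive_roots \<rho> \<g> \<t> Ts.
        \<not> (\<exists>A\<in>positive_roots \<rho> \<g> \<t> Ts. \<exists>B\<in>positive_roots \<rho> \<g> \<t> Ts. R = A + B)}"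

definition highest_root ::
  "real \<Rightarrow> 'n::finite cmat set \<Rightarrow> 'n cmat set \<Rightarrow> 'n cmat list \<Rightarrow> 'n cmat \<Rightarrow> bool" where
  "highest_root \<rho> \<g> \<t> Ts S \<longleftrightarrow>
     S \<in> roots \<rho> \<g> \<t> \<and> (\<forall>R\<in>roots \<rho> \<g> \<t>. R \<noteq> S \<longrightarrow> root_greater Ts S R)"

definition root_P :: "real \<Rightarrow> 'n::finite cmat set \<Rightarrow> 'n cmat \<Rightarrow> 'n cmat" where
  "root_P \<rho> \<g> R = (2 * pi / (lie_norm \<rho> \<g> R)\<^sup>2) *\<^sub>R R"

definition relatively_prime :: "nat \<Rightarrow> (nat \<Rightarrow> nat) \<Rightarrow> bool" where
  "relatively_prime m n \<longleftrightarrow> (\<exists>i<m. n i \<noteq> 0) \<and> Gcd {n i | i. i < m \<and> n i \<noteq> 0} = 1"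

text \<open>Unlike \<open>Max\<close>, this is meaningful for infinite sets and asserts that the maximum is attained.\<close>

definition is_maximum :: "real set \<Rightarrow> real \<Rightarrow> bool" where
  "is_maximum S x \<longleftrightarrow> x \<in> S \<and> (\<forall>y\<in>S. y \<le> x)"

end

(*
Up to the factor 2 pi, the vectors in the denominators are the relatively prime nonnegative
combinations of the simple coroots. The highest root R* is a longest root and |R*|^2 is an integral
multiple of |R|^2 for every root R, so for each v in the coroot lattice |v|^2 is an integral multiple
of 4 / |R*|^2, the squared length of the coroot of R*. This coroot lies in the lattice and attains
the minimum, which also forces its coefficients to be relatively prime.

The root system properties come from sl(2)-strings. The Killing form is negative definite because
exp (t ad X) is bounded in t, so averaging an inner product over t makes ad X skew; the centraliser
of the Lie algebra of a maximal torus is that Lie algebra because the torus is generated by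
exponentials; and simplicity makes the root system irreducible.
*)

theory Submission
  imports Defs
begin

section \<open>Root systems with a highest root\<close>

text \<open>\<open>2 *\<^sub>R root_P\<close> of a root is \<open>2 * pi\<close> times its coroot,
  so each quotient in the statement is 2 divided by the norm of a vector v of the coroot lattice,
  and it equals |R*| when v is the coroot of R*. Expanding |v|^2 |R*|^2 / 4 leaves length ratios
  |R*|^2 / |a|^2 and Cartan integers times such ratios, so the combinatorial half rests on the
  integrality of these ratios. That half sees the ordering only through the laws of
  \<open>pos\<close>, never through coordinates.

  The obstacle in the Lie algebra half is that \<g> consists of complex matrices but is only a real
  space, and its complexification has a formal imaginary unit. Everything is therefore kept real:
  the unit is an operator \<open>J\<close> on pairs, and the eigenvalue i r of a root is written as
  the multiple \<open>r *\<^sub>R J\<close>. For T in \<t> the composite of \<open>J\<close> with ad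
  T is symmetric for a real inner product, so roots arise from the real spectral theorem.\<close>

locale ordered_root_system =
  fixes ip :: "'a::real_vector \<Rightarrow> 'a \<Rightarrow> real" and V :: "'a set" and \<Phi> :: "'a set"
    and pos :: "'a \<Rightarrow> bool" and S :: 'a
  assumes bilin: "bilinear ip"
    and ip_commute: "ip x y = ip y x"
    and V: "subspace V"
    and ip_pos: "x \<in> V \<Longrightarrow> x \<noteq> 0 \<Longrightarrow> ip x x > 0"
    and finite_roots: "finite \<Phi>"
    and roots_V: "\<Phi> \<subseteq> V"
    and zero_not_root: "0 \<notin> \<Phi>"
    and cartan_int: "a \<in> \<Phi> \<Longrightarrow> b \<in> \<Phi> \<Longrightarrow> 2 * ip b a / ip a a \<in> \<int>"
    and reflect: "a \<in> \<Phi> \<Longrightarrow> b \<in> \<Phi> \<Longrightarrow> b - (2 * ip b a / ip a a) *\<^sub>R a \<in> \<Phi>"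
    and reduced: "a \<in> \<Phi> \<Longrightarrow> 2 *\<^sub>R a \<notin> \<Phi>"
    and irreducible: "A \<union> B = \<Phi> \<Longrightarrow> (\<And>a b. a \<in> A \<Longrightarrow> b \<in> B \<Longrightarrow> ip a b = 0) \<Longrightarrow> A = {} \<or> B = {}"
    and pos_total: "x \<in> V \<Longrightarrow> x \<noteq> 0 \<Longrightarrow> pos x \<or> pos (- x)"
    and pos_add: "x \<in> V \<Longrightarrow> y \<in> V \<Longrightarrow> pos x \<Longrightarrow> pos y \<Longrightarrow> pos (x + y)"
    and pos_scale: "x \<in> V \<Longrightarrow> c > 0 \<Longrightarrow> pos x \<Longrightarrow> pos (c *\<^sub>R x)"
    and not_pos_0: "\<not> pos 0"
    and highest: "S \<in> \<Phi>" "\<And>a. a \<in> \<Phi> \<Longrightarrow> a \<noteq> S \<Longrightarrow> pos (S - a)"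
begin

lemmas ip_simps =
  bilinear_ladd[OF bilin] bilinear_radd[OF bilin] bilinear_lsub[OF bilin] bilinear_rsub[OF bilin]
  bilinear_lmul[OF bilin] bilinear_rmul[OF bilin] bilinear_lneg[OF bilin] bilinear_rneg[OF bilin]
  bilinear_lzero[OF bilin] bilinear_rzero[OF bilin]

lemma ip_sum_left: "ip (\<Sum>a\<in>A. f a) y = (\<Sum>a\<in>A. ip (f a) y)"
  using linear_sum[of "\<lambda>x. ip x y"] bilin by (auto simp: bilinear_def)

lemma root_V: "a \<in> \<Phi> \<Longrightarrow> a \<in> V"
  using roots_V by auto

lemma root_ip_pos: "a \<in> \<Phi> \<Longrightarrow> ip a a > 0"
  using ip_pos roots_V zero_not_root by (metis subsetD)

lemma ip_eq_0D: "x \<in> V \<Longrightarrow> ip x x \<le> 0 \<Longrightarrow> x = 0"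
  using ip_pos by fastforce

lemma neg_root: "a \<in> \<Phi> \<Longrightarrow> - a \<in> \<Phi>"
  using reflect[of a a] root_ip_pos[of a] by (simp add: scaleR_2)

lemma not_pos_neg: "x \<in> V \<Longrightarrow> pos x \<Longrightarrow> \<not> pos (- x)"
  using pos_add[of x "- x"] not_pos_0 V by (auto simp: subspace_neg)

lemma ip_diff_nonpos_eq: "a \<in> V \<Longrightarrow> b \<in> V \<Longrightarrow> ip a a \<le> ip a b \<Longrightarrow> ip b b \<le> ip a b \<Longrightarrow> a = b"
  using ip_eq_0D[of "a - b"] V by (auto simp: ip_simps ip_commute[of b a] subspace_diff)

lemma Ints_ge_1: "(x::real) \<in> \<int> \<Longrightarrow> x > 0 \<Longrightarrow> x \<ge> 1"
  by (auto elim!: Ints_cases)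

lemma Ints_ge_2: "(x::real) \<in> \<int> \<Longrightarrow> x > 0 \<Longrightarrow> x \<noteq> 1 \<Longrightarrow> x \<ge> 2"
  by (auto elim!: Ints_cases)

text \<open>If both Cartan integers were at least 2, \<open>ip a b\<close> would be at least
  \<open>ip a a\<close> and \<open>ip b b\<close>, so the squared norm of \<open>a - b\<close> would
  not be positive. Hence one of them is 1, and the matching reflection yields the difference or its
  negative.\<close>

lemma diff_root:
  assumes a: "a \<in> \<Phi>" and b: "b \<in> \<Phi>" and "a \<noteq> b" and p: "ip a b > 0"
  shows "a - b \<in> \<Phi>"
proof -
  define m where "m = 2 * ip b a / ip a a"
  define n where "n = 2 * ip a b / ip b b"
  have pp: "ip a a > 0" "ip b b > 0" using a b root_ip_pos by auto
  have m: "m \<in> \<int>" "m > 0" and n: "n \<in> \<int>" "n > 0"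
    using cartan_int[OF a b] cartan_int[OF b a] p pp by (auto simp: m_def n_def ip_commute[of b a])
  consider "m = 1" | "n = 1" | "m \<ge> 2" "n \<ge> 2" using Ints_ge_2 m n by blast
  then show ?thesis
  proof cases
    case 1
    then have "b - a \<in> \<Phi>" using reflect[OF a b] by (simp add: m_def)
    then show ?thesis using neg_root by fastforce
  next
    case 2
    then show ?thesis using reflect[OF b a] by (simp add: n_def)
  next
    case 3
    then have "ip a a \<le> ip a b" "ip b b \<le> ip a b"
      using pp by (auto simp: m_def n_def field_simps ip_commute[of b a])
    then show ?thesis using ip_diff_nonpos_eq a b assms root_V by blast
  qed
qed

lemma pos_diff_trans: "x \<in> V \<Longrightarrow> y \<in> V \<Longrightarrow> z \<in> V \<Longrightarrow> pos (x - y) \<Longrightarrow> pos (y - z) \<Longrightarrow> pos (x - z)"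
  using pos_add[of "x - y" "y - z"] V by (auto simp: subspace_diff)

definition height :: "'a \<Rightarrow> nat" where
  "height b = card {c\<in>\<Phi>. pos (b - c)}"

lemma height_less:
  assumes "a \<in> \<Phi>" "b \<in> \<Phi>" "pos (b - a)"
  shows "height a < height b"
  unfolding height_def
proof (rule psubset_card_mono)
  show "finite {c \<in> \<Phi>. pos (b - c)}" using finite_roots by auto
  have "{c \<in> \<Phi>. pos (a - c)} \<subseteq> {c \<in> \<Phi>. pos (b - c)}"
    using assms pos_diff_trans root_V by blast
  moreover have "a \<in> {c \<in> \<Phi>. pos (b - c)}" "a \<notin> {c \<in> \<Phi>. pos (a - c)}"
    using assms not_pos_0 by auto
  ultimately show "{c \<in> \<Phi>. pos (a - c)} \<subset> {c \<in> \<Phi>. pos (b - c)}" by blast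
qed

section \<open>Simple roots and descent by simple reflections\<close>

definition \<Delta> :: "'a set" where
  "\<Delta> = {a\<in>\<Phi>. pos a \<and> \<not> (\<exists>b\<in>\<Phi>. \<exists>c\<in>\<Phi>. pos b \<and> pos c \<and> a = b + c)}"

lemma simple_root: "a \<in> \<Delta> \<Longrightarrow> a \<in> \<Phi>" and simple_pos: "a \<in> \<Delta> \<Longrightarrow> pos a"
  by (auto simp: \<Delta>_def)

lemma finite_simple: "finite \<Delta>"
  using finite_roots by (auto simp: \<Delta>_def)

lemma not_simpleD: "a \<in> \<Delta> \<Longrightarrow> b \<in> \<Phi> \<Longrightarrow> c \<in> \<Phi> \<Longrightarrow> pos b \<Longrightarrow> pos c \<Longrightarrow> a \<noteq> b + c"
  by (auto simp: \<Delta>_def)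

text \<open>Otherwise \<open>a - b\<close> or its negative would be a positive root, and
  \<open>a\<close> or \<open>b\<close> would be a sum of two positive roots.\<close>

lemma simple_obtuse:
  assumes "a \<in> \<Delta>" "b \<in> \<Delta>" "a \<noteq> b"
  shows "ip a b \<le> 0"
proof (rule ccontr)
  assume "\<not> ip a b \<le> 0"
  then have ab: "a - b \<in> \<Phi>" using diff_root assms simple_root by auto
  then consider "pos (a - b)" | "pos (b - a)" using pos_total[of "a - b"] root_V assms(3) by auto
  then show False
  proof cases
    case 1
    then show False using not_simpleD[OF assms(1) ab, of b] assms simple_root simple_pos by auto
  next
    case 2
    then show False using not_simpleD[OF assms(2), of "b - a" a] neg_root[OF ab] assms simple_root simple_pos
      by auto
  qed
qed

lemma comb_V: "A \<subseteq> V \<Longrightarrow> (\<Sum>a\<in>A. k a *\<^sub>R a) \<in> V"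
  by (auto intro!: subspace_sum[OF V] subspace_scale[OF V])

text \<open>Plays the part of linear independence of the simple roots: a nontrivial nonnegative
  combination is positive, hence nonzero.\<close>

lemma pos_comb:
  assumes "finite A" "A \<subseteq> V" "\<And>a. a \<in> A \<Longrightarrow> pos a" "\<And>a. a \<in> A \<Longrightarrow> k a \<ge> 0"
  shows "pos (\<Sum>a\<in>A. k a *\<^sub>R a) \<or> (\<forall>a\<in>A. k a = 0)"
  using assms
proof (induction A)
  case (insert x A)
  have xV: "x \<in> V" "pos x" "k x \<ge> 0" and AV: "A \<subseteq> V" using insert by auto
  have IH: "pos (\<Sum>a\<in>A. k a *\<^sub>R a) \<or> (\<forall>a\<in>A. k a = 0)" using insert by auto
  have kx: "pos (k x *\<^sub>R x)" if "k x \<noteq> 0" using pos_scale[of x "k x"] xV that by auto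
  have "pos (k x *\<^sub>R x + (\<Sum>a\<in>A. k a *\<^sub>R a)) \<or> (k x = 0 \<and> (\<forall>a\<in>A. k a = 0))"
  proof (cases "k x = 0")
    case True
    then show ?thesis using IH by auto
  next
    case False
    show ?thesis
    proof (cases "\<forall>a\<in>A. k a = 0")
      case True
      then show ?thesis using kx False by simp
    next
      case F: False
      then show ?thesis using IH kx[OF False] pos_add[of "k x *\<^sub>R x"] xV comb_V[OF AV] V
        by (auto simp: subspace_scale)
    qed
  qed
  then show ?case using insert by simp
qed simp

lemma simple_comb:
  assumes "b \<in> \<Phi>" "pos b"
  shows "\<exists>k :: 'a \<Rightarrow> nat. b = (\<Sum>a\<in>\<Delta>. real (k a) *\<^sub>R a)"
  using assms
proof (induction "height b" arbitrary: b rule: less_induct)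
  case less
  show ?case
  proof (cases "b \<in> \<Delta>")
    case True
    then have "b = (\<Sum>a\<in>\<Delta>. real (if a = b then 1 else 0) *\<^sub>R a)"
      by (simp add: if_distrib[of real] if_distrib[of "\<lambda>c. c *\<^sub>R _"] finite_simple cong: if_cong)
    then show ?thesis by (intro exI)
  next
    case False
    then obtain c d where cd: "c \<in> \<Phi>" "d \<in> \<Phi>" "pos c" "pos d" "b = c + d"
      using less by (auto simp: \<Delta>_def)
    then have "height c < height b" "height d < height b" using height_less less by auto
    then obtain k l where "c = (\<Sum>a\<in>\<Delta>. real (k a) *\<^sub>R a)" "d = (\<Sum>a\<in>\<Delta>. real (l a) *\<^sub>R a)"
      using less.hyps[of c] less.hyps[of d] cd by metis
    then have "b = (\<Sum>a\<in>\<Delta>. real (k a + l a) *\<^sub>R a)"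
      using cd by (simp add: scaleR_add_left sum.distrib)
    then show ?thesis by (intro exI)
  qed
qed

text \<open>Were the image negative, the expansions of \<open>b\<close> and of minus the image would
  add up to a multiple of \<open>a\<close>. By obtuseness this forces \<open>b\<close> to be a
  multiple of \<open>a\<close>, and integrality with reducedness leaves only
  \<open>b = a\<close>.\<close>

lemma reflect_simple_pos:
  assumes b: "b \<in> \<Phi>" "pos b" and a: "a \<in> \<Delta>" and "b \<noteq> a"
  shows "pos (b - (2 * ip b a / ip a a) *\<^sub>R a)"
proof (rule ccontr)
  define c where "c = 2 * ip b a / ip a a"
  define b' where "b' = b - c *\<^sub>R a"
  have a': "a \<in> \<Phi>" "ip a a > 0" using a simple_root root_ip_pos by auto
  have \<Delta>V: "\<Delta> \<subseteq> V" using simple_root root_V by auto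
  have b': "b' \<in> \<Phi>" unfolding b'_def c_def using reflect a' b by auto
  assume "\<not> pos (b - (2 * ip b a / ip a a) *\<^sub>R a)"
  then have "pos (- b')" using pos_total[of b'] b' root_V zero_not_root by (metis b'_def c_def)
  then obtain k l :: "'a \<Rightarrow> nat" where k: "b = (\<Sum>x\<in>\<Delta>. real (k x) *\<^sub>R x)" and l: "- b' = (\<Sum>x\<in>\<Delta>. real (l x) *\<^sub>R x)"
    using simple_comb b neg_root[OF b'] by metis
  define w where "w = (\<Sum>x\<in>\<Delta> - {a}. (real (k x) + real (l x)) *\<^sub>R x)"
  define d where "d = c - real (k a) - real (l a)"
  have "c *\<^sub>R a = b + (- b')" by (simp add: b'_def)
  also have "\<dots> = (\<Sum>x\<in>\<Delta>. (real (k x) + real (l x)) *\<^sub>R x)"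
    unfolding k l by (simp add: scaleR_add_left sum.distrib)
  also have "\<dots> = (real (k a) + real (l a)) *\<^sub>R a + w"
    unfolding w_def using a finite_simple by (simp add: sum.remove)
  finally have dw: "d *\<^sub>R a = w" by (simp add: d_def algebra_simps)
  have "ip w a \<le> 0" unfolding w_def ip_sum_left
    using simple_obtuse a by (auto simp: ip_simps intro!: sum_nonpos mult_nonneg_nonpos)
  then have "d \<le> 0" unfolding dw[symmetric] using a' by (simp add: ip_simps mult_le_0_iff)
  \<comment> \<open>Moving \<open>d *\<^sub>R a\<close> to the other side gives a vanishing
    combination whose coefficients are all nonnegative because \<open>d\<close> is not positive, so
    \<open>pos_comb\<close> makes each of them zero.\<close>
  define q where "q = (\<lambda>x. if x = a then - d else real (k x) + real (l x))"
  have "(\<Sum>x\<in>\<Delta>. q x *\<^sub>R x) = - d *\<^sub>R a + w"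
    unfolding w_def using a finite_simple by (auto simp: sum.remove q_def intro!: sum.cong)
  also have "\<dots> = 0" using dw by simp
  finally have "\<forall>x\<in>\<Delta>. q x = 0"
    using pos_comb[OF finite_simple \<Delta>V simple_pos, of q] \<open>d \<le> 0\<close> not_pos_0 by (auto simp: q_def)
  then have q0: "q x = 0" if "x \<in> \<Delta>" for x using that by blast
  have "k x = 0" if "x \<in> \<Delta> - {a}" for x
    using q0[of x] that by (simp add: q_def add_nonneg_eq_0_iff)
  then have "(\<Sum>x\<in>\<Delta> - {a}. real (k x) *\<^sub>R x) = 0" by (intro sum.neutral) simp
  then have ba: "b = real (k a) *\<^sub>R a" by (subst k) (simp add: sum.remove[OF finite_simple a])
  then have k0: "k a \<noteq> 0" using b(1) zero_not_root by (metis of_nat_0 scaleR_zero_left)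
  \<comment> \<open>The opposite Cartan integer restricts the multiple to 1 or 2; the value 1
    contradicts \<open>b \<noteq> a\<close>, the value 2 contradicts \<open>reduced\<close>.\<close>
  have "2 * ip a b / ip b b = 2 / real (k a)" unfolding ba using k0 a' by (simp add: ip_simps)
  then have i: "2 / real (k a) \<in> \<int>" using cartan_int[of b a] b a' by auto
  then have "2 / real (k a) \<ge> 1" using Ints_ge_1 k0 by auto
  then have "k a \<le> 2" using k0 by (simp add: field_simps)
  then have "k a = 1 \<or> k a = 2" using k0 by auto
  then show False using ba assms reduced[of a] a' by auto
qed

lemma exists_acute_simple:
  assumes "b \<in> \<Phi>" "pos b"
  shows "\<exists>a\<in>\<Delta>. ip b a > 0"
proof (rule ccontr)
  assume *: "\<not> ?thesis"
  obtain k :: "'a \<Rightarrow> nat" where k: "b = (\<Sum>x\<in>\<Delta>. real (k x) *\<^sub>R x)" using simple_comb assms by blast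
  have "ip b b = (\<Sum>x\<in>\<Delta>. real (k x) * ip x b)"
    by (subst (1) k) (simp add: ip_sum_left ip_simps)
  also have "\<dots> \<le> 0" using * by (intro sum_nonpos) (auto simp: ip_commute[of _ b] not_less mult_nonneg_nonpos)
  finally show False using root_ip_pos assms by force
qed

text \<open>A simple root acute to \<open>b\<close> lowers it by a reflection that keeps it
  positive. Unlike a splitting of \<open>b\<close> into a sum of positive roots, such a step
  preserves lengths, which the passage to coroots relies on.\<close>

lemma pos_root_induct [consumes 2, case_names simple step]:
  assumes "b \<in> \<Phi>" "pos b"
    and simple: "\<And>a. a \<in> \<Delta> \<Longrightarrow> P a"
    and step: "\<And>a b c. a \<in> \<Delta> \<Longrightarrow> b \<in> \<Phi> \<Longrightarrow> pos b \<Longrightarrow> c = 2 * ip b a / ip a a \<Longrightarrow> ip b a > 0 \<Longrightarrow>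
       b - c *\<^sub>R a \<in> \<Phi> \<Longrightarrow> P (b - c *\<^sub>R a) \<Longrightarrow> P b"
  shows "P b"
  using assms(1,2)
proof (induction "height b" arbitrary: b rule: less_induct)
  case (less b)
  show ?case
  proof (cases "b \<in> \<Delta>")
    case False
    obtain a where a: "a \<in> \<Delta>" "ip b a > 0" using exists_acute_simple less by blast
    define c where "c = 2 * ip b a / ip a a"
    have c: "c > 0" using a root_ip_pos simple_root by (auto simp: c_def)
    have b': "b - c *\<^sub>R a \<in> \<Phi>" "pos (b - c *\<^sub>R a)"
      using reflect[of a b] reflect_simple_pos[of b a] less a False simple_root by (auto simp: c_def)
    moreover have "pos (b - (b - c *\<^sub>R a))" using pos_scale c a simple_root simple_pos root_V by auto
    ultimately have "P (b - c *\<^sub>R a)" using height_less less by blast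
    then show ?thesis using step[OF a(1) less.prems c_def a(2) b'(1)] by blast
  qed (use simple in auto)
qed

section \<open>Coroots and their expansion in simple coroots\<close>

definition coroot :: "'a \<Rightarrow> 'a" where
  "coroot a = (2 / ip a a) *\<^sub>R a"

text \<open>The coefficients of a root do not carry over to its coroot, since roots differ in
  length. Along the descent, however, the length is constant, and each step changes the coroot by a
  positive integral multiple of a simple coroot.\<close>

lemma coroot_comb:
  assumes "b \<in> \<Phi>" "pos b"
  shows "\<exists>k :: 'a \<Rightarrow> nat. coroot b = (\<Sum>a\<in>\<Delta>. real (k a) *\<^sub>R coroot a)"
  using assms
proof (induction rule: pos_root_induct)
  case (simple b)
  then have "coroot b = (\<Sum>a\<in>\<Delta>. real (if a = b then 1 else 0) *\<^sub>R coroot a)"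
    by (simp add: if_distrib[of real] if_distrib[of "\<lambda>c. c *\<^sub>R _"] finite_simple cong: if_cong)
  then show ?case by (intro exI)
next
  case (step a b c)
  define b' where "b' = b - c *\<^sub>R a"
  have pa: "ip a a > 0" "ip b b > 0" using step simple_root root_ip_pos by auto
  have bb: "ip b' b' = ip b b"
    unfolding b'_def step(4) using pa by (simp add: ip_simps ip_commute[of a b] field_simps)
  obtain k :: "'a \<Rightarrow> nat" where k: "coroot b' = (\<Sum>a\<in>\<Delta>. real (k a) *\<^sub>R coroot a)" using step b'_def by blast
  \<comment> \<open>As \<open>b\<close> and \<open>b'\<close> have equal length, the coefficient of
    \<open>coroot a\<close> in the difference of their coroots is the Cartan integer with the two
    roots exchanged.\<close>
  define e where "e = 2 * ip a b / ip b b"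
  have "e \<in> \<int>" "e > 0" using step simple_root cartan_int[of b a] pa by (auto simp: e_def ip_commute[of a b])
  then obtain m where m: "e = real m" by (metis Ints_cases nonneg_int_cases of_int_0_less_iff of_int_of_nat_eq order_less_imp_le)
  have "coroot b = (2 / ip b b) *\<^sub>R (b' + c *\<^sub>R a)" by (simp add: coroot_def b'_def)
  also have "\<dots> = coroot b' + e *\<^sub>R coroot a"
    using pa by (simp add: coroot_def bb e_def step(4) algebra_simps ip_commute[of a b])
  also have "\<dots> = (\<Sum>x\<in>\<Delta>. real (k x + (if x = a then m else 0)) *\<^sub>R coroot x)"
    unfolding k m using step(1) by (simp add: scaleR_add_left sum.distrib if_distrib[of real] if_distrib[of "\<lambda>c. c *\<^sub>R _"] finite_simple cong: if_cong)
  finally show ?case by (intro exI)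
qed

text \<open>A simple root used in the descent is not orthogonal to the root it produces, so both
  belong to the same side of an orthogonal splitting of the simple roots. Such a splitting therefore
  separates all roots.\<close>

lemma simple_irreducible:
  assumes J: "J \<subseteq> \<Delta>" "J \<noteq> {}" and orth: "\<And>a b. a \<in> J \<Longrightarrow> b \<in> \<Delta> - J \<Longrightarrow> ip a b = 0"
  shows "J = \<Delta>"
proof -
  have span_orth: "ip x y = 0" if x: "x \<in> span J" and y: "y \<in> span (\<Delta> - J)" for x y
  proof -
    have 1: "ip z y = 0" if "z \<in> J" for z
      using y
    proof (induction rule: span_induct)
      case base
      then show ?case by (auto simp: subspace_def ip_simps)
    next
      case (step w)
      then show ?case using orth that by auto
    qed
    show ?thesis using x
    proof (induction rule: span_induct)
      case base
      then show ?case by (auto simp: subspace_def ip_simps)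
    next
      case (step w)
      then show ?case using 1 by auto
    qed
  qed
  have split: "b \<in> span J \<union> span (\<Delta> - J)" if "b \<in> \<Phi>" "pos b" for b
    using that
  proof (induction rule: pos_root_induct)
    case (simple a)
    then show ?case by (cases "a \<in> J") (auto simp: span_base)
  next
    case (step a b c)
    have aa: "ip a a > 0" using step simple_root root_ip_pos by auto
    have n: "ip (b - c *\<^sub>R a) a \<noteq> 0"
      using step(4,5) aa by (simp add: ip_simps field_simps)
    show ?case
    proof (cases "a \<in> J")
      case True
      then have a: "a \<in> span J" by (simp add: span_base)
      then have "b - c *\<^sub>R a \<notin> span (\<Delta> - J)" using n span_orth ip_commute by metis
      then have "b - c *\<^sub>R a \<in> span J" using step(7) by blast
      then have "b - c *\<^sub>R a + c *\<^sub>R a \<in> span J" using a by (intro span_add span_scale)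
      then show ?thesis by simp
    next
      case False
      then have a: "a \<in> span (\<Delta> - J)" using step(1) by (simp add: span_base)
      then have "b - c *\<^sub>R a \<notin> span J" using n span_orth by metis
      then have "b - c *\<^sub>R a \<in> span (\<Delta> - J)" using step(7) by blast
      then have "b - c *\<^sub>R a + c *\<^sub>R a \<in> span (\<Delta> - J)" using a by (intro span_add span_scale)
      then show ?thesis by simp
    qed
  qed
  have "b \<in> span J \<union> span (\<Delta> - J)" if "b \<in> \<Phi>" for b
  proof -
    have "pos b \<or> pos (- b)"
      by (metis pos_total that root_V zero_not_root)
    then show ?thesis
    proof
      assume "pos (- b)"
      then have "- b \<in> span J \<union> span (\<Delta> - J)" by (rule split[OF neg_root[OF that]])
      then have "- (- b) \<in> span J \<union> span (\<Delta> - J)" by (blast intro: span_neg)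
      then show ?thesis by simp
    qed (rule split[OF that])
  qed
  then have "(\<Phi> \<inter> span J) \<union> (\<Phi> \<inter> span (\<Delta> - J)) = \<Phi>" by auto
  then have "\<Phi> \<inter> span J = {} \<or> \<Phi> \<inter> span (\<Delta> - J) = {}"
    by (rule irreducible) (use span_orth in auto)
  moreover have "J \<subseteq> \<Phi> \<inter> span J" "\<Delta> - J \<subseteq> \<Phi> \<inter> span (\<Delta> - J)"
    using J(1) simple_root by (auto intro: span_base)
  ultimately have "\<Delta> - J = {}" using J(2) by blast
  then show ?thesis using J by auto
qed

section \<open>Dominant roots and root lengths\<close>

definition dominant :: "'a \<Rightarrow> bool" where
  "dominant x \<longleftrightarrow> (\<forall>a\<in>\<Phi>. pos a \<longrightarrow> ip x a \<ge> 0)"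

lemma reflect_ip:
  assumes "a \<in> \<Phi>"
  shows "ip (x - (2 * ip x a / ip a a) *\<^sub>R a) (x - (2 * ip x a / ip a a) *\<^sub>R a) = ip x x"
  using root_ip_pos[OF assms] by (simp add: ip_simps ip_commute[of a x] field_simps)

text \<open>Reflecting \<open>R\<close> in a positive root obtuse to it adds a positive multiple of
  that root. Only roots of the length of \<open>R\<close> are compared, so this applies both to the
  highest root and to the greatest of the longest roots.\<close>

lemma dominantI:
  assumes R: "R \<in> \<Phi>" and le: "\<And>Q. Q \<in> \<Phi> \<Longrightarrow> ip Q Q = ip R R \<Longrightarrow> Q \<noteq> R \<Longrightarrow> \<not> pos (Q - R)"
  shows "dominant R"
proof (rule ccontr)
  assume "\<not> dominant R"
  then obtain a where a: "a \<in> \<Phi>" "pos a" "ip R a < 0" by (auto simp: dominant_def)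
  define c where "c = 2 * ip R a / ip a a"
  have c: "c < 0" using a root_ip_pos by (auto simp: c_def divide_less_0_iff)
  let ?Q = "R - c *\<^sub>R a"
  have "?Q \<in> \<Phi>" "ip ?Q ?Q = ip R R" using reflect reflect_ip a R by (auto simp: c_def)
  moreover have "pos (?Q - R)" using pos_scale[of a "- c"] a c root_V by auto
  moreover have "?Q \<noteq> R" using calculation(3) not_pos_0 by force
  ultimately show False using le[of ?Q] by blast
qed

lemma highest_dominant: "dominant S"
proof (rule dominantI)
  fix Q assume Q: "Q \<in> \<Phi>" "Q \<noteq> S"
  then have "pos (S - Q)" using highest by auto
  then show "\<not> pos (Q - S)" using not_pos_neg[of "S - Q"] Q highest root_V V by (auto simp: subspace_diff)
qed (use highest in auto)

lemma dominant_pos: "R \<in> \<Phi> \<Longrightarrow> dominant R \<Longrightarrow> pos R"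
  using pos_total[of R] root_V zero_not_root neg_root[of R] root_ip_pos[of R]
  by (force simp: dominant_def ip_simps)

text \<open>At a simple root \<open>b\<close> with coefficient zero every term of
  \<open>ip R b\<close> is nonpositive by obtuseness, while dominance makes the sum nonnegative. All
  terms vanish, so the support is orthogonal to the other simple roots.\<close>

lemma dominant_support:
  assumes R: "R \<in> \<Phi>" "dominant R" and k: "R = (\<Sum>a\<in>\<Delta>. real (k a) *\<^sub>R a)" and "a \<in> \<Delta>"
  shows "k a > 0"
proof -
  define J where "J = {a\<in>\<Delta>. k a > 0}"
  have "J = \<Delta>"
  proof (rule simple_irreducible)
    show "J \<noteq> {}"
    proof
      assume "J = {}"
      then have "R = 0" unfolding k by (intro sum.neutral) (auto simp: J_def)
      then show False using R zero_not_root by auto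
    qed
  next
    fix a b assume a: "a \<in> J" and b: "b \<in> \<Delta> - J"
    have le: "real (k x) * ip x b \<le> 0" if "x \<in> \<Delta>" for x
      using simple_obtuse[OF that, of b] b by (cases "x = b") (auto simp: J_def mult_nonneg_nonpos)
    have "ip R b = (\<Sum>x\<in>\<Delta>. real (k x) * ip x b)"
      by (subst k) (simp add: ip_sum_left ip_simps)
    moreover have "ip R b \<ge> 0" using R b simple_root simple_pos by (auto simp: dominant_def)
    ultimately have "(\<Sum>x\<in>\<Delta>. real (k x) * ip x b) = 0"
      using sum_nonpos[of \<Delta> "\<lambda>x. real (k x) * ip x b"] le by auto
    then have "(\<Sum>x\<in>\<Delta>. - (real (k x) * ip x b)) = 0" by (simp add: sum_negf)
    then have "\<forall>x\<in>\<Delta>. - (real (k x) * ip x b) = 0"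
      by (subst (asm) sum_nonneg_eq_0_iff) (use le finite_simple in auto)
    then show "ip a b = 0" using a by (auto simp: J_def)
  qed (auto simp: J_def)
  then show ?thesis using \<open>a \<in> \<Delta>\<close> unfolding J_def by blast
qed

text \<open>Compare \<open>S\<close> with a dominant root \<open>R\<close> of maximal length: irreducibility gives \<open>ip R S > 0\<close>, so \<open>S - R\<close>
  is \<open>0\<close> or a positive root, and dominance of both makes \<open>S\<close> at least as long as \<open>R\<close>.\<close>

lemma highest_longest:
  assumes "Q \<in> \<Phi>"
  shows "ip Q Q \<le> ip S S"
proof -
  define M where "M = {R\<in>\<Phi>. \<forall>Q\<in>\<Phi>. ip Q Q \<le> ip R R}"
  have "finite M" using finite_roots by (auto simp: M_def)
  have "Max ((\<lambda>x. ip x x) ` \<Phi>) \<in> (\<lambda>x. ip x x) ` \<Phi>" using finite_roots assms by (intro Max_in) auto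
  then obtain R0 where "R0 \<in> \<Phi>" "ip R0 R0 = Max ((\<lambda>x. ip x x) ` \<Phi>)" by auto
  then have "R0 \<in> M" using finite_roots by (auto simp: M_def)
  \<comment> \<open>Among the longest roots the greatest one is dominant by
    \<open>dominantI\<close>; \<open>height\<close> serves to select it.\<close>
  have "Max (height ` M) \<in> height ` M" using \<open>finite M\<close> \<open>R0 \<in> M\<close> by (intro Max_in) auto
  then obtain R where R: "R \<in> M" "height R = Max (height ` M)" by auto
  then have R\<Phi>: "R \<in> \<Phi>" and Rmax: "\<And>Q. Q \<in> \<Phi> \<Longrightarrow> ip Q Q \<le> ip R R" by (auto simp: M_def)
  have dom: "dominant R"
  proof (rule dominantI)
    fix Q assume Q: "Q \<in> \<Phi>" "ip Q Q = ip R R"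
    then have "Q \<in> M" using R by (auto simp: M_def)
    then have "height Q \<le> height R" using \<open>finite M\<close> R by auto
    then show "\<not> pos (Q - R)" using height_less[of R Q] Q R\<Phi> by auto
  qed (use R\<Phi> in auto)
  have "ip R R \<le> ip S S"
  proof (cases "R = S")
    case False
    obtain k :: "'a \<Rightarrow> nat" where k: "R = (\<Sum>a\<in>\<Delta>. real (k a) *\<^sub>R a)" using simple_comb dominant_pos dom R\<Phi> by metis
    obtain a where a: "a \<in> \<Delta>" "ip S a > 0" using exists_acute_simple dominant_pos highest(1) highest_dominant by blast
    \<comment> \<open>All terms are nonnegative because \<open>S\<close> is dominant, and the term
      of the acute simple root is positive because no coefficient of \<open>R\<close>
      vanishes.\<close>
    have "ip R S = (\<Sum>a\<in>\<Delta>. real (k a) * ip a S)"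
      by (subst k) (simp add: ip_sum_left ip_simps)
    also have "\<dots> > 0"
    proof (rule sum_pos2[OF finite_simple a(1)])
      show "0 < real (k a) * ip a S" using a dominant_support[OF R\<Phi> dom k a(1)] by (simp add: ip_commute[of a])
      fix i assume "i \<in> \<Delta>"
      then show "0 \<le> real (k i) * ip i S" using highest_dominant simple_root simple_pos
        by (auto simp: dominant_def ip_commute[of i])
    qed
    finally have RS: "ip S R > 0" by (simp add: ip_commute)
    then have "S - R \<in> \<Phi>" "pos (S - R)" using diff_root highest R\<Phi> False by auto
    then have "ip R (S - R) \<ge> 0" "ip S (S - R) \<ge> 0" using dom highest_dominant by (auto simp: dominant_def)
    then show ?thesis by (simp add: ip_simps ip_commute[of R S])
  qed auto
  then show ?thesis using Rmax[OF assms] by linarith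
qed

text \<open>Let \<open>x\<close> be a root not orthogonal to some longest root \<open>Q\<close>. It
  is a multiple of the difference of \<open>Q\<close> and its reflection in \<open>x\<close>, both
  longest, so a root orthogonal to all longest roots is orthogonal to \<open>x\<close>.
  Irreducibility excludes such roots, and the sign is adjusted by passing to
  \<open>- Q\<close>.\<close>

lemma exists_long_acute:
  assumes b: "b \<in> \<Phi>"
  shows "\<exists>Q\<in>\<Phi>. ip Q Q = ip S S \<and> ip b Q > 0"
proof -
  define A where "A = {b\<in>\<Phi>. \<exists>Q\<in>\<Phi>. ip Q Q = ip S S \<and> ip b Q \<noteq> 0}"
  have "A = {} \<or> \<Phi> - A = {}"
  proof (rule irreducible)
    show "A \<union> (\<Phi> - A) = \<Phi>" by (auto simp: A_def)
    fix x y assume x: "x \<in> A" and y: "y \<in> \<Phi> - A"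
    then obtain Q where Q: "Q \<in> \<Phi>" "ip Q Q = ip S S" "ip x Q \<noteq> 0" "x \<in> \<Phi>" by (auto simp: A_def)
    define c where "c = 2 * ip Q x / ip x x"
    have c: "c \<noteq> 0" using Q root_ip_pos[OF Q(4)] by (simp add: c_def ip_commute[of Q x])
    have "ip y Q = 0" "ip y (Q - c *\<^sub>R x) = 0"
      using y Q reflect[OF Q(4,1)] reflect_ip[OF Q(4), of Q] by (auto simp: A_def c_def)
    then show "ip x y = 0" using c by (simp add: ip_simps ip_commute[of x])
  qed
  moreover have "S \<in> A" using highest root_ip_pos[of S] by (auto simp: A_def)
  ultimately obtain Q where Q: "Q \<in> \<Phi>" "ip Q Q = ip S S" "ip b Q \<noteq> 0" using b by (auto simp: A_def)
  have "ip b (- Q) = - ip b Q" "ip (- Q) (- Q) = ip Q Q" by (simp_all add: ip_simps)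
  then have "ip b (- Q) > 0 \<and> ip (- Q) (- Q) = ip S S" if "\<not> ip b Q > 0" using that Q by simp
  then show ?thesis using Q neg_root[of Q] by blast
qed

text \<open>The Cartan integer of \<open>b\<close> relative to an acute long root is 1 unless
  \<open>b\<close> is that root; when it is 1, the ratio of the squared lengths is the opposite
  Cartan integer.\<close>

lemma long_ratio_Ints:
  assumes b: "b \<in> \<Phi>"
  shows "ip S S / ip b b \<in> \<int>"
proof -
  obtain Q where Q: "Q \<in> \<Phi>" "ip Q Q = ip S S" "ip b Q > 0" using exists_long_acute b by blast
  define m where "m = 2 * ip b Q / ip Q Q"
  have pp: "ip b b > 0" "ip Q Q > 0" using b Q(1) root_ip_pos by blast+
  have m: "m \<in> \<int>" "m > 0" using cartan_int[OF Q(1) b] Q pp by (auto simp: m_def)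
  consider "m = 1" | "m \<ge> 2" using Ints_ge_2 m by blast
  then show ?thesis
  proof cases
    case 1
    then have "ip S S / ip b b = 2 * ip Q b / ip b b" using pp by (simp add: m_def Q ip_commute[of Q b] field_simps)
    then show ?thesis using cartan_int b Q by auto
  next
    case 2
    then have "ip Q Q \<le> ip b Q" using pp by (simp add: m_def field_simps)
    moreover have "ip b b \<le> ip Q Q" using highest_longest[OF b] Q(2) by simp
    ultimately have "b = Q" by (intro ip_diff_nonpos_eq root_V b Q(1)) simp_all
    then show ?thesis using Q pp by auto
  qed
qed

lemma coroot_lattice_norm_Ints:
  assumes "A \<subseteq> \<Delta>"
  shows "ip (\<Sum>a\<in>A. real (k a) *\<^sub>R coroot a) (\<Sum>a\<in>A. real (k a) *\<^sub>R coroot a) * ip S S / 4 \<in> \<int>"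
proof -
  have "finite A" using assms finite_simple finite_subset by auto
  then show ?thesis using assms
  proof (induction A)
    case empty
    then show ?case by (simp add: ip_simps)
  next
    case (insert a A)
    define v where "v = (\<Sum>a\<in>A. real (k a) *\<^sub>R coroot a)"
    have a: "a \<in> \<Phi>" "ip a a > 0" and A: "A \<subseteq> \<Phi>" using insert simple_root root_ip_pos by auto
    have 1: "ip v v * ip S S / 4 \<in> \<int>" using insert by (auto simp: v_def)
    \<comment> \<open>The mixed term occurs twice in the square, so it needs division by 2 instead
      of 4; each summand is a Cartan integer times a ratio from
      \<open>long_ratio_Ints\<close>.\<close>
    have "ip v (coroot a) * ip S S / 2 = (\<Sum>b\<in>A. real (k b) * (2 * ip b a / ip a a * (ip S S / ip b b)))"
      unfolding v_def ip_sum_left sum_distrib_right sum_divide_distrib using a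
      by (auto intro!: sum.cong simp: ip_simps coroot_def mult_ac)
    also have "\<dots> \<in> \<int>" using a A cartan_int long_ratio_Ints
      by (intro Ints_sum Ints_mult) auto
    finally have 2: "ip v (coroot a) * ip S S / 2 \<in> \<int>" .
    have 3: "ip (coroot a) (coroot a) * ip S S / 4 \<in> \<int>"
      using long_ratio_Ints[OF a(1)] a by (simp add: ip_simps coroot_def)
    have w: "(\<Sum>a\<in>insert a A. real (k a) *\<^sub>R coroot a) = v + real (k a) *\<^sub>R coroot a"
      using insert(1,2) by (simp add: v_def add.commute)
    have e: "ip (v + real (k a) *\<^sub>R coroot a) (v + real (k a) *\<^sub>R coroot a) * ip S S / 4
      = ip v v * ip S S / 4 + real (k a) * (ip v (coroot a) * ip S S / 2) + real (k a) * real (k a) * (ip (coroot a) (coroot a) * ip S S / 4)"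
      by (simp add: ip_simps ip_commute[of "coroot a" v] algebra_simps)
    show ?case unfolding w e by (intro Ints_add Ints_mult Ints_of_nat 1 2 3)
  qed
qed

lemma coroot_lattice_norm_ge:
  assumes "\<exists>a\<in>\<Delta>. k a \<noteq> (0::nat)"
  defines "v \<equiv> (\<Sum>a\<in>\<Delta>. real (k a) *\<^sub>R coroot a)"
  shows "ip v v \<ge> 4 / ip S S"
proof -
  have \<Delta>V: "\<Delta> \<subseteq> V" using simple_root root_V by auto
  have S: "ip S S > 0" using highest root_ip_pos by auto
  have v: "v = (\<Sum>a\<in>\<Delta>. (real (k a) * (2 / ip a a)) *\<^sub>R a)" by (simp add: v_def coroot_def)
  have "v \<in> V" unfolding v by (auto intro!: subspace_sum[OF V] subspace_scale[OF V] simp: simple_root root_V)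
  have "pos v \<or> (\<forall>a\<in>\<Delta>. real (k a) * (2 / ip a a) = 0)"
    unfolding v using root_ip_pos simple_root by (intro pos_comb finite_simple \<Delta>V simple_pos) (auto simp: less_imp_le)
  moreover have "\<not> (\<forall>a\<in>\<Delta>. real (k a) * (2 / ip a a) = 0)" using assms(1) simple_root root_ip_pos by force
  ultimately have "v \<noteq> 0" using not_pos_0 by auto
  then have "ip v v * ip S S / 4 > 0" using ip_pos \<open>v \<in> V\<close> S by auto
  moreover have "ip v v * ip S S / 4 \<in> \<int>" unfolding v_def using coroot_lattice_norm_Ints by auto
  ultimately have "ip v v * ip S S / 4 \<ge> 1" using Ints_ge_1 by blast
  then show ?thesis using S by (simp add: field_simps)
qed

lemma ip_coroot_highest: "ip (coroot S) (coroot S) = 4 / ip S S"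
  using root_ip_pos[OF highest(1)] by (simp add: coroot_def ip_simps)

theorem highest_norm_is_maximum:
  assumes Rs: "distinct Rs" "set Rs = \<Delta>"
  defines "v \<equiv> \<lambda>n. \<Sum>i<length Rs. real (n i) *\<^sub>R (2 *\<^sub>R ((2 * pi / (sqrt (ip (Rs ! i) (Rs ! i)))\<^sup>2) *\<^sub>R Rs ! i))"
  shows "is_maximum
           {4 * pi / sqrt (ip (v n) (v n)) | n. relatively_prime (length Rs) n}
           (sqrt (ip S S))"
proof -
  have S: "ip S S > 0" using highest root_ip_pos by auto
  have \<Delta>: "Rs ! i \<in> \<Delta>" if "i < length Rs" for i using Rs(2) nth_mem[OF that] by simp
  have bij: "bij_betw (\<lambda>i. Rs ! i) {..<length Rs} \<Delta>"
    by (rule bij_betw_nth[OF Rs(1) refl Rs(2)[symmetric]])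
  define w where "w n = (\<Sum>i<length Rs. real (n i) *\<^sub>R coroot (Rs ! i))" for n :: "nat \<Rightarrow> nat"
  have vw: "(\<Sum>i<length Rs. real (n i) *\<^sub>R (2 *\<^sub>R ((2 * pi / (sqrt (ip (Rs ! i) (Rs ! i)))\<^sup>2) *\<^sub>R Rs ! i))) = (2 * pi) *\<^sub>R w n" for n
    unfolding w_def scaleR_sum_right using \<Delta> simple_root root_ip_pos
    by (intro sum.cong) (auto simp: coroot_def less_imp_le)
  have reindex: "(\<Sum>i<length Rs. real (k (Rs ! i)) *\<^sub>R coroot (Rs ! i)) = (\<Sum>a\<in>\<Delta>. real (k a) *\<^sub>R coroot a)" for k :: "'a \<Rightarrow> nat"
    using sum.reindex_bij_betw[OF bij, of "\<lambda>a. real (k a) *\<^sub>R coroot a"] by simp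
  have ge: "ip (w n) (w n) \<ge> 4 / ip S S" if "i < length Rs" "n i \<noteq> 0" for n i
  proof -
    \<comment> \<open>The lattice estimate indexes coefficients by simple roots, the statement by
      positions in \<open>Rs\<close>; distinctness of \<open>Rs\<close> permits the
      translation.\<close>
    define k where "k a = n (the_inv_into {..<length Rs} (\<lambda>i. Rs ! i) a)" for a
    have k: "k (Rs ! i) = n i" if "i < length Rs" for i
      using the_inv_into_f_f[OF bij_betw_imp_inj_on[OF bij]] that by (auto simp: k_def)
    have "w n = (\<Sum>a\<in>\<Delta>. real (k a) *\<^sub>R coroot a)"
      unfolding reindex[symmetric] w_def using k by (auto intro!: sum.cong)
    then show ?thesis using coroot_lattice_norm_ge[of k] \<Delta> k that by metis
  qed
  have val: "4 * pi / sqrt (ip ((2 * pi) *\<^sub>R w n) ((2 * pi) *\<^sub>R w n)) = 2 / sqrt (ip (w n) (w n))" for n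
  proof -
    have "ip ((2 * pi) *\<^sub>R w n) ((2 * pi) *\<^sub>R w n) = (2 * pi)\<^sup>2 * ip (w n) (w n)"
      by (simp add: ip_simps power2_eq_square)
    then show ?thesis by (simp add: real_sqrt_mult)
  qed
  obtain k :: "'a \<Rightarrow> nat" where k: "coroot S = (\<Sum>a\<in>\<Delta>. real (k a) *\<^sub>R coroot a)"
    using coroot_comb highest(1) dominant_pos highest_dominant by metis
  define n where "n i = k (Rs ! i)" for i
  have wn: "w n = coroot S" unfolding k reindex[symmetric] w_def n_def ..
  have rp: "relatively_prime (length Rs) n"
    unfolding relatively_prime_def
  proof
    have "coroot S \<noteq> 0" using S zero_not_root highest(1) by (auto simp: coroot_def)
    then show ex: "\<exists>i<length Rs. n i \<noteq> 0" unfolding wn[symmetric] w_def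
      by (metis (no_types, lifting) lessThan_iff of_nat_0 scaleR_eq_0_iff sum.neutral)
    define d where "d = Gcd {n i |i. i < length Rs \<and> n i \<noteq> 0}"
    have dvd: "d dvd n i" if "i < length Rs" for i
      using that by (cases "n i = 0") (auto simp: d_def intro!: Gcd_dvd)
    have d0: "d > 0" using ex dvd by (metis dvd_0_left_iff gr0I)
    obtain i where i: "i < length Rs" "n i \<noteq> 0" using ex by auto
    \<comment> \<open>Dividing by the common factor \<open>d\<close> leaves a nonzero lattice
      vector, which cannot be shorter than \<open>coroot S\<close>; this bounds \<open>d\<close> by
      1.\<close>
    have "w n = real d *\<^sub>R w (\<lambda>i. n i div d)"
      unfolding w_def scaleR_sum_right using dvd d0
      by (auto intro!: sum.cong simp: real_of_nat_div)
    then have "4 / ip S S = (real d)\<^sup>2 * ip (w (\<lambda>i. n i div d)) (w (\<lambda>i. n i div d))"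
      unfolding ip_coroot_highest[symmetric] wn by (simp add: ip_simps power2_eq_square)
    also have "\<dots> \<ge> (real d)\<^sup>2 * (4 / ip S S)"
      using ge[of i "\<lambda>i. n i div d"] dvd[of i] i d0
      by (intro mult_left_mono) (auto elim!: dvdE)
    finally have "(real d)\<^sup>2 \<le> 1" using S by (simp add: field_simps)
    then have "d \<le> 1" by (simp add: power2_le_iff_abs_le abs_square_le_1)
    then show "Gcd {n i |i. i < length Rs \<and> n i \<noteq> 0} = 1" using d0 by (simp add: d_def)
  qed
  show ?thesis
    unfolding is_maximum_def v_def vw mem_Collect_eq
  proof (intro conjI ballI)
    have "sqrt (ip S S) = 4 * pi / sqrt (ip ((2 * pi) *\<^sub>R w n) ((2 * pi) *\<^sub>R w n))"
      using S by (simp only: val) (simp add: wn ip_coroot_highest real_sqrt_divide)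
    then show "\<exists>n. sqrt (ip S S) = 4 * pi / sqrt (ip ((2 * pi) *\<^sub>R w n) ((2 * pi) *\<^sub>R w n)) \<and> relatively_prime (length Rs) n"
      using rp by blast
  next
    fix y assume "y \<in> {4 * pi / sqrt (ip ((2 * pi) *\<^sub>R w n) ((2 * pi) *\<^sub>R w n)) |n. relatively_prime (length Rs) n}"
    then obtain n where n: "relatively_prime (length Rs) n" "y = 2 / sqrt (ip (w n) (w n))"
      unfolding val by auto
    then obtain i where "i < length Rs" "n i \<noteq> 0" by (auto simp: relatively_prime_def)
    then have "sqrt (4 / ip S S) \<le> sqrt (ip (w n) (w n))" using ge by (intro real_sqrt_le_mono) auto
    then have "2 / sqrt (ip S S) \<le> sqrt (ip (w n) (w n))" by (simp add: real_sqrt_divide)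
    then show "y \<le> sqrt (ip S S)" using S unfolding n
      by (smt (verit) divide_pos_pos mult.commute pos_divide_le_eq real_sqrt_gt_0_iff)
  qed
qed

end

section \<open>The matrix exponential\<close>

text \<open>Telescoping. The exponent \<open>n\<close> in place of \<open>n - 1\<close> avoids a
  special case at zero and is affordable because \<open>M\<close> is at least 1.\<close>

lemma power_diff_norm_le:
  fixes x y :: "'a::real_normed_algebra_1"
  assumes "norm x \<le> M" "norm y \<le> M" "M \<ge> 1"
  shows "norm (x ^ n - y ^ n) \<le> real n * M ^ n * norm (x - y)"
proof (induction n)
  case (Suc n)
  have y: "norm (y ^ n) \<le> M ^ n"
    by (rule order_trans[OF norm_power_ineq power_mono[OF assms(2)]]) simp
  have "x ^ Suc n - y ^ Suc n = x * (x ^ n - y ^ n) + (x - y) * y ^ n"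
    by (simp add: algebra_simps)
  then have "norm (x ^ Suc n - y ^ Suc n) \<le> norm x * norm (x ^ n - y ^ n) + norm (x - y) * norm (y ^ n)"
    by (metis add_mono norm_mult_ineq norm_triangle_le)
  also have "\<dots> \<le> M * (real n * M ^ n * norm (x - y)) + norm (x - y) * M ^ n"
    using assms Suc y by (intro add_mono mult_mono) auto
  also have "\<dots> \<le> M * (real n * M ^ n * norm (x - y)) + norm (x - y) * (M * M ^ n)"
    using assms by (intro add_left_mono mult_left_mono) (auto intro: order_trans[OF _ mult_right_mono[of 1 M]])
  also have "\<dots> = real (Suc n) * M ^ Suc n * norm (x - y)" by (simp add: algebra_simps)
  finally show ?case .
qed simp

text \<open>Tangent vectors reach the Lie algebra as limits of difference quotients along sequences,
  hence the sequential form.\<close>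

lemma vector_derivative_quotient:
  assumes D: "(f has_vector_derivative D) (at (x::real))" and r: "r \<longlonglongrightarrow> 0" "\<And>k. r k \<noteq> 0"
  shows "(\<lambda>k. (1 / r k) *\<^sub>R (f (x + r k) - f x)) \<longlonglongrightarrow> D"
proof -
  have "((\<lambda>h. norm (f (x + h) - f x - h *\<^sub>R D) / norm h) \<longlongrightarrow> 0) (at 0)"
    using D by (simp add: has_vector_derivative_def has_derivative_at)
  moreover have "filterlim r (at 0) sequentially"
    using r by (simp add: filterlim_at)
  ultimately have "(\<lambda>k. norm (f (x + r k) - f x - r k *\<^sub>R D) / norm (r k)) \<longlonglongrightarrow> 0"
    by (rule filterlim_compose)
  moreover have "norm (f (x + r k) - f x - r k *\<^sub>R D) / norm (r k) = norm ((1 / r k) *\<^sub>R (f (x + r k) - f x) - D)" for k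
  proof -
    have "(1 / r k) *\<^sub>R (f (x + r k) - f x) - D = (1 / r k) *\<^sub>R (f (x + r k) - f x - r k *\<^sub>R D)"
      using r by (simp add: scaleR_diff_right)
    then show ?thesis by (simp add: divide_inverse_commute)
  qed
  ultimately show ?thesis by (simp add: tendsto_norm_zero_iff LIM_zero_iff)
qed

lemma exp_of_nat_scaleR:
  fixes x :: "'a::{real_normed_algebra_1,banach}"
  shows "exp (real n *\<^sub>R x) = exp x ^ n"
  by (induction n) (simp_all add: scaleR_add_left exp_add_commuting)

text \<open>In the library \<^term>\<open>exp\<close> is shown to be continuous on fields only.\<close>

lemma exp_diff_norm_le:
  fixes x y :: "'a::{real_normed_algebra_1,banach}"
  assumes "norm x \<le> M" "norm y \<le> M" "M \<ge> 1"
  shows "norm (exp x - exp y) \<le> exp (2 * M) * norm (x - y)"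
proof -
  have le: "norm (x ^ n /\<^sub>R fact n - y ^ n /\<^sub>R fact n) \<le> (2 * M) ^ n /\<^sub>R fact n * norm (x - y)" for n
  proof -
    \<comment> \<open>The factor \<open>n\<close> of the power estimate is absorbed into
      \<open>2 ^ n\<close>, which is the origin of the 2 in \<open>exp (2 * M)\<close>.\<close>
    have "real n * M ^ n \<le> 2 ^ n * M ^ n"
      using assms of_nat_less_two_power[of n, where 'a = real] by (intro mult_right_mono) auto
    then have "real n * M ^ n * norm (x - y) \<le> (2 * M) ^ n * norm (x - y)"
      by (intro mult_right_mono) (auto simp: power_mult_distrib)
    then have "norm (x ^ n - y ^ n) \<le> (2 * M) ^ n * norm (x - y)"
      using power_diff_norm_le[OF assms, of n] by linarith
    then have "norm (x ^ n - y ^ n) / fact n \<le> (2 * M) ^ n * norm (x - y) / fact n"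
      by (rule divide_right_mono) simp
    moreover have "norm (x ^ n /\<^sub>R fact n - y ^ n /\<^sub>R fact n) = norm (x ^ n - y ^ n) / fact n"
      unfolding scaleR_diff_right[symmetric] norm_scaleR by (simp add: divide_inverse mult.commute)
    ultimately show ?thesis by (simp only: real_scaleR_def) (simp add: divide_inverse mult_ac)
  qed
  have "exp x - exp y = (\<Sum>n. x ^ n /\<^sub>R fact n - y ^ n /\<^sub>R fact n)"
    unfolding exp_def by (rule suminf_diff) (rule summable_exp_generic)+
  also have "norm \<dots> \<le> (\<Sum>n. (2 * M) ^ n /\<^sub>R fact n * norm (x - y))"
    by (rule norm_suminf_le[OF le summable_mult2[OF summable_exp_generic]])
  also have "\<dots> = exp (2 * M) * norm (x - y)"
    unfolding exp_def by (rule suminf_mult2[symmetric, OF summable_exp_generic])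
  finally show ?thesis .
qed

lemma tendsto_exp_banach:
  fixes f :: "_ \<Rightarrow> 'a::{real_normed_algebra_1,banach}"
  assumes "(f \<longlongrightarrow> a) F"
  shows "((\<lambda>x. exp (f x)) \<longlongrightarrow> exp a) F"
proof -
  define M where "M = norm a + 1"
  have "\<forall>\<^sub>F x in F. dist (f x) a < 1" using tendstoD[OF assms, of 1] by simp
  then have "\<forall>\<^sub>F x in F. norm (exp (f x) - exp a) \<le> exp (2 * M) * norm (f x - a)"
  proof eventually_elim
    case (elim x)
    then have "norm (f x) \<le> M" using norm_triangle_sub[of "f x" a] by (simp add: M_def dist_norm)
    then show ?case by (intro exp_diff_norm_le) (auto simp: M_def)
  qed
  moreover have "((\<lambda>x. exp (2 * M) * norm (f x - a)) \<longlongrightarrow> exp (2 * M) * norm (a - a)) F"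
    by (intro tendsto_intros assms)
  then have "((\<lambda>x. exp (2 * M) * norm (f x - a)) \<longlongrightarrow> 0) F" by simp
  ultimately have "((\<lambda>x. exp (f x) - exp a) \<longlongrightarrow> 0) F"
    by (rule Lim_null_comparison)
  then show ?thesis by (simp add: LIM_zero_iff)
qed

text \<open>Compare \<open>g k\<close> with \<open>h k = exp (r k *\<^sub>R B)\<close>. Both have
  norm at most \<open>exp (r k * K)\<close> and differ by o(\<open>r k\<close>), so their powers
  differ by a bounded factor times \<open>n k * r k\<close> times a null sequence.\<close>

lemma power_tendsto_exp:
  fixes g :: "nat \<Rightarrow> 'a::{real_normed_algebra_1,banach}"
  assumes r: "r \<longlonglongrightarrow> 0" "\<And>k. r k > 0"
    and B: "(\<lambda>k. (1 / r k) *\<^sub>R (g k - 1)) \<longlonglongrightarrow> B"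
    and s: "(\<lambda>k. real (n k) * r k) \<longlonglongrightarrow> s"
  shows "(\<lambda>k. g k ^ n k) \<longlonglongrightarrow> exp (s *\<^sub>R B)"
proof -
  have r0: "r k \<noteq> 0" for k using r(2)[of k] by simp
  obtain C where C: "\<And>k. norm ((1 / r k) *\<^sub>R (g k - 1)) \<le> C"
    using convergent_imp_bounded[OF B] by (auto simp: bounded_iff)
  define K where "K = max C (norm B)"
  define h where "h k = exp (r k *\<^sub>R B)" for k
  define M where "M k = exp (r k * K)" for k
  have K: "K \<ge> 0" "norm B \<le> K" by (auto simp: K_def le_max_iff_disj)
  have M1: "M k \<ge> 1" for k using r(2)[of k] K by (simp add: M_def less_imp_le)
  have h: "norm (h k) \<le> M k" for k
  proof -
    have "norm (r k *\<^sub>R B) \<le> r k * K" using r(2)[of k] K by (simp add: mult_left_mono)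
    then show ?thesis unfolding h_def M_def using norm_exp[of "r k *\<^sub>R B"] by (meson exp_le_cancel_iff order_trans)
  qed
  have g: "norm (g k) \<le> M k" for k
  proof -
    have "g k = 1 + r k *\<^sub>R ((1 / r k) *\<^sub>R (g k - 1))" using r0 by simp
    then have "norm (g k) \<le> 1 + norm (r k *\<^sub>R ((1 / r k) *\<^sub>R (g k - 1)))"
      by (metis norm_one norm_triangle_ineq)
    also have "\<dots> \<le> 1 + r k * K"
      using C[of k] r(2)[of k] unfolding norm_scaleR[of "r k"]
      by (intro add_left_mono mult_mono) (auto simp: K_def le_max_iff_disj)
    also have "\<dots> \<le> M k" unfolding M_def by (rule exp_ge_add_one_self)
    finally show ?thesis .
  qed
  have lin: "norm (g k - h k) = r k * norm ((1 / r k) *\<^sub>R (g k - 1) - (1 / r k) *\<^sub>R (h k - 1))" for k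
    using r(2)[of k] unfolding scaleR_diff_right[symmetric] by simp
  have "norm (g k ^ n k - h k ^ n k) \<le>
      (real (n k) * r k) * exp ((real (n k) * r k) * K) * norm ((1 / r k) *\<^sub>R (g k - 1) - (1 / r k) *\<^sub>R (h k - 1))" for k
    using power_diff_norm_le[OF g h M1, of k "n k"]
    by (simp add: lin M_def exp_of_nat_mult[symmetric] mult_ac)
  then have le: "\<forall>\<^sub>F k in sequentially. norm (g k ^ n k - h k ^ n k) \<le>
      (real (n k) * r k) * exp ((real (n k) * r k) * K) * norm ((1 / r k) *\<^sub>R (g k - 1) - (1 / r k) *\<^sub>R (h k - 1))"
    by (intro always_eventually) blast
  have "(\<lambda>k. (1 / r k) *\<^sub>R (h k - 1)) \<longlonglongrightarrow> B"
    using vector_derivative_quotient[OF exp_scaleR_has_vector_derivative_right[of B 0 UNIV] r(1) r0] by (simp add: h_def)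
  then have "(\<lambda>k. (real (n k) * r k) * exp ((real (n k) * r k) * K) * norm ((1 / r k) *\<^sub>R (g k - 1) - (1 / r k) *\<^sub>R (h k - 1)))
      \<longlonglongrightarrow> s * exp (s * K) * norm (B - B)"
    by (intro tendsto_intros B s)
  then have "(\<lambda>k. g k ^ n k - h k ^ n k) \<longlonglongrightarrow> 0"
    by (intro Lim_null_comparison[OF le]) simp
  moreover have "(\<lambda>k. h k ^ n k) \<longlonglongrightarrow> exp (s *\<^sub>R B)"
  proof -
    have "h k ^ n k = exp ((real (n k) * r k) *\<^sub>R B)" for k
      unfolding h_def exp_of_nat_scaleR[symmetric] by simp
    then show ?thesis by (simp only:) (intro tendsto_exp_banach tendsto_intros s)
  qed
  ultimately have "(\<lambda>k. (g k ^ n k - h k ^ n k) + h k ^ n k) \<longlonglongrightarrow> 0 + exp (s *\<^sub>R B)"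
    by (rule tendsto_add)
  then show ?thesis by simp
qed

text \<open>The product of the class \<^class>\<open>times\<close> on matrices is entrywise, so a copy of the type is made
  into a Banach algebra.\<close>

typedef 'n mat_alg = "UNIV :: (complex ^ 'n ^ 'n) set"
  morphisms to_mat of_mat by simp

setup_lifting type_definition_mat_alg

text \<open>Makes \<open>to_mat\<close> bounded, so that limits pass from the Banach algebra back to
  matrices.\<close>

lemma norm_entry_le_onorm: "norm (A $ i $ j) \<le> onorm ((*v) A)"
  for A :: "complex ^ 'n::finite ^ 'n"
proof -
  have e: "A $ i $ j = (A *v axis j 1) $ i"
    by (simp add: matrix_vector_mult_def axis_def if_distrib[of "\<lambda>x. _ * x"] cong: if_cong)
  have "norm (A $ i $ j) \<le> norm (A *v axis j 1)"
    unfolding e by (rule Finite_Cartesian_Product.norm_nth_le)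
  also have "\<dots> \<le> onorm ((*v) A) * norm (axis j (1::complex))" by (rule onorm) simp
  also have "norm (axis j (1::complex)) = 1"
    by (simp add: norm_vec_def L2_set_def axis_def if_distrib[of "\<lambda>x. (cmod x)\<^sup>2"] cong: if_cong)
  finally show ?thesis by simp
qed

instantiation mat_alg :: (finite) real_algebra_1
begin

lift_definition zero_mat_alg :: "'a mat_alg" is 0 .
lift_definition one_mat_alg :: "'a mat_alg" is "mat 1" .
lift_definition plus_mat_alg :: "'a mat_alg \<Rightarrow> 'a mat_alg \<Rightarrow> 'a mat_alg" is "(+)" .
lift_definition minus_mat_alg :: "'a mat_alg \<Rightarrow> 'a mat_alg \<Rightarrow> 'a mat_alg" is "(-)" .
lift_definition uminus_mat_alg :: "'a mat_alg \<Rightarrow> 'a mat_alg" is uminus .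
lift_definition times_mat_alg :: "'a mat_alg \<Rightarrow> 'a mat_alg \<Rightarrow> 'a mat_alg" is "(**)" .
lift_definition scaleR_mat_alg :: "real \<Rightarrow> 'a mat_alg \<Rightarrow> 'a mat_alg" is scaleR .
instance
proof
  fix A B C :: "'a mat_alg" and r s :: real
  show "A + B + C = A + (B + C)" "A + B = B + A" "0 + A = A" "- A + A = 0" "A - B = A + - B"
    by (transfer; simp)+
  show "r *\<^sub>R (A + B) = r *\<^sub>R A + r *\<^sub>R B" "(r + s) *\<^sub>R A = r *\<^sub>R A + s *\<^sub>R A"
    "r *\<^sub>R s *\<^sub>R A = (r * s) *\<^sub>R A" "1 *\<^sub>R A = A"
    by (transfer; simp add: algebra_simps)+
  show "A * B * C = A * (B * C)" by transfer (simp add: matrix_mul_assoc)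
  show "(A + B) * C = A * C + B * C" by transfer (simp add: matrix_matrix_mult_def vec_eq_iff algebra_simps sum.distrib)
  show "A * (B + C) = A * B + A * C" by transfer (simp add: matrix_matrix_mult_def vec_eq_iff algebra_simps sum.distrib)
  show "r *\<^sub>R A * B = r *\<^sub>R (A * B)" "A * r *\<^sub>R B = r *\<^sub>R (A * B)"
    by (transfer; simp add: matrix_matrix_mult_def vec_eq_iff scaleR_sum_right)+
  show "1 * A = A" "A * 1 = A" by (transfer; simp)+
  show "(0::'a mat_alg) \<noteq> 1"
    by transfer (auto simp: vec_eq_iff mat_def)
qed

end

instantiation mat_alg :: (finite) real_normed_algebra_1
begin

text \<open>The operator norm gives the identity norm 1, whereas the norm of the vector type gives
  it the square root of the size.\<close>

lift_definition norm_mat_alg :: "'a mat_alg \<Rightarrow> real" is "\<lambda>A. onorm ((*v) A)" .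

definition "sgn_mat_alg (A :: 'a mat_alg) = inverse (norm A) *\<^sub>R A"
definition "dist_mat_alg (A :: 'a mat_alg) B = norm (A - B)"
definition [code del]: "(uniformity :: ('a mat_alg \<times> 'a mat_alg) filter) =
  (INF e\<in>{0<..}. principal {(x, y). dist x y < e})"
definition [code del]: "open (U :: 'a mat_alg set) = (\<forall>x\<in>U. \<forall>\<^sub>F (x', y) in uniformity. x' = x \<longrightarrow> y \<in> U)"

instance
proof
  fix A B :: "'a mat_alg" and r :: real
  show "dist A B = norm (A - B)" "sgn A = A /\<^sub>R norm A" by (simp_all add: dist_mat_alg_def sgn_mat_alg_def)
  show "(uniformity :: ('a mat_alg \<times> 'a mat_alg) filter) = (INF e\<in>{0<..}. principal {(x, y). dist x y < e})"
    by (rule uniformity_mat_alg_def)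
  show "open U = (\<forall>x\<in>U. \<forall>\<^sub>F (x', y) in uniformity. x' = x \<longrightarrow> y \<in> U)" for U :: "'a mat_alg set"
    by (rule open_mat_alg_def)
  show "(norm A = 0) = (A = 0)"
  proof transfer
    fix A :: "complex ^ 'a ^ 'a"
    show "(onorm ((*v) A) = 0) = (A = 0)"
      by (subst onorm_eq_0) (simp, simp add: matrix_eq)
  qed
  show "norm (A + B) \<le> norm A + norm B"
  proof transfer
    fix A B :: "complex ^ 'a ^ 'a"
    have "(*v) (A + B) = (\<lambda>x. A *v x + B *v x)" by (simp add: fun_eq_iff matrix_vector_mult_add_rdistrib)
    then show "onorm ((*v) (A + B)) \<le> onorm ((*v) A) + onorm ((*v) B)"
      by (simp add: onorm_triangle)
  qed
  show "norm (r *\<^sub>R A) = \<bar>r\<bar> * norm A"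
  proof transfer
    fix A :: "complex ^ 'a ^ 'a" and r
    have "(*v) (r *\<^sub>R A) = (\<lambda>x. r *\<^sub>R (A *v x))"
      by (simp add: fun_eq_iff matrix_vector_mult_def vec_eq_iff scaleR_sum_right)
    then show "onorm ((*v) (r *\<^sub>R A)) = \<bar>r\<bar> * onorm ((*v) A)"
      by (simp add: onorm_scaleR)
  qed
  show "norm (A * B) \<le> norm A * norm B"
  proof transfer
    fix A B :: "complex ^ 'a ^ 'a"
    have "(*v) (A ** B) = (*v) A \<circ> (*v) B" by (simp add: fun_eq_iff matrix_vector_mul_assoc)
    then show "onorm ((*v) (A ** B)) \<le> onorm ((*v) A) * onorm ((*v) B)"
      by (simp add: onorm_compose)
  qed
  show "norm (1 :: 'a mat_alg) = 1"
  proof transfer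
    have "(*v) (mat 1 :: complex ^ 'a ^ 'a) = (\<lambda>x. x)" by (simp add: fun_eq_iff)
    then show "onorm ((*v) (mat 1 :: complex ^ 'a ^ 'a)) = 1"
      by (simp add: onorm_id)
  qed
qed

end

lemma bounded_linear_of_mat: "bounded_linear of_mat"
  unfolding linear_conv_bounded_linear[symmetric]
  by (rule linearI) (transfer, simp)+

lemma bounded_linear_to_mat: "bounded_linear to_mat"
proof (rule bounded_linear_intro[where K = "real CARD('a) * real CARD('a)"])
  fix x y :: "'a mat_alg" and r
  show "to_mat (x + y) = to_mat x + to_mat y" "to_mat (r *\<^sub>R x) = r *\<^sub>R to_mat x"
    by (transfer, simp)+
  show "norm (to_mat x) \<le> norm x * (real CARD('a) * real CARD('a))"
  proof transfer
    fix A :: "complex ^ 'a ^ 'a"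
    have "norm A \<le> (\<Sum>i\<in>UNIV. norm (A $ i))"
      unfolding norm_vec_def by (rule L2_set_le_sum) simp
    also have "\<dots> \<le> (\<Sum>i\<in>UNIV. \<Sum>j\<in>UNIV. norm (A $ i $ j))"
      unfolding norm_vec_def[of "A $ _"] by (intro sum_mono L2_set_le_sum) simp
    also have "\<dots> \<le> (\<Sum>i\<in>(UNIV::'a set). \<Sum>j\<in>(UNIV::'a set). onorm ((*v) A))"
      by (intro sum_mono norm_entry_le_onorm)
    finally show "norm A \<le> onorm ((*v) A) * (real CARD('a) * real CARD('a))"
      by (simp add: mult_ac)
  qed
qed

instance mat_alg :: (finite) banach
proof
  fix X :: "nat \<Rightarrow> 'a mat_alg"
  assume "Cauchy X"
  then have "Cauchy (\<lambda>k. to_mat (X k))" by (rule bounded_linear.Cauchy[OF bounded_linear_to_mat])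
  then obtain L where "(\<lambda>k. to_mat (X k)) \<longlonglongrightarrow> L" using Cauchy_convergent_iff convergent_def by blast
  then have "(\<lambda>k. of_mat (to_mat (X k))) \<longlonglongrightarrow> of_mat L" by (rule bounded_linear.tendsto[OF bounded_linear_of_mat])
  then show "convergent X" by (auto simp: convergent_def to_mat_inverse)
qed

section \<open>Transfer of the exponential between the Banach algebra and matrices\<close>

lemma of_mat_simps:
  "of_mat (A ** B) = of_mat A * of_mat B" "of_mat (mat 1) = 1" "of_mat (A + B) = of_mat A + of_mat B"
  "of_mat (A - B) = of_mat A - of_mat B" "of_mat (r *\<^sub>R A) = r *\<^sub>R of_mat A"
  by (transfer; simp)+

lemma to_mat_simps:
  "to_mat (A * B) = to_mat A ** to_mat B" "to_mat 1 = mat 1" "to_mat (A + B) = to_mat A + to_mat B"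
  by (transfer; simp)+

lemma of_mat_inj: "of_mat A = of_mat B \<longleftrightarrow> A = B"
  by (simp add: of_mat_inject)

lemma to_of_mat [simp]: "to_mat (of_mat A) = A"
  by (simp add: of_mat_inverse)

lemma of_mat_power: "of_mat (mat_power A n) = of_mat A ^ n"
  by (induction n) (simp_all add: of_mat_simps)

lemma mat_exp_eq: "mat_exp A = to_mat (exp (of_mat A))"
proof -
  have "to_mat (exp (of_mat A)) = (\<Sum>n. to_mat (of_mat A ^ n /\<^sub>R fact n))"
    unfolding exp_def by (rule bounded_linear.suminf[OF bounded_linear_to_mat summable_exp_generic])
  also have "\<dots> = (\<Sum>n. (1 / fact n) *\<^sub>R mat_power A n)"
    by (simp add: of_mat_power[symmetric] of_mat_simps(5)[symmetric] divide_inverse)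
  finally show ?thesis by (simp add: mat_exp_def)
qed

lemma of_mat_exp: "of_mat (mat_exp A) = exp (of_mat A)"
  by (simp add: mat_exp_eq to_mat_inverse)

lemma mat_exp_0 [simp]: "mat_exp 0 = mat 1"
  by (simp add: of_mat_inj[symmetric] of_mat_exp of_mat_simps zero_mat_alg.abs_eq[symmetric])

lemma mat_exp_add: "A ** B = B ** A \<Longrightarrow> mat_exp (A + B) = mat_exp A ** mat_exp B"
  by (simp add: of_mat_inj[symmetric] of_mat_exp of_mat_simps exp_add_commuting)

lemma matrix_mult_scaleR: "(r *\<^sub>R A) ** B = r *\<^sub>R (A ** B)" "A ** (r *\<^sub>R B) = r *\<^sub>R (A ** B)"
  for A B :: "'n::finite cmat"
  by (simp_all add: of_mat_inj[symmetric] of_mat_simps)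

lemma mat_exp_add_scaleR: "mat_exp ((s + t) *\<^sub>R A) = mat_exp (s *\<^sub>R A) ** mat_exp (t *\<^sub>R A)"
  unfolding scaleR_add_left by (rule mat_exp_add) (simp add: matrix_mult_scaleR)

lemma mat_exp_minus: "mat_exp A ** mat_exp (- A) = mat 1" "mat_exp (- A) ** mat_exp A = mat 1"
  using mat_exp_add_scaleR[of 1 "- 1" A] mat_exp_add_scaleR[of "- 1" 1 A] by auto

lemma bounded_bilinear_matrix_mult: "bounded_bilinear ((**) :: 'n::finite cmat \<Rightarrow> 'n cmat \<Rightarrow> 'n cmat)"
  unfolding bilinear_conv_bounded_bilinear[symmetric] bilinear_def
  by (intro conjI allI linearI) (simp_all add: of_mat_inj[symmetric] of_mat_simps distrib_left distrib_right)

lemma mat_exp_has_vector_derivative: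
  "((\<lambda>t. mat_exp (t *\<^sub>R A)) has_vector_derivative A ** mat_exp (t *\<^sub>R A)) (at t)"
proof -
  have "((\<lambda>t. exp (t *\<^sub>R of_mat A)) has_vector_derivative of_mat A * exp (t *\<^sub>R of_mat A)) (at t)"
    by (rule exp_scaleR_has_vector_derivative_left)
  from bounded_linear.has_vector_derivative[OF bounded_linear_to_mat this]
  show ?thesis by (simp add: mat_exp_eq of_mat_simps to_mat_simps)
qed

lemma continuous_on_mat_exp: "continuous_on S (\<lambda>t. mat_exp (t *\<^sub>R A))"
  using mat_exp_has_vector_derivative
  by (intro continuous_at_imp_continuous_on) (auto intro: has_vector_derivative_continuous)

lemma mat_power_tendsto_exp:
  assumes "r \<longlonglongrightarrow> 0" "\<And>k. r k > 0"
    and "(\<lambda>k. (1 / r k) *\<^sub>R (g k - mat 1)) \<longlonglongrightarrow> B"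
    and "(\<lambda>k. real (n k) * r k) \<longlonglongrightarrow> s"
  shows "(\<lambda>k. mat_power (g k) (n k)) \<longlonglongrightarrow> mat_exp (s *\<^sub>R B)"
proof -
  have "(\<lambda>k. of_mat ((1 / r k) *\<^sub>R (g k - mat 1))) \<longlonglongrightarrow> of_mat B"
    by (rule bounded_linear.tendsto[OF bounded_linear_of_mat assms(3)])
  then have "(\<lambda>k. (1 / r k) *\<^sub>R (of_mat (g k) - 1)) \<longlonglongrightarrow> of_mat B"
    by (simp add: of_mat_simps)
  from power_tendsto_exp[OF assms(1,2) this assms(4)]
  have "(\<lambda>k. of_mat (g k) ^ n k) \<longlonglongrightarrow> exp (s *\<^sub>R of_mat B)" .
  from bounded_linear.tendsto[OF bounded_linear_to_mat this]
  show ?thesis by (simp add: of_mat_power[symmetric] mat_exp_eq of_mat_simps)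
qed

lemma mat_exp_conj:
  fixes P Q :: "'n::finite cmat"
  assumes "P ** Q = mat 1" "Q ** P = mat 1"
  shows "mat_exp (P ** A ** Q) = P ** mat_exp A ** Q"
proof -
  let ?P = "of_mat P" and ?Q = "of_mat Q" and ?A = "of_mat A"
  have QP: "?Q * ?P = 1" "?P * ?Q = 1" using assms by (simp_all add: of_mat_simps[symmetric])
  have pow: "(?P * ?A * ?Q) ^ n = ?P * ?A ^ n * ?Q" for n
  proof (induction n)
    case (Suc n)
    have "?P * ?A * ?Q * (?P * ?A ^ n * ?Q) = ?P * ?A * (?Q * ?P) * ?A ^ n * ?Q" by (simp add: mult.assoc)
    then show ?case using Suc QP by (simp add: mult.assoc)
  qed (simp add: QP)
  have "bounded_linear (\<lambda>x. ?P * x * ?Q)"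
    by (intro bounded_linear_compose[OF bounded_linear_mult_left bounded_linear_mult_right])
  from bounded_linear.suminf[OF this summable_exp_generic[of ?A]]
  have "exp (?P * ?A * ?Q) = ?P * exp ?A * ?Q"
    by (simp add: exp_def pow)
  then show ?thesis by (simp add: of_mat_inj[symmetric] of_mat_exp of_mat_simps)
qed

section \<open>Closed matrix groups and their Lie algebras\<close>

interpretation mmult: bounded_bilinear "(**) :: 'n::finite cmat \<Rightarrow> 'n cmat \<Rightarrow> 'n cmat"
  by (rule bounded_bilinear_matrix_mult)

lemma bounded_bilinear_bracket: "bounded_bilinear (bracket :: 'n::finite cmat \<Rightarrow> 'n cmat \<Rightarrow> 'n cmat)"
  unfolding bilinear_conv_bounded_bilinear[symmetric] bilinear_def bracket_def
  by (intro conjI allI linearI)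
    (simp_all add: mmult.add_left mmult.add_right mmult.scaleR_left mmult.scaleR_right scaleR_diff_right)

interpretation bracket: bounded_bilinear "bracket :: 'n::finite cmat \<Rightarrow> 'n cmat \<Rightarrow> 'n cmat"
  by (rule bounded_bilinear_bracket)

lemma bracket_swap: "bracket Y X = - bracket X Y"
  by (simp add: bracket_def)

lemma bracket_self [simp]: "bracket X X = 0"
  by (simp add: bracket_def)

lemma jacobi: "bracket X (bracket Y Z) = bracket (bracket X Y) Z + bracket Y (bracket X Z)"
  for X :: "'n::finite cmat"
  by (simp add: bracket_def mmult.diff_left mmult.diff_right matrix_mul_assoc)

lemma matrix_inv_eqI:
  fixes A B :: "'n::finite cmat"
  assumes "A ** B = mat 1" "B ** A = mat 1"
  shows "matrix_inv A = B" "invertible A"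
proof -
  show inv: "invertible A" using assms by (auto simp: invertible_def)
  then have "A ** matrix_inv A = mat 1" "matrix_inv A ** A = mat 1"
    using someI[of "\<lambda>B. A ** B = mat 1 \<and> B ** A = mat 1" B] assms unfolding matrix_inv_def by auto
  then show "matrix_inv A = B" using assms by (metis matrix_mul_assoc matrix_mul_lid matrix_mul_rid)
qed

lemma compact_sequence_subseq:
  assumes "compact (S :: 'a::metric_space set)" "\<And>k::nat. f k \<in> S"
  obtains l r where "l \<in> S" "strict_mono r" "(\<lambda>k. f (r k)) \<longlonglongrightarrow> l"
  using assms unfolding compact_def comp_def by metis

text \<open>Differentiate both sides at \<open>s = 0\<close>.\<close>

lemma mat_exp_commute_imp:
  fixes P Y :: "'n::finite cmat"
  assumes "\<And>s::real. P ** mat_exp (s *\<^sub>R Y) = mat_exp (s *\<^sub>R Y) ** P"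
  shows "P ** Y = Y ** P"
proof -
  have "((\<lambda>s. mat_exp (s *\<^sub>R Y)) has_vector_derivative Y) (at 0)"
    using mat_exp_has_vector_derivative[of Y 0] by simp
  then have "((\<lambda>s. P ** mat_exp (s *\<^sub>R Y)) has_vector_derivative P ** Y) (at 0)"
    "((\<lambda>s. mat_exp (s *\<^sub>R Y) ** P) has_vector_derivative Y ** P) (at 0)"
    by (rule bounded_linear.has_vector_derivative[OF mmult.bounded_linear_right],
        rule bounded_linear.has_vector_derivative[OF mmult.bounded_linear_left])
  then show ?thesis using assms vector_derivative_unique_at by simp
qed

lemma bracket_eq_0_iff: "bracket X Y = 0 \<longleftrightarrow> X ** Y = Y ** X"
  by (simp add: bracket_def)

lemma mat_exp_commute:
  fixes P Y :: "'n::finite cmat"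
  assumes "P ** Y = Y ** P" "P ** Q = mat 1" "Q ** P = mat 1"
  shows "P ** mat_exp Y = mat_exp Y ** P"
proof -
  have "P ** Y ** Q = Y ** (P ** Q)" unfolding assms(1) by (simp add: matrix_mul_assoc)
  then have "mat_exp Y = P ** mat_exp Y ** Q" using mat_exp_conj[OF assms(2,3), of Y] assms(2) by simp
  then have "mat_exp Y ** P = P ** mat_exp Y ** (Q ** P)" by (simp add: matrix_mul_assoc)
  then show ?thesis using assms(3) by simp
qed

lemma mat_exp_commute_exp:
  fixes X Y :: "'n::finite cmat"
  assumes "X ** Y = Y ** X"
  shows "mat_exp X ** mat_exp Y = mat_exp Y ** mat_exp X"
  using mat_exp_add[OF assms] mat_exp_add[OF assms[symmetric]] by (simp add: add.commute)

section \<open>The Lie algebra as the space of tangent directions of a compact group\<close>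

locale compact_matrix_group =
  fixes G :: "'n::finite cmat set"
  assumes group: "matrix_lie_group G" and compact: "compact G"
begin

lemma one_in: "mat 1 \<in> G" and mult_in: "A \<in> G \<Longrightarrow> B \<in> G \<Longrightarrow> A ** B \<in> G"
  using group by (auto simp: matrix_lie_group_def)

lemma inv_in:
  assumes "A \<in> G"
  obtains B where "B \<in> G" "A ** B = mat 1" "B ** A = mat 1"
proof -
  obtain B where B: "A ** B = mat 1" "B ** A = mat 1" and "matrix_inv A \<in> G"
    using group assms by (auto simp: matrix_lie_group_def invertible_def)
  then show thesis using that matrix_inv_eqI[OF B] by auto
qed

lemma inv_in': "A \<in> G \<Longrightarrow> A ** B = mat 1 \<Longrightarrow> B \<in> G"
  by (metis inv_in matrix_mul_assoc matrix_mul_lid matrix_mul_rid)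

lemma mat_power_in: "A \<in> G \<Longrightarrow> mat_power A n \<in> G"
  by (induction n) (auto intro: one_in mult_in)

lemma exp_in: "X \<in> lie_algebra G \<Longrightarrow> mat_exp (t *\<^sub>R X) \<in> G"
  by (simp add: lie_algebra_def)

text \<open>The powers of \<open>g k\<close> with exponent the integer part of
  \<open>s / r k\<close> stay in the closed set \<open>G\<close> and converge to the exponential of
  \<open>s *\<^sub>R B\<close>. Negative \<open>s\<close> is reached by inversion.\<close>

lemma tangent_in_lie_algebra:
  assumes g: "\<And>k. g k \<in> G" and r: "r \<longlonglongrightarrow> 0" "\<And>k. r k > 0"
    and B: "(\<lambda>k. (1 / r k) *\<^sub>R (g k - mat 1)) \<longlonglongrightarrow> B"
  shows "B \<in> lie_algebra G"
proof -
  have pos: "mat_exp (s *\<^sub>R B) \<in> G" if s: "s \<ge> 0" for s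
  proof -
    define n where "n k = nat \<lfloor>s / r k\<rfloor>" for k
    have "\<bar>real (n k) * r k - s\<bar> \<le> r k" for k
    proof -
      have "0 \<le> s / r k" using s r(2)[of k] by simp
      then have "real (n k) \<le> s / r k" "s / r k \<le> real (n k) + 1"
        unfolding n_def by linarith+
      then have "real (n k) * r k \<le> s" "s \<le> real (n k) * r k + r k"
        using r(2)[of k] by (auto simp: field_simps)
      then show ?thesis by linarith
    qed
    then have "\<forall>\<^sub>F k in sequentially. norm (real (n k) * r k - s) \<le> r k" by simp
    then have "(\<lambda>k. real (n k) * r k - s) \<longlonglongrightarrow> 0" by (rule Lim_null_comparison[OF _ r(1)])
    then have "(\<lambda>k. real (n k) * r k) \<longlonglongrightarrow> s" by (simp add: LIM_zero_iff)
    then have "(\<lambda>k. mat_power (g k) (n k)) \<longlonglongrightarrow> mat_exp (s *\<^sub>R B)"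
      by (rule mat_power_tendsto_exp[OF r B])
    then show ?thesis by (rule closed_sequentially[OF compact_imp_closed[OF compact] mat_power_in[OF g]])
  qed
  have "mat_exp (s *\<^sub>R B) \<in> G" for s
  proof (cases "s \<ge> 0")
    case False
    then have "mat_exp ((- s) *\<^sub>R B) \<in> G" by (intro pos) simp
    then show ?thesis using inv_in'[of "mat_exp ((- s) *\<^sub>R B)"] mat_exp_minus(2)[of "s *\<^sub>R B"] by simp
  qed (rule pos)
  then show ?thesis by (simp add: lie_algebra_def)
qed

lemma subspace_lie_algebra: "subspace (lie_algebra G)"
proof (rule subspaceI)
  show "0 \<in> lie_algebra G" by (simp add: lie_algebra_def one_in)
  show "c *\<^sub>R X \<in> lie_algebra G" if "X \<in> lie_algebra G" for c X
    using that by (simp add: lie_algebra_def)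
  fix X Y assume XY: "X \<in> lie_algebra G" "Y \<in> lie_algebra G"
  have d: "((\<lambda>s. mat_exp (s *\<^sub>R X)) has_vector_derivative X) (at 0)" for X :: "'n cmat"
    using mat_exp_has_vector_derivative[of X 0] by simp
  \<comment> \<open>The sum is the tangent at the identity of the product of the two one-parameter
    groups, a curve that stays in \<open>G\<close>.\<close>
  have "((\<lambda>s. mat_exp (s *\<^sub>R X) ** mat_exp (s *\<^sub>R Y)) has_vector_derivative X + Y) (at 0)"
    using mmult.has_vector_derivative[OF d d, of X Y] by (simp add: add.commute)
  from vector_derivative_quotient[OF this LIMSEQ_inverse_real_of_nat]
  have "(\<lambda>k. (1 / inverse (real (Suc k))) *\<^sub>R (mat_exp (inverse (real (Suc k)) *\<^sub>R X) ** mat_exp (inverse (real (Suc k)) *\<^sub>R Y) - mat 1)) \<longlonglongrightarrow> X + Y"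
    by simp
  then show "X + Y \<in> lie_algebra G"
    by (rule tangent_in_lie_algebra[rotated 3]) (use XY exp_in mult_in LIMSEQ_inverse_real_of_nat in auto)
qed

lemma conj_in:
  assumes "P \<in> G" "P ** Q = mat 1" "Q ** P = mat 1" "X \<in> lie_algebra G"
  shows "P ** X ** Q \<in> lie_algebra G"
  unfolding lie_algebra_def
proof (intro CollectI allI)
  fix t :: real
  have "mat_exp (P ** (t *\<^sub>R X) ** Q) \<in> G"
    unfolding mat_exp_conj[OF assms(2,3)]
    by (intro mult_in exp_in inv_in'[OF assms(1,2)] assms)
  then show "mat_exp (t *\<^sub>R (P ** X ** Q)) \<in> G" by (simp add: mmult.scaleR_left mmult.scaleR_right)
qed

end

text \<open>The bracket is kept inside the conjugation because \<open>invariant_form_exists\<close>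
  takes the derivative in the form \<open>\<phi> t (A y)\<close>.\<close>

lemma exp_conj_has_vector_derivative:
  fixes X Y :: "'n::finite cmat"
  shows "((\<lambda>t. mat_exp (t *\<^sub>R X) ** Y ** mat_exp ((- t) *\<^sub>R X)) has_vector_derivative
     mat_exp (t *\<^sub>R X) ** bracket X Y ** mat_exp ((- t) *\<^sub>R X)) (at t)"
proof -
  have X: "X ** mat_exp (t *\<^sub>R X) = mat_exp (t *\<^sub>R X) ** X"
    using mat_exp_commute_imp[of "mat_exp (t *\<^sub>R X)" X] mat_exp_add_scaleR[of t _ X] mat_exp_add_scaleR[of _ t X]
    by (simp add: add.commute)
  have 1: "((\<lambda>t. mat_exp (t *\<^sub>R X) ** Y) has_vector_derivative X ** mat_exp (t *\<^sub>R X) ** Y) (at t)"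
    by (rule bounded_linear.has_vector_derivative[OF mmult.bounded_linear_left mat_exp_has_vector_derivative])
  have 2: "((\<lambda>t. mat_exp ((- t) *\<^sub>R X)) has_vector_derivative - X ** mat_exp ((- t) *\<^sub>R X)) (at t)"
    using mat_exp_has_vector_derivative[of "- X" t] by simp
  show ?thesis
    using mmult.has_vector_derivative[OF 1 2] unfolding X
    by (simp add: bracket_def mmult.diff_left mmult.diff_right mmult.minus_left mmult.minus_right matrix_mul_assoc)
qed

context compact_matrix_group
begin

lemma exp_conj_in:
  assumes "X \<in> lie_algebra G" "Y \<in> lie_algebra G"
  shows "mat_exp (t *\<^sub>R X) ** Y ** mat_exp ((- t) *\<^sub>R X) \<in> lie_algebra G"
  using conj_in[OF exp_in[OF assms(1), of t] _ _ assms(2)] mat_exp_minus[of "t *\<^sub>R X"] by simp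

text \<open>The conjugates of \<open>Y\<close> by exponentials of \<open>X\<close> form a curve in
  the Lie algebra, which is closed, and the bracket is its derivative at 0.\<close>

lemma bracket_in:
  assumes "X \<in> lie_algebra G" "Y \<in> lie_algebra G"
  shows "bracket X Y \<in> lie_algebra G"
proof -
  let ?f = "\<lambda>t. mat_exp (t *\<^sub>R X) ** Y ** mat_exp ((- t) *\<^sub>R X)"
  have "(?f has_vector_derivative bracket X Y) (at 0)"
    using exp_conj_has_vector_derivative[of X Y 0] by simp
  from vector_derivative_quotient[OF this LIMSEQ_inverse_real_of_nat]
  have lim: "(\<lambda>k. (1 / inverse (real (Suc k))) *\<^sub>R (?f (0 + inverse (real (Suc k))) - ?f 0)) \<longlonglongrightarrow> bracket X Y" by simp
  have "(1 / inverse (real (Suc k))) *\<^sub>R (?f (0 + inverse (real (Suc k))) - ?f 0) \<in> lie_algebra G" for k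
    by (intro subspace_scale subspace_diff subspace_lie_algebra exp_conj_in assms)
  then show ?thesis by (rule closed_sequentially[OF closed_subspace[OF subspace_lie_algebra] _ lim])
qed

lemma exp_bounded:
  assumes "X \<in> lie_algebra G"
  obtains M where "M > 0" "\<And>t. norm (mat_exp (t *\<^sub>R X)) \<le> M"
proof -
  obtain M where "M > 0" "\<And>x. x \<in> G \<Longrightarrow> norm x \<le> M"
    using compact_imp_bounded[OF compact] bounded_pos by metis
  then show thesis using that exp_in assms by blast
qed

lemma lie_algebra_commute:
  assumes "\<And>A B. A \<in> G \<Longrightarrow> B \<in> G \<Longrightarrow> A ** B = B ** A" "X \<in> lie_algebra G"
  shows "A \<in> G \<Longrightarrow> A ** X = X ** A" "Y \<in> lie_algebra G \<Longrightarrow> bracket X Y = 0"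
proof -
  show *: "A ** X = X ** A" if "A \<in> G" for A using assms exp_in mat_exp_commute_imp that by metis
  then show "bracket X Y = 0" if "Y \<in> lie_algebra G"
    unfolding bracket_eq_0_iff using that exp_in mat_exp_commute_imp by metis
qed

text \<open>Move \<open>h\<close> near \<open>1\<close> by \<open>C\<close> as close to \<open>1\<close> as possible. If the result \<open>g\<close> is not \<open>1\<close>, then
  \<open>g - 1\<close> points, up to a small error, in a direction of the Lie algebra, but by minimality it is
  orthogonal to that direction.\<close>

lemma subgroup_neighbourhood:
  assumes C: "closed C" "C \<subseteq> G" "mat 1 \<in> C"
    and mult: "\<And>A B. A \<in> C \<Longrightarrow> B \<in> C \<Longrightarrow> A ** B \<in> C"
    and inv: "\<And>A B. A \<in> C \<Longrightarrow> B ** A = mat 1 \<Longrightarrow> B \<in> C"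
    and exp: "\<And>X s. X \<in> lie_algebra G \<Longrightarrow> mat_exp (s *\<^sub>R X) \<in> C"
  obtains e where "e > 0" "\<And>h. h \<in> G \<Longrightarrow> norm (h - mat 1) < e \<Longrightarrow> h \<in> C"
proof (rule ccontr)
  assume "\<not> thesis"
  then have "\<exists>h. h \<in> G \<and> norm (h - mat 1) < inverse (real (Suc k)) \<and> h \<notin> C" for k
    using that[of "inverse (real (Suc k))"] by auto
  then obtain h where h: "\<And>k. h k \<in> G" "\<And>k. norm (h k - mat 1) < inverse (real (Suc k))" "\<And>k. h k \<notin> C"
    by metis
  have cC: "compact C" using C compact by (metis closed_Int_compact inf.absorb_iff1)
  have "\<exists>u\<in>C. \<forall>v\<in>C. norm (h k ** u - mat 1) \<le> norm (h k ** v - mat 1)" for k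
    by (rule continuous_attains_inf[OF cC]) (use C in \<open>auto intro!: continuous_intros mmult.continuous_on\<close>)
  then obtain u where u: "\<And>k. u k \<in> C" "\<And>k v. v \<in> C \<Longrightarrow> norm (h k ** u k - mat 1) \<le> norm (h k ** v - mat 1)"
    by metis
  define g where "g k = h k ** u k" for k
  define d where "d k = norm (g k - mat 1)" for k
  have gG: "g k \<in> G" for k using h u C by (auto simp: g_def intro!: mult_in)
  \<comment> \<open>Otherwise \<open>h k\<close> would be a left inverse of \<open>u k\<close> and
    hence lie in \<open>C\<close>.\<close>
  have "g k \<noteq> mat 1" for k
    using inv[of "u k" "h k"] h u by (auto simp: g_def)
  then have d: "d k > 0" for k by (simp add: d_def)
  have "d k \<le> inverse (real (Suc k))" for k
    using u(2)[OF C(3), of k] h(2)[of k] by (simp add: d_def g_def)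
  then have d0: "d \<longlonglongrightarrow> 0"
    using d by (intro tendsto_sandwich[OF _ _ tendsto_const LIMSEQ_inverse_real_of_nat]) (auto intro!: always_eventually simp: less_imp_le)
  define w where "w k = (1 / d k) *\<^sub>R (g k - mat 1)" for k
  have "w k \<in> sphere 0 1" for k using d[of k] by (simp add: w_def d_def)
  then obtain B r where B: "B \<in> sphere 0 1" and r: "strict_mono r" and lim: "(\<lambda>k. w (r k)) \<longlonglongrightarrow> B"
    using compact_sequence_subseq[OF compact_sphere] by metis
  have "(\<lambda>k. d (r k)) \<longlonglongrightarrow> 0" using LIMSEQ_subseq_LIMSEQ[OF d0 r] by (simp add: comp_def)
  then have BG: "B \<in> lie_algebra G"
    by (intro tangent_in_lie_algebra[of "\<lambda>k. g (r k)" "\<lambda>k. d (r k)"] gG d) (use lim in \<open>auto simp: w_def\<close>)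
  have orth: "inner (g k ** B) (g k - mat 1) = 0" for k
  proof -
    define f where "f s = inner (g k ** mat_exp (s *\<^sub>R B) - mat 1) (g k ** mat_exp (s *\<^sub>R B) - mat 1)" for s
    have "((\<lambda>s. mat_exp (s *\<^sub>R B)) has_vector_derivative B) (at 0)"
      using mat_exp_has_vector_derivative[of B 0] by simp
    then have D: "((\<lambda>s. g k ** mat_exp (s *\<^sub>R B) - mat 1) has_vector_derivative g k ** B) (at 0)"
      using has_vector_derivative_diff[OF bounded_linear.has_vector_derivative[OF mmult.bounded_linear_right] has_vector_derivative_const]
      by fastforce
    have "(f has_vector_derivative 2 * inner (g k ** B) (g k - mat 1)) (at 0)"
      unfolding f_def using bounded_bilinear.has_vector_derivative[OF bounded_bilinear_inner D D]
      by (simp add: inner_commute)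
    then have "DERIV f 0 :> 2 * inner (g k ** B) (g k - mat 1)"
      by (simp add: has_real_derivative_iff_has_vector_derivative)
    moreover have "f 0 \<le> f s" for s
    proof -
      \<comment> \<open>\<open>u k ** mat_exp (s *\<^sub>R B)\<close> lies in \<open>C\<close> and
        so competes in the minimisation; hence \<open>f\<close> is minimal at
        \<open>s = 0\<close>.\<close>
      have "norm (g k - mat 1) \<le> norm (h k ** (u k ** mat_exp (s *\<^sub>R B)) - mat 1)"
        unfolding g_def by (intro u mult exp BG)
      then show ?thesis by (simp add: f_def g_def matrix_mul_assoc dot_square_norm)
    qed
    ultimately have "2 * inner (g k ** B) (g k - mat 1) = 0" by (intro DERIV_local_min[of f _ 0 1]) auto
    then show ?thesis by simp
  qed
  have gr: "(\<lambda>k. g (r k)) \<longlonglongrightarrow> mat 1"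
  proof -
    have "(\<lambda>k. g (r k) - mat 1) \<longlonglongrightarrow> 0"
      using \<open>(\<lambda>k. d (r k)) \<longlonglongrightarrow> 0\<close> unfolding d_def tendsto_norm_zero_iff .
    then show ?thesis by (simp add: LIM_zero_iff)
  qed
  \<comment> \<open>In the limit \<open>g\<close> tends to the identity and \<open>w\<close> to
    \<open>B\<close>, so the orthogonality becomes \<open>inner B B = 0\<close> for a vector of norm
    1.\<close>
  have "inner (g (r k) ** B) (w (r k)) = 0" for k using orth by (simp add: w_def)
  moreover have "(\<lambda>k. inner (g (r k) ** B) (w (r k))) \<longlonglongrightarrow> inner (mat 1 ** B) B"
    by (intro tendsto_inner mmult.tendsto gr lim tendsto_const)
  ultimately have "inner B B = 0" by (simp add: LIMSEQ_const_iff)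
  then show False using B by simp
qed

text \<open>Translates of the neighbourhood of the identity make \<open>C\<close> open in
  \<open>G\<close>, and it is also closed. This extends commutation with all exponentials to
  commutation with the whole connected group.\<close>

lemma connected_subgroup_eq:
  assumes "connected G"
    and C: "closed C" "C \<subseteq> G" "mat 1 \<in> C"
    and mult: "\<And>A B. A \<in> C \<Longrightarrow> B \<in> C \<Longrightarrow> A ** B \<in> C"
    and inv: "\<And>A B. A \<in> C \<Longrightarrow> B ** A = mat 1 \<Longrightarrow> B \<in> C"
    and exp: "\<And>X s. X \<in> lie_algebra G \<Longrightarrow> mat_exp (s *\<^sub>R X) \<in> C"
  shows "C = G"
proof -
  obtain e where e: "e > 0" "\<And>h. h \<in> G \<Longrightarrow> norm (h - mat 1) < e \<Longrightarrow> h \<in> C"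
    by (rule subgroup_neighbourhood[OF C]) (use mult inv exp in blast)+
  have "openin (top_of_set G) C"
    unfolding openin_subopen[of _ C]
  proof
    fix c assume c: "c \<in> C"
    obtain b where b: "b \<in> G" "c ** b = mat 1" "b ** c = mat 1" using inv_in c C by blast
    let ?D = "(\<lambda>h. b ** h) -` ball (mat 1) e"
    have "open ?D" by (intro open_vimage open_ball continuous_intros mmult.continuous_on)
    then have "openin (top_of_set G) (G \<inter> ?D)" by (rule openin_open_Int)
    moreover have "c \<in> G \<inter> ?D" using c C b e by auto
    moreover have "G \<inter> ?D \<subseteq> C"
    proof
      fix h assume h: "h \<in> G \<inter> ?D"
      then have "b ** h \<in> C" using b by (intro e mult_in) (auto simp: dist_norm norm_minus_commute)
      then have "c ** (b ** h) \<in> C" using c mult by blast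
      then show "h \<in> C" using b by (simp add: matrix_mul_assoc)
    qed
    ultimately show "\<exists>T. openin (top_of_set G) T \<and> c \<in> T \<and> T \<subseteq> C" by blast
  qed
  moreover have "closedin (top_of_set G) C" using C by (simp add: closed_subset)
  ultimately show ?thesis using assms(1) C unfolding connected_clopen by blast
qed

lemma closure_matrix_group:
  assumes K: "K \<subseteq> G" "mat 1 \<in> K"
    and mult: "\<And>A B. A \<in> K \<Longrightarrow> B \<in> K \<Longrightarrow> A ** B \<in> K"
    and inv: "\<And>A B. A \<in> K \<Longrightarrow> A ** B = mat 1 \<Longrightarrow> B \<in> K"
  shows "matrix_lie_group (closure K)" "closure K \<subseteq> G" "compact (closure K)"
proof -
  show sub: "closure K \<subseteq> G" using K compact_imp_closed[OF compact] by (simp add: closure_minimal)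
  then show "compact (closure K)" using compact by (metis closed_Int_compact closed_closure inf.absorb_iff1)
  have m: "A ** B \<in> closure K" if "A \<in> closure K" "B \<in> closure K" for A B
  proof -
    obtain a where "\<And>k::nat. a k \<in> K" "a \<longlonglongrightarrow> A" using \<open>A \<in> closure K\<close> unfolding closure_sequential by metis
    moreover obtain b where "\<And>k::nat. b k \<in> K" "b \<longlonglongrightarrow> B" using \<open>B \<in> closure K\<close> unfolding closure_sequential by metis
    ultimately have "\<And>k. a k ** b k \<in> K" "(\<lambda>k. a k ** b k) \<longlonglongrightarrow> A ** B" by (auto intro: mult mmult.tendsto)
    then show ?thesis unfolding closure_sequential by (intro exI[of _ "\<lambda>k. a k ** b k"]) simp
  qed
  have i: "invertible A \<and> matrix_inv A \<in> closure K" if "A \<in> closure K" for A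
  proof -
    obtain a where a: "\<And>k::nat. a k \<in> K" "a \<longlonglongrightarrow> A"
      using \<open>A \<in> closure K\<close> unfolding closure_sequential by metis
    have "\<exists>b. b \<in> K \<and> a k ** b = mat 1 \<and> b ** a k = mat 1" for k
      using a K inv inv_in by (metis subsetD)
    then obtain b where b: "\<And>k. b k \<in> K" "\<And>k. a k ** b k = mat 1" "\<And>k. b k ** a k = mat 1" by metis
    \<comment> \<open>The inverses of the approximating sequence stay in a compact set, so along a
      subsequence they converge to an inverse of the limit.\<close>
    obtain B r where B: "B \<in> closure K" and r: "strict_mono r" and lim: "(\<lambda>k. b (r k)) \<longlonglongrightarrow> B"
      using compact_sequence_subseq[OF \<open>compact (closure K)\<close>, of b] b closure_subset by blast
    have a': "(\<lambda>k. a (r k)) \<longlonglongrightarrow> A" using LIMSEQ_subseq_LIMSEQ[OF a(2) r] by (simp add: comp_def)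
    have "A ** B = mat 1" using mmult.tendsto[OF a' lim] by (simp add: b LIMSEQ_const_iff)
    moreover have "B ** A = mat 1" using mmult.tendsto[OF lim a'] by (simp add: b LIMSEQ_const_iff)
    ultimately show ?thesis using matrix_inv_eqI B by metis
  qed
  show "matrix_lie_group (closure K)"
    unfolding matrix_lie_group_def using m i subsetD[OF closure_subset K(2)] by (auto intro!: closed_subset)
qed

text \<open>Once \<open>X\<close> commutes with all of \<open>H\<close>, the products of elements of
  \<open>H\<close> with exponentials of \<open>X\<close> form a connected commutative group. Its
  closure is a torus containing \<open>H\<close>, so by maximality it is \<open>H\<close> and
  contains the exponentials of \<open>X\<close>. The closure is taken because the group of products
  need not be closed.\<close>

lemma centralizer_torus:
  assumes H: "maximal_torus G H" and X: "X \<in> lie_algebra G"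
    and comm: "\<And>T. T \<in> lie_algebra H \<Longrightarrow> bracket X T = 0"
  shows "X \<in> lie_algebra H"
proof -
  have tor: "matrix_lie_group H" "H \<subseteq> G" "compact H" "connected H" "\<And>A B. A \<in> H \<Longrightarrow> B \<in> H \<Longrightarrow> A ** B = B ** A"
    using H by (auto simp: maximal_torus_def torus_in_def)
  interpret H: compact_matrix_group H using tor by unfold_locales
  have "{h\<in>H. h ** X = X ** h} = H"
  proof (rule H.connected_subgroup_eq[OF tor(4)])
    have "closed {h. h ** X = X ** h}"
      by (intro closed_Collect_eq continuous_intros mmult.continuous_on)
    then show "closed {h\<in>H. h ** X = X ** h}"
      using compact_imp_closed[OF tor(3)] by (metis (no_types) Collect_conj_eq Collect_mem_eq closed_Int)
    show "mat 1 \<in> {h\<in>H. h ** X = X ** h}" using H.one_in by simp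
    show "A ** B \<in> {h\<in>H. h ** X = X ** h}" if "A \<in> {h\<in>H. h ** X = X ** h}" "B \<in> {h\<in>H. h ** X = X ** h}" for A B
      using that H.mult_in by (auto simp: matrix_mul_assoc[symmetric]) (metis matrix_mul_assoc)
    show "B \<in> {h\<in>H. h ** X = X ** h}" if A: "A \<in> {h\<in>H. h ** X = X ** h}" and BA: "B ** A = mat 1" for A B
    proof -
      obtain B' where B': "B' \<in> H" "A ** B' = mat 1" "B' ** A = mat 1" using H.inv_in A by blast
      then have B: "B = B'" using BA by (metis matrix_mul_assoc matrix_mul_lid matrix_mul_rid)
      have "B ** X = B ** (X ** A) ** B" using B' B by (simp add: matrix_mul_assoc[symmetric])
      also have "\<dots> = B ** (A ** X) ** B" using A by simp
      also have "\<dots> = X ** B" using BA by (simp add: matrix_mul_assoc)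
      finally show ?thesis using B B' by simp
    qed
    show "mat_exp (s *\<^sub>R T) \<in> {h\<in>H. h ** X = X ** h}" if T: "T \<in> lie_algebra H" for T s
    proof -
      have "(s *\<^sub>R T) ** X = X ** (s *\<^sub>R T)" using comm[OF T] by (simp add: bracket_eq_0_iff mmult.scaleR_left mmult.scaleR_right)
      then have "mat_exp (s *\<^sub>R T) ** mat_exp (u *\<^sub>R X) = mat_exp (u *\<^sub>R X) ** mat_exp (s *\<^sub>R T)" for u
        by (intro mat_exp_commute_exp) (auto simp: mmult.scaleR_left mmult.scaleR_right mult.commute)
      then show ?thesis using mat_exp_commute_imp H.exp_in T by blast
    qed
  qed auto
  then have hX: "h ** X = X ** h" if "h \<in> H" for h using that by blast
  have he: "h ** mat_exp (s *\<^sub>R X) = mat_exp (s *\<^sub>R X) ** h" if "h \<in> H" for h s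
  proof -
    obtain b where b: "h ** b = mat 1" "b ** h = mat 1" using H.inv_in \<open>h \<in> H\<close> by blast
    show ?thesis using hX[OF that] by (intro mat_exp_commute[OF _ b]) (simp add: mmult.scaleR_left mmult.scaleR_right)
  qed
  define K where "K = (\<lambda>(h, s). h ** mat_exp (s *\<^sub>R X)) ` (H \<times> UNIV)"
  have K: "A \<in> K \<longleftrightarrow> (\<exists>h s. h \<in> H \<and> A = h ** mat_exp (s *\<^sub>R X))" for A by (auto simp: K_def)
  have prod: "h ** mat_exp (s *\<^sub>R X) ** (h' ** mat_exp (s' *\<^sub>R X)) = h ** h' ** mat_exp ((s + s') *\<^sub>R X)"
    if "h \<in> H" "h' \<in> H" for h h' s s'
  proof -
    have "h ** mat_exp (s *\<^sub>R X) ** (h' ** mat_exp (s' *\<^sub>R X)) = h ** (mat_exp (s *\<^sub>R X) ** h') ** mat_exp (s' *\<^sub>R X)"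
      by (simp add: matrix_mul_assoc)
    also have "\<dots> = h ** h' ** (mat_exp (s *\<^sub>R X) ** mat_exp (s' *\<^sub>R X))"
      unfolding he[OF that(2), symmetric] by (simp add: matrix_mul_assoc)
    finally show ?thesis by (simp only: mat_exp_add_scaleR)
  qed
  have HK: "H \<subseteq> K" using K by (force intro: exI[of _ "0::real"])
  have KG: "K \<subseteq> G" using tor(2) by (auto simp: K intro!: mult_in exp_in[OF X])
  have Kmult: "A ** B \<in> K" if "A \<in> K" "B \<in> K" for A B
    using that prod H.mult_in unfolding K by metis
  have Kcomm: "A ** B = B ** A" if "A \<in> K" "B \<in> K" for A B
    using that prod tor(5) unfolding K by (metis add.commute)
  have Kinv: "B \<in> K" if A: "A \<in> K" and AB: "A ** B = mat 1" for A B
  proof -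
    obtain h s where hs: "h \<in> H" "A = h ** mat_exp (s *\<^sub>R X)" using A K by blast
    obtain b where b: "b \<in> H" "h ** b = mat 1" "b ** h = mat 1" using H.inv_in hs by blast
    have "b ** mat_exp ((- s) *\<^sub>R X) ** A = mat 1"
      unfolding hs prod[OF b(1) hs(1)] using b by simp
    then have "B = b ** mat_exp ((- s) *\<^sub>R X)" using AB by (metis matrix_mul_assoc matrix_mul_lid matrix_mul_rid)
    then show ?thesis using K b by blast
  qed
  have one: "mat 1 \<in> K" using HK H.one_in by blast
  have "torus_in G (closure K)"
    unfolding torus_in_def
  proof (intro conjI ballI)
    show "matrix_lie_group (closure K)" "closure K \<subseteq> G" "compact (closure K)"
      using closure_matrix_group[OF KG one Kmult Kinv] by auto
    have "connected K" unfolding K_def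
    proof (rule connected_continuous_image)
      show "connected (H \<times> (UNIV::real set))" by (intro connected_Times tor connected_UNIV)
      show "continuous_on (H \<times> UNIV) (\<lambda>(h, s). h ** mat_exp (s *\<^sub>R X))"
        unfolding case_prod_unfold
        by (intro mmult.continuous_on continuous_intros continuous_on_compose2[OF continuous_on_mat_exp[of UNIV]]) auto
    qed
    then show "connected (closure K)" by (rule connected_imp_connected_closure)
    fix A B assume AB: "A \<in> closure K" "B \<in> closure K"
    obtain a where a: "\<And>k::nat. a k \<in> K" "a \<longlonglongrightarrow> A" using AB(1) unfolding closure_sequential by metis
    obtain b where b: "\<And>k::nat. b k \<in> K" "b \<longlonglongrightarrow> B" using AB(2) unfolding closure_sequential by metis
    note ab = a b
    have "(\<lambda>k. a k ** b k) \<longlonglongrightarrow> A ** B" by (intro mmult.tendsto ab)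
    moreover have "(\<lambda>k. a k ** b k) \<longlonglongrightarrow> B ** A" using mmult.tendsto[OF ab(4) ab(2)] Kcomm ab by simp
    ultimately show "A ** B = B ** A" by (rule LIMSEQ_unique)
  qed
  moreover have "H \<subseteq> closure K" using HK closure_subset by blast
  ultimately have "closure K = H" using H by (auto simp: maximal_torus_def)
  moreover have "mat_exp (s *\<^sub>R X) \<in> K" for s using K H.one_in by (metis matrix_mul_lid)
  ultimately show ?thesis using closure_subset by (auto simp: lie_algebra_def)
qed

end

section \<open>Inner products on subspaces and traces\<close>

text \<open>Bilinear and symmetric on the whole type but definite on \<open>V\<close> only, so that
  one form can be restricted to subspaces and extended arbitrarily outside the Lie algebra.\<close>

locale inner_form =
  fixes \<beta> :: "'a::euclidean_space \<Rightarrow> 'a \<Rightarrow> real" and V :: "'a set"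
  assumes bilin: "bilinear \<beta>" and commute: "\<beta> x y = \<beta> y x" and V: "subspace V"
    and pos: "x \<in> V \<Longrightarrow> x \<noteq> 0 \<Longrightarrow> \<beta> x x > 0"
begin

lemmas form_simps =
  bilinear_ladd[OF bilin] bilinear_radd[OF bilin] bilinear_lsub[OF bilin] bilinear_rsub[OF bilin]
  bilinear_lmul[OF bilin] bilinear_rmul[OF bilin] bilinear_lneg[OF bilin] bilinear_rneg[OF bilin]
  bilinear_lzero[OF bilin] bilinear_rzero[OF bilin]

lemma form_sum_left: "\<beta> (\<Sum>a\<in>A. f a) y = (\<Sum>a\<in>A. \<beta> (f a) y)"
  using linear_sum[of "\<lambda>x. \<beta> x y"] bilin by (auto simp: bilinear_def)

lemma form_sum_right: "\<beta> x (\<Sum>a\<in>A. f a) = (\<Sum>a\<in>A. \<beta> x (f a))"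
  using linear_sum[of "\<lambda>y. \<beta> x y"] bilin by (auto simp: bilinear_def)

lemma form_nonneg: "x \<in> V \<Longrightarrow> \<beta> x x \<ge> 0"
  using pos[of x] by (cases "x = 0") (auto simp: form_simps)

lemma form_eq_0D: "x \<in> V \<Longrightarrow> \<beta> x x = 0 \<Longrightarrow> x = 0"
  using pos by fastforce

lemma orthogonal_independent:
  assumes "finite B" and B: "\<And>b. b \<in> B \<Longrightarrow> \<beta> b b \<noteq> 0" "\<And>b c. b \<in> B \<Longrightarrow> c \<in> B \<Longrightarrow> b \<noteq> c \<Longrightarrow> \<beta> b c = 0"
  shows "independent B"
proof
  assume "dependent B"
  then obtain u v where u: "v \<in> B" "u v \<noteq> 0" "(\<Sum>b\<in>B. u b *\<^sub>R b) = 0"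
    using \<open>finite B\<close> dependent_finite by blast
  have "0 = \<beta> (\<Sum>b\<in>B. u b *\<^sub>R b) v" by (simp add: u form_simps)
  also have "\<dots> = (\<Sum>b\<in>B. u b * \<beta> b v)" by (simp add: form_sum_left form_simps)
  also have "\<dots> = (\<Sum>b\<in>B. if b = v then u v * \<beta> v v else 0)"
    using B u by (intro sum.cong) auto
  also have "\<dots> = u v * \<beta> v v" using \<open>finite B\<close> u by simp
  finally show False using u B by simp
qed

definition orthonormal_basis :: "'a set \<Rightarrow> bool" where
  "orthonormal_basis B \<longleftrightarrow> finite B \<and> independent B \<and> span B = V \<and>
     (\<forall>b\<in>B. \<forall>c\<in>B. \<beta> b c = (if b = c then 1 else 0))"

text \<open>An orthonormal set of largest size spans \<open>V\<close>: otherwise the normalised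
  remainder of an orthogonal projection could be added to it.\<close>

lemma exists_orthonormal_basis: "\<exists>B. orthonormal_basis B"
proof -
  define good where "good B \<longleftrightarrow> finite B \<and> B \<subseteq> V \<and> (\<forall>b\<in>B. \<forall>c\<in>B. \<beta> b c = (if b = c then 1 else 0))" for B
  have ind: "independent B" if "good B" for B
    by (rule orthogonal_independent) (use that in \<open>auto simp: good_def\<close>)
  have "card B \<le> DIM('a)" if "good B" for B using independent_bound[OF ind[OF that]] by simp
  moreover have "good {}" by (simp add: good_def)
  ultimately have "\<exists>B. good B \<and> (\<forall>C. good C \<longrightarrow> card C \<le> card B)"
    by (intro ex_has_greatest_nat[of good "{}" card "Suc (DIM('a))"]) (simp_all add: less_Suc_eq_le)
  then obtain B where B: "good B" and max: "\<And>C. good C \<Longrightarrow> card C \<le> card B" by blast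
  have Bf: "finite B" "B \<subseteq> V" and orth: "\<And>b c. b \<in> B \<Longrightarrow> c \<in> B \<Longrightarrow> \<beta> b c = (if b = c then 1 else 0)"
    using B by (auto simp: good_def)
  have "V \<subseteq> span B"
  proof
    fix v assume v: "v \<in> V"
    define w where "w = v - (\<Sum>b\<in>B. \<beta> v b *\<^sub>R b)"
    show "v \<in> span B"
    proof (rule ccontr)
      assume nv: "v \<notin> span B"
      have "(\<Sum>b\<in>B. \<beta> v b *\<^sub>R b) \<in> span B" by (intro span_sum span_scale span_base)
      then have w0: "w \<noteq> 0" using nv by (auto simp: w_def)
      have wV: "w \<in> V" unfolding w_def using Bf v by (intro subspace_diff subspace_sum subspace_scale V) auto
      have wc: "\<beta> w c = 0" if c: "c \<in> B" for c
      proof -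
        have "(\<Sum>b\<in>B. \<beta> v b * \<beta> b c) = (\<Sum>b\<in>B. if b = c then \<beta> v c else 0)"
          using orth c by (intro sum.cong) auto
        then show ?thesis using Bf c by (simp add: w_def form_simps form_sum_left)
      qed
      have p: "\<beta> w w > 0" using pos wV w0 by auto
      define e where "e = (1 / sqrt (\<beta> w w)) *\<^sub>R w"
      have "\<beta> e e = 1" using p by (simp add: e_def form_simps)
      moreover have "\<beta> e c = 0" "\<beta> c e = 0" if "c \<in> B" for c using wc[OF that] by (simp_all add: e_def form_simps commute[of c])
      moreover have "e \<in> V" using wV by (simp add: e_def subspace_scale V)
      moreover have eB: "e \<notin> B" using calculation(1,2) by force
      ultimately have "good (insert e B)" using Bf orth by (auto simp: good_def)
      then show False using max[of "insert e B"] eB Bf by simp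
    qed
  qed
  moreover have "span B \<subseteq> V" using Bf V by (simp add: span_minimal)
  ultimately have "span B = V" by blast
  then have "orthonormal_basis B" unfolding orthonormal_basis_def using Bf(1) orth ind[OF B] by blast
  then show ?thesis by blast
qed

lemma orthonormal_expansion:
  assumes B: "orthonormal_basis B" and v: "v \<in> V"
  shows "v = (\<Sum>b\<in>B. \<beta> v b *\<^sub>R b)" "representation B v b = (if b \<in> B then \<beta> v b else 0)"
proof -
  have Bf: "finite B" "independent B" "span B = V" and orth: "\<And>b c. b \<in> B \<Longrightarrow> c \<in> B \<Longrightarrow> \<beta> b c = (if b = c then 1 else 0)"
    using B by (auto simp: orthonormal_basis_def)
  have v': "(\<Sum>b\<in>B. representation B v b *\<^sub>R b) = v"
    using Bf v by (intro sum_representation_eq) auto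
  have *: "\<beta> v c = representation B v c" if c: "c \<in> B" for c
  proof -
    have "\<beta> v c = (\<Sum>b\<in>B. representation B v b * \<beta> b c)"
      by (subst v'[symmetric]) (simp add: form_sum_left form_simps)
    also have "\<dots> = (\<Sum>b\<in>B. if b = c then representation B v c else 0)"
      using orth c by (intro sum.cong) auto
    finally show ?thesis using Bf c by simp
  qed
  then show "v = (\<Sum>b\<in>B. \<beta> v b *\<^sub>R b)" using v' by simp
  show "representation B v b = (if b \<in> B then \<beta> v b else 0)"
    using * representation_ne_zero by metis
qed

lemma exists_orthogonal:
  assumes S: "subspace S" "S \<subseteq> V" "S \<noteq> V"
  shows "\<exists>x\<in>V. x \<noteq> 0 \<and> (\<forall>y\<in>S. \<beta> x y = 0)"
proof -
  interpret S: inner_form \<beta> S using S bilin commute pos by unfold_locales auto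
  obtain B where B: "S.orthonormal_basis B" using S.exists_orthonormal_basis by blast
  then have Bf: "finite B" "span B = S" "B \<subseteq> S" and orth: "\<And>b c. b \<in> B \<Longrightarrow> c \<in> B \<Longrightarrow> \<beta> b c = (if b = c then 1 else 0)"
    using span_superset by (auto simp: S.orthonormal_basis_def)
  obtain v where v: "v \<in> V" "v \<notin> S" using S by blast
  define p where "p = (\<Sum>b\<in>B. \<beta> v b *\<^sub>R b)"
  have p: "p \<in> S" unfolding p_def using Bf by (intro subspace_sum subspace_scale S) auto
  have pb: "\<beta> p c = \<beta> v c" if "c \<in> B" for c
  proof -
    have "(\<Sum>b\<in>B. \<beta> v b * \<beta> b c) = (\<Sum>b\<in>B. if b = c then \<beta> v c else 0)"
      using orth that by (intro sum.cong) auto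
    then show ?thesis using Bf that by (simp add: p_def form_simps form_sum_left)
  qed
  have "\<beta> (v - p) y = 0" if "y \<in> S" for y
  proof -
    have "\<beta> (v - p) y = (\<Sum>b\<in>B. \<beta> y b * \<beta> (v - p) b)"
      by (subst S.orthonormal_expansion(1)[OF B that]) (simp add: form_sum_right form_simps)
    also have "\<dots> = 0" using pb by (intro sum.neutral) (simp add: form_simps)
    finally show ?thesis .
  qed
  moreover have "v - p \<in> V" "v - p \<noteq> 0" using v p S V by (auto simp: subspace_diff)
  ultimately show ?thesis by blast
qed

end

text \<open>Expanding the vectors of each basis in the other turns the trace for \<open>B\<close>
  and the trace for the basis chosen by \<open>SOME\<close> into the same double sum.\<close>

lemma trace_on_eq:
  fixes f :: "'a::euclidean_space \<Rightarrow> 'a"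
  assumes B: "independent B" "span B = V" and f: "linear f" "f ` V \<subseteq> V"
  shows "trace_on V f = (\<Sum>b\<in>B. representation B (f b) b)"
proof -
  define C where "C = (SOME B. independent B \<and> span B = V)"
  have C: "independent C" "span C = V" using someI[of "\<lambda>B. independent B \<and> span B = V" B] B by (auto simp: C_def)
  have fin: "finite B" "finite C" using B C independent_bound by auto
  have BV: "B \<subseteq> V" and CV: "C \<subseteq> V" using B C span_superset by auto
  have 1: "representation C (f c) c = (\<Sum>b\<in>B. representation B c b * representation C (f b) c)" if c: "c \<in> C" for c
  proof -
    have "c = (\<Sum>b\<in>B. representation B c b *\<^sub>R b)"
      using sum_representation_eq[OF B(1) _ fin(1) subset_refl, of c] B CV c by auto
    then have "f c = (\<Sum>b\<in>B. representation B c b *\<^sub>R f b)"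
      by (metis (no_types, lifting) linear_sum[OF f(1)] linear_scale[OF f(1)] sum.cong)
    moreover have "f b \<in> span C" if "b \<in> B" for b using that C(2) f(2) BV by blast
    ultimately show ?thesis
      by (simp add: representation_sum[OF C(1)] representation_scale[OF C(1)] span_scale)
  qed
  have 2: "representation B (f b) b = (\<Sum>c\<in>C. representation C (f b) c * representation B c b)" if b: "b \<in> B" for b
  proof -
    have fb: "f b \<in> span C" using f(2) BV b C(2) by blast
    have "f b = (\<Sum>c\<in>C. representation C (f b) c *\<^sub>R c)"
      by (rule sum_representation_eq[OF C(1) fb fin(2) subset_refl, symmetric])
    then have "representation B (f b) b = representation B (\<Sum>c\<in>C. representation C (f b) c *\<^sub>R c) b" by simp
    moreover have "c \<in> span B" if "c \<in> C" for c using that B(2) CV by blast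
    ultimately show ?thesis
      by (simp add: representation_sum[OF B(1)] representation_scale[OF B(1)] span_scale)
  qed
  have "trace_on V f = (\<Sum>c\<in>C. representation C (f c) c)"
    by (simp add: trace_on_def C_def Let_def)
  also have "\<dots> = (\<Sum>c\<in>C. \<Sum>b\<in>B. representation B c b * representation C (f b) c)" using 1 by simp
  also have "\<dots> = (\<Sum>b\<in>B. \<Sum>c\<in>C. representation C (f b) c * representation B c b)"
    by (subst sum.swap) (simp add: mult.commute)
  also have "\<dots> = (\<Sum>b\<in>B. representation B (f b) b)" using 2 by simp
  finally show ?thesis .
qed

context inner_form
begin

lemma trace_on_orthonormal:
  assumes B: "orthonormal_basis B" and f: "linear f" "f ` V \<subseteq> V"
  shows "trace_on V f = (\<Sum>b\<in>B. \<beta> (f b) b)"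
proof -
  have "B \<subseteq> V" using B span_superset by (auto simp: orthonormal_basis_def)
  then show ?thesis
    using B f trace_on_eq[of B V f] orthonormal_expansion(2)[OF B]
    by (auto simp: orthonormal_basis_def image_subset_iff subset_iff intro!: sum.cong)
qed

lemma trace_on_commute:
  assumes f: "linear f" "f ` V \<subseteq> V" and g: "linear g" "g ` V \<subseteq> V"
  shows "trace_on V (\<lambda>x. f (g x)) = trace_on V (\<lambda>x. g (f x))"
proof -
  obtain B where B: "orthonormal_basis B" using exists_orthonormal_basis by blast
  have BV: "b \<in> V" if "b \<in> B" for b using B that span_superset by (auto simp: orthonormal_basis_def)
  have *: "trace_on V (\<lambda>x. f (g x)) = (\<Sum>b\<in>B. \<Sum>c\<in>B. \<beta> (g b) c * \<beta> (f c) b)"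
    if f: "linear f" "f ` V \<subseteq> V" and g: "linear g" "g ` V \<subseteq> V" for f g
  proof -
    have "\<beta> (f (g b)) b = (\<Sum>c\<in>B. \<beta> (g b) c * \<beta> (f c) b)" if b: "b \<in> B" for b
    proof -
      have "g b = (\<Sum>c\<in>B. \<beta> (g b) c *\<^sub>R c)"
        using g BV[OF b] by (intro orthonormal_expansion[OF B]) auto
      then have "f (g b) = (\<Sum>c\<in>B. \<beta> (g b) c *\<^sub>R f c)"
        by (metis (no_types, lifting) linear_sum[OF f(1)] linear_scale[OF f(1)] sum.cong)
      then show ?thesis by (simp add: form_sum_left form_simps)
    qed
    moreover have "linear (\<lambda>x. f (g x))" using linear_compose[OF g(1) f(1)] by (simp add: o_def)
    ultimately show ?thesis
      using trace_on_orthonormal[OF B, of "\<lambda>x. f (g x)"] f g by (auto simp: image_subset_iff)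
  qed
  show ?thesis
    unfolding *[OF f g] *[OF g f] by (subst sum.swap) (simp add: mult.commute)
qed

end

lemma inner_form_inner: "subspace V \<Longrightarrow> inner_form inner V"
  by unfold_locales (auto simp: bilinear_def inner_commute inner_add_left inner_add_right intro!: linearI)

section \<open>Invariant inner products for bounded one-parameter groups\<close>

text \<open>\<open>b n\<close> averages the inner products of the moved vectors over
  \<open>{0..T n}\<close>. By the fundamental theorem of calculus its defect from skewness of
  \<open>A\<close> is a bounded boundary term divided by \<open>T n\<close>, so \<open>A\<close> is
  exactly skew for every limit of the averages.\<close>

lemma invariant_form_exists:
  fixes A :: "'a::euclidean_space \<Rightarrow> 'a" and \<phi> :: "real \<Rightarrow> 'a \<Rightarrow> 'a"
  assumes lin: "\<And>t. linear (\<phi> t)" and zero: "\<And>y. \<phi> 0 y = y"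
    and der: "\<And>t y. ((\<lambda>t. \<phi> t y) has_vector_derivative \<phi> t (A y)) (at t)"
    and bound: "M > 0" "\<And>t y. norm (\<phi> t y) \<le> M * norm y" and inv: "\<And>t y. \<phi> (- t) (\<phi> t y) = y"
  obtains \<beta> :: "'a \<Rightarrow> 'a \<Rightarrow> real" where "bilinear \<beta>" "\<And>x y. \<beta> x y = \<beta> y x" "\<And>x. x \<noteq> 0 \<Longrightarrow> \<beta> x x > 0"
    "\<And>x y. \<beta> (A x) y = - \<beta> x (A y)"
proof -
  define T where "T n = real (Suc n)" for n
  have T: "T n > 0" for n by (simp add: T_def)
  define f where "f y z t = inner (\<phi> t y) (\<phi> t z)" for y z t
  define b where "b n y z = (1 / T n) * integral {0..T n} (f y z)" for n y z
  have cont\<phi>: "continuous_on S (\<lambda>t. \<phi> t y)" for S y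
    using der by (intro continuous_at_imp_continuous_on ballI) (auto intro: has_vector_derivative_continuous)
  have cont: "continuous_on S (f y z)" for S y z
    unfolding f_def by (intro continuous_on_inner cont\<phi>)
  have int: "f y z integrable_on {0..T n}" for y z n
    by (intro integrable_continuous_real cont)
  have f_add: "f (x + y) z = (\<lambda>t. f x z t + f y z t)" and f_scale: "f (c *\<^sub>R y) z = (\<lambda>t. c * f y z t)" for x y z c
    by (simp_all add: f_def fun_eq_iff linear_add[OF lin] linear_scale[OF lin] inner_add_left)
  have f_commute: "f y z = f z y" for y z by (simp add: f_def fun_eq_iff inner_commute)
  have b_commute: "b n y z = b n z y" for n y z by (simp add: b_def f_commute)
  have b_add: "b n (x + y) z = b n x z + b n y z" and b_scale: "b n (c *\<^sub>R y) z = c * b n y z" for n x y z c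
    unfolding b_def f_add f_scale by (simp_all add: integral_add[OF int int] algebra_simps)
  have b_linear: "linear (\<lambda>y. b n y z)" for n z by (rule linearI) (simp_all add: b_add b_scale)
  have f_le: "\<bar>f y z t\<bar> \<le> M\<^sup>2 * norm y * norm z" for y z t
  proof -
    have "\<bar>f y z t\<bar> \<le> norm (\<phi> t y) * norm (\<phi> t z)" unfolding f_def by (rule Cauchy_Schwarz_ineq2)
    also have "\<dots> \<le> (M * norm y) * (M * norm z)" using bound by (intro mult_mono) auto
    finally show ?thesis by (simp add: power2_eq_square mult_ac)
  qed
  have b_le: "\<bar>b n y z\<bar> \<le> M\<^sup>2 * norm y * norm z" for n y z
  proof -
    have "norm (integral {0..T n} (f y z)) \<le> (M\<^sup>2 * norm y * norm z) * (T n - 0)"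
      using T[of n] f_le cont by (intro integral_bound) auto
    then show ?thesis using T[of n] by (simp add: b_def abs_mult field_simps)
  qed
  have b_ge: "b n y y \<ge> (norm y)\<^sup>2 / M\<^sup>2" for n y
  proof -
    \<comment> \<open>Moving back by \<open>\<phi> (- t)\<close> bounds \<open>y\<close> by
      \<open>M\<close> times its image. The resulting lower bound does not depend on
      \<open>n\<close>, so the limit form is still definite.\<close>
    have "(norm y)\<^sup>2 / M\<^sup>2 \<le> f y y t" for t
    proof -
      have "norm y \<le> M * norm (\<phi> t y)" using bound(2)[of "- t" "\<phi> t y"] inv by simp
      then have "(norm y)\<^sup>2 \<le> (M * norm (\<phi> t y))\<^sup>2" by (intro power_mono) auto
      then show ?thesis using bound(1) by (simp add: f_def power_mult_distrib dot_square_norm field_simps)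
    qed
    then have "integral {0..T n} (\<lambda>t. (norm y)\<^sup>2 / M\<^sup>2) \<le> integral {0..T n} (f y y)"
      by (intro integral_le int) auto
    then show ?thesis using T[of n] by (simp add: b_def field_simps)
  qed
  have b_skew: "b n (A y) z + b n y (A z) = (1 / T n) * (f y z (T n) - f y z 0)" for n y z
  proof -
    have D: "(f y z has_vector_derivative f (A y) z t + f y (A z) t) (at t)" for t
      unfolding f_def using bounded_bilinear.has_vector_derivative[OF bounded_bilinear_inner der[of y t] der[of z t]]
      by (simp add: add.commute)
    have "((\<lambda>t. f (A y) z t + f y (A z) t) has_integral f y z (T n) - f y z 0) {0..T n}"
      using T[of n] by (intro fundamental_theorem_of_calculus[OF _ has_vector_derivative_at_within[OF D]]) simp
    then have "integral {0..T n} (\<lambda>t. f (A y) z t + f y (A z) t) = f y z (T n) - f y z 0" by (rule integral_unique)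
    then have "integral {0..T n} (f (A y) z) + integral {0..T n} (f y (A z)) = f y z (T n) - f y z 0"
      by (simp add: integral_add[OF int int])
    then show ?thesis unfolding b_def distrib_left[symmetric] by simp
  qed
  \<comment> \<open>Representing the averages by bounded operators gives one subsequence that
    converges for all pairs of arguments at once.\<close>
  define P where "P n = Blinfun (\<lambda>y. \<Sum>i\<in>Basis. b n y i *\<^sub>R i)" for n
  have "bounded_linear (\<lambda>y. \<Sum>i\<in>Basis. b n y i *\<^sub>R i)" for n
    unfolding linear_conv_bounded_linear[symmetric]
    by (rule linearI) (simp_all add: b_add b_scale scaleR_add_left sum.distrib scaleR_sum_right)
  then have P: "blinfun_apply (P n) y = (\<Sum>i\<in>Basis. b n y i *\<^sub>R i)" for n y
    by (simp add: P_def bounded_linear_Blinfun_apply)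
  have Pb: "inner (P n y) z = b n y z" for n y z
  proof -
    have "b n y z = b n (\<Sum>i\<in>Basis. inner z i *\<^sub>R i) y" by (simp add: b_commute euclidean_representation)
    also have "\<dots> = (\<Sum>i\<in>Basis. inner z i * b n i y)"
      by (simp add: linear_sum[OF b_linear] b_scale)
    finally show ?thesis unfolding P inner_sum_left inner_scaleR_left b_commute[of n y] inner_commute[of z]
      by (simp add: mult.commute)
  qed
  have "norm (P n) \<le> M\<^sup>2" for n
  proof (rule norm_blinfun_bound)
    fix y
    have "norm (P n y) * norm (P n y) \<le> (M\<^sup>2 * norm y) * norm (P n y)"
      using b_le[of n y "P n y"] Pb[of n y "P n y"] by (simp add: dot_square_norm power2_eq_square)
    then show "norm (P n y) \<le> M\<^sup>2 * norm y" by (cases "norm (P n y) = 0") auto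
  qed simp
  then have "bounded (range P)" by (auto simp: bounded_iff)
  then obtain L r where r: "strict_mono (r :: nat \<Rightarrow> nat)" and L: "(\<lambda>k. P (r k)) \<longlonglongrightarrow> L"
    using bounded_imp_convergent_subsequence[of P] by (auto simp: comp_def)
  define \<beta> where "\<beta> y z = inner (L y) z" for y z
  have lim: "(\<lambda>k. b (r k) y z) \<longlonglongrightarrow> \<beta> y z" for y z
    unfolding \<beta>_def Pb[symmetric] by (intro tendsto_inner tendsto_const blinfun.tendsto L)
  show thesis
  proof (rule that[of \<beta>])
    show "bilinear \<beta>" unfolding bilinear_def \<beta>_def
      by (auto intro!: linearI simp: blinfun.add_right blinfun.scaleR_right inner_add_left inner_add_right)
    show "\<beta> x y = \<beta> y x" for x y
      using LIMSEQ_unique[OF lim[of x y]] lim[of y x] b_commute by simp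
    show "\<beta> x x > 0" if "x \<noteq> 0" for x
    proof -
      have "(norm x)\<^sup>2 / M\<^sup>2 \<le> \<beta> x x" using b_ge by (intro LIMSEQ_le_const[OF lim]) auto
      moreover have "(norm x)\<^sup>2 / M\<^sup>2 > 0" using that bound by simp
      ultimately show ?thesis by linarith
    qed
    show "\<beta> (A x) y = - \<beta> x (A y)" for x y
    proof -
      have Tl: "(\<lambda>n. 2 * (M\<^sup>2 * norm x * norm y) * (1 / T n)) \<longlonglongrightarrow> 2 * (M\<^sup>2 * norm x * norm y) * 0"
        using LIMSEQ_inverse_real_of_nat by (intro tendsto_mult tendsto_const) (simp add: T_def divide_inverse)
      have "\<bar>b n (A x) y + b n x (A y)\<bar> \<le> 2 * (M\<^sup>2 * norm x * norm y) * (1 / T n)" for n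
      proof -
        have "\<bar>f x y (T n) - f x y 0\<bar> \<le> 2 * (M\<^sup>2 * norm x * norm y)"
          using f_le[of x y "T n"] f_le[of x y 0] by linarith
        then show ?thesis unfolding b_skew abs_mult using T[of n] by (simp add: field_simps)
      qed
      then have "(\<lambda>n. b n (A x) y + b n x (A y)) \<longlonglongrightarrow> 0"
        using Tl by (intro Lim_null_comparison[OF _ Tl[simplified]] always_eventually) simp
      then have "(\<lambda>k. b (r k) (A x) y + b (r k) x (A y)) \<longlonglongrightarrow> 0"
        using LIMSEQ_subseq_LIMSEQ[OF _ r] by (fastforce simp: comp_def)
      moreover have "(\<lambda>k. b (r k) (A x) y + b (r k) x (A y)) \<longlonglongrightarrow> \<beta> (A x) y + \<beta> x (A y)"
        by (intro tendsto_add lim)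
      ultimately have "\<beta> (A x) y + \<beta> x (A y) = 0" by (rule LIMSEQ_unique[symmetric])
      then show ?thesis by simp
    qed
  qed
qed

section \<open>The Killing form of a compact simple group\<close>

lemma linear_bracket: "linear (bracket X)"
  by (simp add: bracket.bounded_linear_right bounded_linear.linear)

lemma linear_bracket_bracket: "linear (\<lambda>Z. bracket X (bracket Y Z))"
  using linear_compose[OF linear_bracket[of Y] linear_bracket[of X]] by (simp add: o_def)

locale compact_simple_group = compact_matrix_group G for G :: "'n::finite cmat set" +
  assumes simple: "simple_lie_group G"
begin

abbreviation "\<g> \<equiv> lie_algebra G"

lemma nonabelian: "\<exists>X\<in>\<g>. \<exists>Y\<in>\<g>. bracket X Y \<noteq> 0"
  and ideal_trivial: "lie_ideal \<g> I \<Longrightarrow> I = {0} \<or> I = \<g>"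
  using simple by (auto simp: simple_lie_group_def simple_lie_algebra_def)

text \<open>The centre is an ideal, and it is not all of \<open>\<g>\<close> because some bracket is
  nonzero.\<close>

lemma centre_trivial:
  assumes X: "X \<in> \<g>" and c: "\<And>Y. Y \<in> \<g> \<Longrightarrow> bracket X Y = 0"
  shows "X = 0"
proof -
  define I where "I = {X\<in>\<g>. \<forall>Y\<in>\<g>. bracket X Y = 0}"
  have "subspace I" unfolding I_def
    using subspace_lie_algebra by (auto simp: subspace_def bracket.add_left bracket.scaleR_left bracket.zero_left)
  moreover have "bracket Y Z \<in> I" if "Y \<in> \<g>" "Z \<in> I" for Y Z
  proof -
    have "bracket Y Z = 0" using that bracket_swap[of Y Z] by (simp add: I_def)
    then show ?thesis using \<open>subspace I\<close> by (simp add: subspace_0)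
  qed
  ultimately have "lie_ideal \<g> I" by (auto simp: lie_ideal_def I_def)
  then have "I = {0} \<or> I = \<g>" by (rule ideal_trivial)
  moreover have "I \<noteq> \<g>" using nonabelian by (auto simp: I_def)
  ultimately show ?thesis using assms by (auto simp: I_def)
qed

lemma bracket_image: "X \<in> \<g> \<Longrightarrow> bracket X ` \<g> \<subseteq> \<g>"
  and bracket_bracket_image: "X \<in> \<g> \<Longrightarrow> Y \<in> \<g> \<Longrightarrow> (\<lambda>Z. bracket X (bracket Y Z)) ` \<g> \<subseteq> \<g>"
  by (auto intro!: bracket_in)

text \<open>Once ad X is skew for some inner product, the trace of its square is minus the sum of
  the squared lengths of \<open>bracket X b\<close> over an orthonormal basis, which vanishes only
  for central \<open>X\<close>. The inner product may depend on \<open>X\<close>, so the average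
  runs over the conjugations by \<open>mat_exp (t *\<^sub>R X)\<close> alone.\<close>

lemma killing_neg:
  assumes X: "X \<in> \<g>" "X \<noteq> 0"
  shows "killing \<g> X X < 0"
proof -
  let ?\<phi> = "\<lambda>t Y. mat_exp (t *\<^sub>R X) ** Y ** mat_exp ((- t) *\<^sub>R X)"
  obtain M where M: "M > 0" "\<And>t. norm (mat_exp (t *\<^sub>R X)) \<le> M" using exp_bounded X by metis
  \<comment> \<open>\<open>K\<close> bounds the matrix product; a conjugation contains two products
    and two exponentials, hence the constant \<open>M * K * M * K\<close>.\<close>
  have "\<exists>K>0. \<forall>(A :: 'n cmat) B :: 'n cmat. norm (A ** B) \<le> norm A * norm B * K"
    by (rule mmult.pos_bounded)
  then obtain K where "K > 0" and K': "\<forall>(A :: 'n cmat) B :: 'n cmat. norm (A ** B) \<le> norm A * norm B * K"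
    by (elim exE conjE)
  note K = \<open>K > 0\<close> K'[rule_format]
  have ee: "mat_exp (t *\<^sub>R X) ** mat_exp ((- t) *\<^sub>R X) = mat 1" "mat_exp ((- t) *\<^sub>R X) ** mat_exp (t *\<^sub>R X) = mat 1" for t
    using mat_exp_minus[of "t *\<^sub>R X"] by simp_all
  have "\<exists>\<beta> :: 'n cmat \<Rightarrow> 'n cmat \<Rightarrow> real. bilinear \<beta> \<and> (\<forall>x y. \<beta> x y = \<beta> y x) \<and> (\<forall>x. x \<noteq> 0 \<longrightarrow> \<beta> x x > 0) \<and>
    (\<forall>x y. \<beta> (bracket X x) y = - \<beta> x (bracket X y))" (is "\<exists>\<beta>. ?Q \<beta>")
  proof (rule invariant_form_exists[of ?\<phi> "bracket X" "M * K * M * K"])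
    show "linear (?\<phi> t)" for t
      by (rule linearI) (simp_all add: mmult.add_left mmult.add_right mmult.scaleR_left mmult.scaleR_right)
    show "?\<phi> 0 y = y" for y by simp
    show "((\<lambda>t. ?\<phi> t y) has_vector_derivative ?\<phi> t (bracket X y)) (at t)" for t y
      by (rule exp_conj_has_vector_derivative)
    show "M * K * M * K > 0" using M K by simp
    show "norm (?\<phi> t y) \<le> M * K * M * K * norm y" for t y
    proof -
      have "norm (?\<phi> t y) \<le> norm (mat_exp (t *\<^sub>R X) ** y) * norm (mat_exp ((- t) *\<^sub>R X)) * K" by (rule K)
      also have "\<dots> \<le> (M * norm y * K) * M * K"
      proof (intro mult_mono)
        show "norm (mat_exp (t *\<^sub>R X) ** y) \<le> M * norm y * K"
          using K(2)[of "mat_exp (t *\<^sub>R X)" y] M(2)[of t] K(1)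
          by (meson mult_right_mono norm_ge_zero order_trans less_imp_le)
      qed (use M K M(2)[of "- t"] in auto)
      finally show ?thesis by (simp add: mult_ac)
    qed
    show "?\<phi> (- t) (?\<phi> t y) = y" for t y
    proof -
      have "?\<phi> (- t) (?\<phi> t y) = (mat_exp ((- t) *\<^sub>R X) ** mat_exp (t *\<^sub>R X)) ** y ** (mat_exp ((- t) *\<^sub>R X) ** mat_exp (t *\<^sub>R X))"
        by (simp add: matrix_mul_assoc)
      then show ?thesis by (simp only: ee matrix_mul_lid matrix_mul_rid)
    qed
    show "\<exists>\<beta>. ?Q \<beta>" if "bilinear \<beta>" "\<And>x y. \<beta> x y = \<beta> y x" "\<And>x. x \<noteq> 0 \<Longrightarrow> \<beta> x x > 0"
      "\<And>x y. \<beta> (bracket X x) y = - \<beta> x (bracket X y)" for \<beta> :: "'n cmat \<Rightarrow> 'n cmat \<Rightarrow> real"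
      by (intro exI[of _ \<beta>] conjI allI impI that)
  qed
  then obtain \<beta> :: "'n cmat \<Rightarrow> 'n cmat \<Rightarrow> real" where Q: "?Q \<beta>" by (rule exE)
  note \<beta> = conjunct1[OF Q] conjunct1[OF conjunct2[OF Q], rule_format]
    conjunct1[OF conjunct2[OF conjunct2[OF Q]], rule_format] conjunct2[OF conjunct2[OF conjunct2[OF Q]], rule_format]
  interpret inner_form \<beta> \<g> by unfold_locales (rule \<beta> subspace_lie_algebra; assumption?)+
  obtain B where B: "orthonormal_basis B" using exists_orthonormal_basis by blast
  have BV: "B \<subseteq> \<g>" "span B = \<g>" "finite B" using B span_superset by (auto simp: orthonormal_basis_def)
  have "killing \<g> X X = (\<Sum>b\<in>B. \<beta> (bracket X (bracket X b)) b)"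
    unfolding killing_def
    by (rule trace_on_orthonormal[OF B linear_bracket_bracket bracket_bracket_image[OF X(1) X(1)]])
  also have "\<dots> = - (\<Sum>b\<in>B. \<beta> (bracket X b) (bracket X b))"
    by (simp add: \<beta>(4) sum_negf)
  finally have k: "killing \<g> X X = - (\<Sum>b\<in>B. \<beta> (bracket X b) (bracket X b))" .
  have nn: "\<beta> x x \<ge> 0" for x using \<beta>(3)[of x] by (cases "x = 0") (auto simp: form_simps)
  have "(\<Sum>b\<in>B. \<beta> (bracket X b) (bracket X b)) \<noteq> 0"
  proof
    assume "(\<Sum>b\<in>B. \<beta> (bracket X b) (bracket X b)) = 0"
    then have "\<forall>b\<in>B. \<beta> (bracket X b) (bracket X b) = 0" using nn BV by (subst (asm) sum_nonneg_eq_0_iff) auto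
    then have "\<forall>b\<in>B. bracket X b = 0" using \<beta>(3) by (metis less_irrefl)
    then have "bracket X Y = 0" if "Y \<in> span B" for Y
      using linear_eq_0_on_span[OF linear_bracket _ that] by blast
    then show False using centre_trivial X BV by metis
  qed
  moreover have "(\<Sum>b\<in>B. \<beta> (bracket X b) (bracket X b)) \<ge> 0" using nn by (intro sum_nonneg)
  ultimately show ?thesis using k by linarith
qed

text \<open>By the Jacobi identity ad of a bracket is the commutator of the ad maps, and the trace
  is cyclic: tr(YXZ) = tr(XZY) for the ad maps of X, Y, Z.\<close>

lemma killing_invariant:
  assumes X: "X \<in> \<g>" and Y: "Y \<in> \<g>" and Z: "Z \<in> \<g>"
  shows "killing \<g> X Y = killing \<g> Y X" "killing \<g> (bracket X Y) Z = killing \<g> X (bracket Y Z)"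
proof -
  interpret inner_form inner \<g> by (rule inner_form_inner[OF subspace_lie_algebra])
  obtain B where B: "orthonormal_basis B" using exists_orthonormal_basis by blast
  note im = bracket_image[OF X] bracket_image[OF Y] bracket_image[OF Z]
  show "killing \<g> X Y = killing \<g> Y X"
    unfolding killing_def by (rule trace_on_commute[OF linear_bracket im(1) linear_bracket im(2)])
  have tr_diff: "trace_on \<g> (\<lambda>x. f x - g x) = trace_on \<g> f - trace_on \<g> g"
    if "linear f" "f ` \<g> \<subseteq> \<g>" "linear g" "g ` \<g> \<subseteq> \<g>" for f g
    using that subspace_diff[OF subspace_lie_algebra] linear_compose_sub[OF that(1,3)]
    by (simp add: trace_on_orthonormal[OF B] image_subset_iff inner_diff_left sum_subtractf)
  have lin3: "linear (\<lambda>W. bracket X (bracket Y (bracket Z W)))" for X Y Z :: "'n cmat"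
    using linear_compose[OF linear_bracket_bracket[of Y Z] linear_bracket[of X]] by (simp add: o_def)
  have im3: "(\<lambda>W. bracket A (bracket B (bracket C W))) ` \<g> \<subseteq> \<g>" if "A \<in> \<g>" "B \<in> \<g>" "C \<in> \<g>" for A B C
    using that by (auto intro!: bracket_in)
  have "killing \<g> (bracket X Y) Z = trace_on \<g> (\<lambda>W. bracket X (bracket Y (bracket Z W)) - bracket Y (bracket X (bracket Z W)))"
    unfolding killing_def by (intro arg_cong[of _ _ "trace_on \<g>"] ext) (simp add: jacobi[of X Y])
  also have "\<dots> = trace_on \<g> (\<lambda>W. bracket X (bracket Y (bracket Z W))) - trace_on \<g> (\<lambda>W. bracket Y (bracket X (bracket Z W)))"
    by (intro tr_diff lin3 im3 X Y Z)
  also have "trace_on \<g> (\<lambda>W. bracket Y (bracket X (bracket Z W))) = trace_on \<g> (\<lambda>W. bracket X (bracket Z (bracket Y W)))"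
    by (rule trace_on_commute[OF linear_bracket im(2) linear_bracket_bracket bracket_bracket_image[OF X Z]])
  also have "trace_on \<g> (\<lambda>W. bracket X (bracket Y (bracket Z W))) - trace_on \<g> (\<lambda>W. bracket X (bracket Z (bracket Y W)))
      = trace_on \<g> (\<lambda>W. bracket X (bracket Y (bracket Z W)) - bracket X (bracket Z (bracket Y W)))"
    by (intro tr_diff[symmetric] lin3 im3 X Y Z)
  also have "\<dots> = killing \<g> X (bracket Y Z)"
    unfolding killing_def by (intro arg_cong[of _ _ "trace_on \<g>"] ext) (simp add: jacobi[of Y Z] bracket.add_right)
  finally show "killing \<g> (bracket X Y) Z = killing \<g> X (bracket Y Z)" .
qed

text \<open>\<^term>\<open>lie_inner\<close> is bilinear on the Lie algebra only, so it is extended to all matrices.\<close>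

lemma lie_inner_extension:
  assumes "\<rho> > 0"
  obtains ip where "inner_form ip \<g>" "\<And>X Y. X \<in> \<g> \<Longrightarrow> Y \<in> \<g> \<Longrightarrow> lie_inner \<rho> \<g> X Y = ip X Y"
    "\<And>X Y Z. X \<in> \<g> \<Longrightarrow> Y \<in> \<g> \<Longrightarrow> Z \<in> \<g> \<Longrightarrow> ip (bracket X Y) Z = ip X (bracket Y Z)"
proof -
  interpret inner_form inner \<g> by (rule inner_form_inner[OF subspace_lie_algebra])
  obtain B where B: "orthonormal_basis B" using exists_orthonormal_basis by blast
  define k where "k X Y = (\<Sum>b\<in>B. inner (bracket X (bracket Y b)) b)" for X Y
  have k: "killing \<g> X Y = k X Y" if "X \<in> \<g>" "Y \<in> \<g>" for X Y
    unfolding killing_def k_def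
    by (rule trace_on_orthonormal[OF B linear_bracket_bracket bracket_bracket_image[OF that]])
  \<comment> \<open>On the Lie algebra the two summands agree; their mean makes the extension
    symmetric on all matrices.\<close>
  define ip where "ip X Y = - (\<rho> / 2) * (k X Y + k Y X)" for X Y
  have eq: "lie_inner \<rho> \<g> X Y = ip X Y" if "X \<in> \<g>" "Y \<in> \<g>" for X Y
    using killing_invariant(1)[OF that that(1)] that by (simp add: lie_inner_def ip_def k)
  have k_lin: "k (X + X') Y = k X Y + k X' Y" "k Y (X + X') = k Y X + k Y X'" "k (c *\<^sub>R X) Y = c * k X Y" "k Y (c *\<^sub>R X) = c * k Y X" for X X' Y c
    by (simp_all add: k_def bracket.add_left bracket.add_right bracket.scaleR_left bracket.scaleR_right inner_add_left sum.distrib sum_distrib_left)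
  show thesis
  proof (rule that[of ip])
    show "inner_form ip \<g>"
    proof
      show "bilinear ip" unfolding bilinear_def
        by (auto intro!: linearI simp: ip_def k_lin algebra_simps add_divide_distrib)
      show "ip x y = ip y x" for x y by (simp add: ip_def add.commute)
      show "subspace \<g>" by (rule subspace_lie_algebra)
      show "ip x x > 0" if "x \<in> \<g>" "x \<noteq> 0" for x
        using killing_neg[OF that] assms that by (simp add: ip_def k mult_pos_neg)
    qed
    show "lie_inner \<rho> \<g> X Y = ip X Y" if "X \<in> \<g>" "Y \<in> \<g>" for X Y by (rule eq[OF that])
    show "ip (bracket X Y) Z = ip X (bracket Y Z)" if "X \<in> \<g>" "Y \<in> \<g>" "Z \<in> \<g>" for X Y Z
      using killing_invariant(2)[OF that] that bracket_in by (simp add: eq[symmetric] lie_inner_def)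
  qed
qed

end

section \<open>Common eigenvectors\<close>

context inner_form
begin

lemma continuous_on_form:
  assumes "continuous_on S f" "continuous_on S g"
  shows "continuous_on S (\<lambda>x. \<beta> (f x) (g x))"
  using bilin assms unfolding bilinear_conv_bounded_bilinear by (rule bounded_bilinear.continuous_on)

text \<open>The maximum \<open>\<mu>\<close> of the Rayleigh quotient makes \<open>g\<close>
  positive semidefinite on \<open>V\<close> with \<open>g x x = 0\<close>. For such a form
  \<open>x\<close> is orthogonal to all of \<open>V\<close>, which says that \<open>x\<close> is an
  eigenvector.\<close>

lemma symmetric_eigenvector:
  assumes W: "V \<noteq> {0}" and A: "linear A" "\<And>x. x \<in> V \<Longrightarrow> A x \<in> V"
    and sym: "\<And>x y. x \<in> V \<Longrightarrow> y \<in> V \<Longrightarrow> \<beta> (A x) y = \<beta> x (A y)"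
  shows "\<exists>x\<in>V. \<exists>\<mu>. x \<noteq> 0 \<and> A x = \<mu> *\<^sub>R x"
proof -
  \<comment> \<open>The sphere is that of the ambient norm, for which compactness is available; the
    quotient \<open>q\<close> is invariant under scaling.\<close>
  define K where "K = sphere 0 1 \<inter> V"
  define q where "q x = \<beta> (A x) x / \<beta> x x" for x
  have K: "compact K" unfolding K_def by (intro compact_Int_closed compact_sphere closed_subspace V)
  have K0: "\<beta> x x \<noteq> 0" if "x \<in> K" for x
  proof -
    have "x \<in> V" "x \<noteq> 0" using that by (auto simp: K_def)
    then show ?thesis using pos[of x] by simp
  qed
  obtain w where w: "w \<in> V" "w \<noteq> 0" using W V subspace_0 by blast
  have scaled: "(1 / norm x) *\<^sub>R x \<in> K" if "x \<in> V" "x \<noteq> 0" for x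
    using that V by (simp add: K_def subspace_scale)
  have "continuous_on K A" using A(1) by (simp add: linear_continuous_on linear_conv_bounded_linear)
  then have "continuous_on K q"
    unfolding q_def using K0 by (intro continuous_on_divide continuous_on_form continuous_on_id) auto
  then obtain x where x: "x \<in> K" and max: "\<And>y. y \<in> K \<Longrightarrow> q y \<le> q x"
    using continuous_attains_sup[OF K, of q] scaled[OF w] by blast
  have xV: "x \<in> V" "x \<noteq> 0" using x by (auto simp: K_def)
  define \<mu> where "\<mu> = q x"
  define g where "g y z = \<mu> * \<beta> y z - \<beta> (A y) z" for y z
  have g_nonneg: "g y y \<ge> 0" if y: "y \<in> V" for y
  proof (cases "y = 0")
    case False
    have "q ((1 / norm y) *\<^sub>R y) \<le> \<mu>" unfolding \<mu>_def by (rule max[OF scaled[OF y False]])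
    moreover have "q ((1 / norm y) *\<^sub>R y) = q y"
      using False by (simp add: q_def form_simps linear_scale[OF A(1)])
    ultimately have "\<beta> (A y) y / \<beta> y y \<le> \<mu>" by (simp add: q_def)
    then show ?thesis using pos[OF y False] by (simp add: g_def field_simps)
  qed (simp add: g_def form_simps)
  have g_x: "g x x = 0" using K0[OF x] by (simp add: g_def \<mu>_def q_def)
  have g_xy: "g x y = 0" if y: "y \<in> V" for y
  proof (rule ccontr)
    assume n: "g x y \<noteq> 0"
    \<comment> \<open>The 1 in the denominator covers \<open>g y y = 0\<close>; with this
      \<open>s\<close> the form at \<open>x + s *\<^sub>R y\<close> is \<open>s * g x y\<close>
      minus the square of \<open>s\<close>, which is negative.\<close>
    define s where "s = - g x y / (g y y + 1)"
    have pp: "g y y + 1 > 0" using g_nonneg[OF y] by simp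
    have com: "g y x = g x y" using sym[OF xV(1) y] commute[of y x] commute[of "A y" x] by (simp add: g_def)
    have "x + s *\<^sub>R y \<in> V" using xV y V by (simp add: subspace_add subspace_scale)
    then have "0 \<le> g (x + s *\<^sub>R y) (x + s *\<^sub>R y)" by (rule g_nonneg)
    also have "\<dots> = g x x + s * g x y + s * g y x + s * s * g y y"
      by (simp add: g_def form_simps linear_add[OF A(1)] linear_scale[OF A(1)] algebra_simps)
    also have "\<dots> = 2 * s * g x y + s\<^sup>2 * g y y" by (simp add: g_x com power2_eq_square)
    also have "\<dots> = 2 * s * g x y + s\<^sup>2 * (g y y + 1) - s\<^sup>2" by (simp add: algebra_simps)
    also have "s\<^sup>2 * (g y y + 1) = - s * g x y" using pp by (simp add: s_def power2_eq_square)
    also have "2 * s * g x y + - s * g x y - s\<^sup>2 = s * g x y - s\<^sup>2" by simp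
    also have "\<dots> < 0"
    proof -
      have "s * g x y = - ((g x y)\<^sup>2 / (g y y + 1))" by (simp add: s_def power2_eq_square)
      moreover have "(g x y)\<^sup>2 / (g y y + 1) > 0" using n pp by simp
      ultimately show ?thesis using zero_le_power2[of s] by linarith
    qed
    finally show False by simp
  qed
  have d: "\<mu> *\<^sub>R x - A x \<in> V" using xV A V by (simp add: subspace_diff subspace_scale)
  have "\<beta> (\<mu> *\<^sub>R x - A x) y = g x y" for y
    by (simp add: g_def bilinear_lsub[OF bilin] bilinear_lmul[OF bilin])
  then have "\<beta> (\<mu> *\<^sub>R x - A x) (\<mu> *\<^sub>R x - A x) = 0" using g_xy[OF d] by simp
  then have "A x = \<mu> *\<^sub>R x" using form_eq_0D[OF d] by simp
  then show ?thesis using xV by blast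
qed

end

text \<open>An eigenspace of the first operator is preserved by those that commute with it, so the
  induction continues inside it.\<close>

lemma common_eigenvector:
  assumes "inner_form \<beta> V" "V \<noteq> {0}"
    and "\<And>A. A \<in> set As \<Longrightarrow> linear A"
    and "\<And>A x. A \<in> set As \<Longrightarrow> x \<in> V \<Longrightarrow> A x \<in> V"
    and "\<And>A x y. A \<in> set As \<Longrightarrow> x \<in> V \<Longrightarrow> y \<in> V \<Longrightarrow> \<beta> (A x) y = \<beta> x (A y)"
    and "\<And>A B x. A \<in> set As \<Longrightarrow> B \<in> set As \<Longrightarrow> x \<in> V \<Longrightarrow> A (B x) = B (A x)"
  shows "\<exists>x\<in>V. x \<noteq> 0 \<and> (\<forall>A\<in>set As. \<exists>\<mu>. A x = \<mu> *\<^sub>R x)"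
  using assms
proof (induction As arbitrary: V)
  case Nil
  then show ?case using inner_form.V subspace_0 by fastforce
next
  case (Cons A As)
  interpret inner_form \<beta> V by (rule Cons.prems(1))
  have A: "linear A" "\<And>x. x \<in> V \<Longrightarrow> A x \<in> V" "\<And>x y. x \<in> V \<Longrightarrow> y \<in> V \<Longrightarrow> \<beta> (A x) y = \<beta> x (A y)"
    using Cons.prems(3-5)[of A] by auto
  obtain x \<mu> where x: "x \<in> V" "x \<noteq> 0" "A x = \<mu> *\<^sub>R x" using symmetric_eigenvector[OF Cons.prems(2) A] by blast
  define W where "W = {x\<in>V. A x = \<mu> *\<^sub>R x}"
  have W: "subspace W" using V unfolding W_def
    by (auto simp: subspace_def linear_add[OF A(1)] linear_scale[OF A(1)] linear_0[OF A(1)] scaleR_add_right)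
  have 1: "inner_form \<beta> W" by unfold_locales (use bilin commute pos W in \<open>auto simp: W_def\<close>)
  have 2: "W \<noteq> {0}" using x by (auto simp: W_def)
  have 3: "B y \<in> W" if B: "B \<in> set As" and y: "y \<in> W" for B y
  proof -
    have "A (B y) = B (A y)" using Cons.prems(6)[of A B y] B y by (simp add: W_def)
    also have "\<dots> = \<mu> *\<^sub>R B y" using Cons.prems(3)[of B] B y by (simp add: W_def linear_scale)
    finally show ?thesis using Cons.prems(4)[of B y] B y by (simp add: W_def)
  qed
  have "\<exists>x\<in>W. x \<noteq> 0 \<and> (\<forall>A\<in>set As. \<exists>\<mu>. A x = \<mu> *\<^sub>R x)"
    by (rule Cons.IH[OF 1 2]) (use Cons.prems(3,5,6) 3 in \<open>auto simp: W_def\<close>)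
  then show ?case using W_def by auto
qed

section \<open>The complexification\<close>

text \<open>Multiplication by the formal imaginary unit.\<close>

definition J :: "'n::finite cmat \<times> 'n cmat \<Rightarrow> 'n cmat \<times> 'n cmat" where
  "J Z = (- snd Z, fst Z)"

text \<open>Complex conjugation with respect to the real form.\<close>

definition cj :: "'n::finite cmat \<times> 'n cmat \<Rightarrow> 'n cmat \<times> 'n cmat" where
  "cj Z = (fst Z, - snd Z)"

lemma bounded_bilinear_cplx_bracket:
  "bounded_bilinear (cplx_bracket :: 'n::finite cmat \<times> 'n cmat \<Rightarrow> 'n cmat \<times> 'n cmat \<Rightarrow> 'n cmat \<times> 'n cmat)"
  unfolding bilinear_conv_bounded_bilinear[symmetric] bilinear_def cplx_bracket_def
  by (intro conjI allI linearI)
    (simp_all add: bracket.add_left bracket.add_right bracket.scaleR_left bracket.scaleR_right algebra_simps)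

interpretation cb: bounded_bilinear "cplx_bracket :: 'n::finite cmat \<times> 'n cmat \<Rightarrow> 'n cmat \<times> 'n cmat \<Rightarrow> 'n cmat \<times> 'n cmat"
  by (rule bounded_bilinear_cplx_bracket)

lemma cb_jacobi: "cplx_bracket A (cplx_bracket B C) = cplx_bracket (cplx_bracket A B) C + cplx_bracket B (cplx_bracket A C)"
  unfolding cplx_bracket_def
  by (simp add: bracket.add_left bracket.add_right bracket.diff_left bracket.diff_right
      jacobi[of "fst A" "fst B"] jacobi[of "fst A" "snd B"] jacobi[of "snd A" "fst B"] jacobi[of "snd A" "snd B"])

lemma cb_swap: "cplx_bracket B A = - cplx_bracket A B"
  unfolding cplx_bracket_def
  by (simp add: bracket_swap[of "fst A" "fst B"] bracket_swap[of "fst A" "snd B"] bracket_swap[of "snd A" "fst B"] bracket_swap[of "snd A" "snd B"])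

lemma cb_self: "cplx_bracket A A = 0"
  by (simp add: cplx_bracket_def bracket_swap[of "snd A" "fst A"] zero_prod_def)

lemma cb_J: "cplx_bracket (J A) B = J (cplx_bracket A B)" "cplx_bracket A (J B) = J (cplx_bracket A B)"
  by (simp_all add: cplx_bracket_def J_def bracket.minus_left bracket.minus_right)

lemma cb_cj: "cplx_bracket (cj A) (cj B) = cj (cplx_bracket A B)"
  by (simp add: cplx_bracket_def cj_def bracket.minus_left bracket.minus_right)

lemma J_simps [simp]: "J (J Z) = - Z" "J (A + B) = J A + J B" "J (c *\<^sub>R Z) = c *\<^sub>R J Z" "J 0 = 0" "J (- Z) = - J Z"
  "J (T, 0) = (0, T)"
  by (simp_all add: J_def prod_eq_iff)

lemma cj_J: "cj (J Z) = - J (cj Z)"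
  by (simp add: J_def cj_def)

lemma cj_simps [simp]: "cj (T, 0) = (T, 0)" "cj (cj Z) = Z" "cj (c *\<^sub>R Z) = c *\<^sub>R cj Z" "cj Z = 0 \<longleftrightarrow> Z = 0"
  by (simp_all add: cj_def prod_eq_iff)

section \<open>Roots\<close>

text \<open>\<open>centralizer\<close> is the algebraic content of the maximality of the torus, and
  \<open>ideals\<close> that of simplicity.\<close>

locale cartan_algebra = inner_form ip \<g> for ip :: "'n::finite cmat \<Rightarrow> 'n cmat \<Rightarrow> real" and \<g> :: "'n cmat set" +
  fixes \<t> :: "'n cmat set"
  assumes bracket_closed: "X \<in> \<g> \<Longrightarrow> Y \<in> \<g> \<Longrightarrow> bracket X Y \<in> \<g>"
    and invariant: "X \<in> \<g> \<Longrightarrow> Y \<in> \<g> \<Longrightarrow> Z \<in> \<g> \<Longrightarrow> ip (bracket X Y) Z = ip X (bracket Y Z)"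
    and ideals: "lie_ideal \<g> I \<Longrightarrow> I = {0} \<or> I = \<g>"
    and \<t>_sub: "\<t> \<subseteq> \<g>" and \<t>: "subspace \<t>"
    and abelian: "S \<in> \<t> \<Longrightarrow> T \<in> \<t> \<Longrightarrow> bracket S T = 0"
    and centralizer: "X \<in> \<g> \<Longrightarrow> (\<And>T. T \<in> \<t> \<Longrightarrow> bracket T X = 0) \<Longrightarrow> X \<in> \<t>"
begin

text \<open>The real part of the Hermitian extension of \<open>ip\<close>.\<close>

definition hp :: "'n cmat \<times> 'n cmat \<Rightarrow> 'n cmat \<times> 'n cmat \<Rightarrow> real" where
  "hp A B = ip (fst A) (fst B) + ip (snd A) (snd B)"

lemma skew: "X \<in> \<g> \<Longrightarrow> Y \<in> \<g> \<Longrightarrow> Z \<in> \<g> \<Longrightarrow> ip (bracket X Y) Z = - ip Y (bracket X Z)"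
  using invariant[of Y X Z] bracket_swap[of X Y] by (simp add: form_simps)

lemma inner_form_hp: "subspace W \<Longrightarrow> W \<subseteq> \<g> \<times> \<g> \<Longrightarrow> inner_form hp W"
proof
  show "bilinear hp" unfolding bilinear_def
    by (auto intro!: linearI simp: hp_def form_simps algebra_simps)
  show "hp x y = hp y x" for x y by (simp add: hp_def commute)
  show "hp x x > 0" if W: "W \<subseteq> \<g> \<times> \<g>" and "x \<in> W" "x \<noteq> 0" for x
  proof -
    have x: "fst x \<in> \<g>" "snd x \<in> \<g>" using that by auto
    have "fst x \<noteq> 0 \<or> snd x \<noteq> 0" using that by (auto simp: prod_eq_iff)
    then show ?thesis
      using pos[OF x(1)] pos[OF x(2)] form_nonneg[OF x(1)] form_nonneg[OF x(2)] by (auto simp: hp_def intro: add_pos_nonneg add_nonneg_pos)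
  qed
qed

sublocale hp: inner_form hp "\<g> \<times> \<g>"
  by (rule inner_form_hp[OF subspace_Times[OF V V] subset_refl])

lemma hp_J: "hp (J A) B = - hp A (J B)"
  by (simp add: hp_def J_def form_simps)

text \<open>The adjoint of ad E is minus ad of the conjugate of E; in particular elements of \<g>
  act by skew operators.\<close>

lemma hp_skew:
  assumes "E \<in> \<g> \<times> \<g>" "A \<in> \<g> \<times> \<g>" "B \<in> \<g> \<times> \<g>"
  shows "hp (cplx_bracket E A) B = - hp A (cplx_bracket (cj E) B)"
  using assms by (auto simp: hp_def cplx_bracket_def cj_def form_simps skew bracket.minus_left)

lemma cb_closed: "A \<in> \<g> \<times> \<g> \<Longrightarrow> B \<in> \<g> \<times> \<g> \<Longrightarrow> cplx_bracket A B \<in> \<g> \<times> \<g>"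
  using V by (auto simp: cplx_bracket_def subspace_add subspace_diff bracket_closed)

lemma J_closed: "A \<in> \<g> \<times> \<g> \<Longrightarrow> J A \<in> \<g> \<times> \<g>" and cj_closed: "A \<in> \<g> \<times> \<g> \<Longrightarrow> cj A \<in> \<g> \<times> \<g>"
  using V by (auto simp: J_def cj_def subspace_neg)

lemma \<t>_closed: "T \<in> \<t> \<Longrightarrow> (T, 0) \<in> \<g> \<times> \<g>"
  using \<t>_sub V by (auto simp: subspace_0)

definition wt :: "'n cmat \<Rightarrow> 'n cmat \<times> 'n cmat \<Rightarrow> bool" where
  "wt a Z \<longleftrightarrow> Z \<in> \<g> \<times> \<g> \<and> (\<forall>T\<in>\<t>. cplx_bracket (T, 0) Z = ip a T *\<^sub>R J Z)"

definition rts :: "'n cmat set" where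
  "rts = {a\<in>\<t>. a \<noteq> 0 \<and> (\<exists>Z. Z \<noteq> 0 \<and> wt a Z)}"

lemma wt_closed: "wt a Z \<Longrightarrow> Z \<in> \<g> \<times> \<g>"
  and wt_bracket: "wt a Z \<Longrightarrow> T \<in> \<t> \<Longrightarrow> cplx_bracket (T, 0) Z = ip a T *\<^sub>R J Z"
  by (auto simp: wt_def)

text \<open>\<open>(0, T)\<close> is i T, which acts on weight vectors by real scalars.\<close>

lemma wt_bracket': "wt a Z \<Longrightarrow> T \<in> \<t> \<Longrightarrow> cplx_bracket (0, T) Z = - ip a T *\<^sub>R Z"
  using cb_J(1)[of "(T, 0)" Z] by (simp add: wt_bracket)

lemma wt_add:
  assumes "wt a Z" "wt b W"
  shows "wt (a + b) (cplx_bracket Z W)"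
  unfolding wt_def
proof (intro conjI ballI)
  show "cplx_bracket Z W \<in> \<g> \<times> \<g>" using assms by (simp add: cb_closed wt_closed)
  fix T assume T: "T \<in> \<t>"
  have "cplx_bracket (T, 0) (cplx_bracket Z W) = ip a T *\<^sub>R J (cplx_bracket Z W) + ip b T *\<^sub>R J (cplx_bracket Z W)"
    unfolding cb_jacobi[of "(T, 0)"] by (simp add: wt_bracket[OF assms(1) T] wt_bracket[OF assms(2) T] cb_J cb.scaleR_left cb.scaleR_right)
  then show "cplx_bracket (T, 0) (cplx_bracket Z W) = ip (a + b) T *\<^sub>R J (cplx_bracket Z W)"
    by (simp add: form_simps scaleR_add_left)
qed

lemma wt_cj:
  assumes "wt a Z"
  shows "wt (- a) (cj Z)"
  unfolding wt_def
proof (intro conjI ballI)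
  show "cj Z \<in> \<g> \<times> \<g>" using assms cj_closed wt_closed by blast
  fix T assume T: "T \<in> \<t>"
  show "cplx_bracket (T, 0) (cj Z) = ip (- a) T *\<^sub>R J (cj Z)"
    using cb_cj[of "(T, 0)" Z] by (simp add: wt_bracket[OF assms T] form_simps cj_J)
qed

lemma wt_J: "wt a Z \<Longrightarrow> wt a (J Z)"
  by (auto simp: wt_def J_closed cb_J)

lemma wt_scale: "wt a Z \<Longrightarrow> wt a (c *\<^sub>R Z)"
  using V by (auto simp: wt_def cb.scaleR_right subspace_scale)

lemma rts_\<t>: "a \<in> rts \<Longrightarrow> a \<in> \<t>" and rts_nonzero: "a \<in> rts \<Longrightarrow> a \<noteq> 0"
  by (auto simp: rts_def)

lemma \<t>_pos: "T \<in> \<t> \<Longrightarrow> T \<noteq> 0 \<Longrightarrow> ip T T > 0"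
  using pos \<t>_sub by blast

lemma rts_pos: "a \<in> rts \<Longrightarrow> ip a a > 0"
  using rts_\<t> rts_nonzero \<t>_pos by blast

lemma \<t>_nondegenerate: "S \<in> \<t> \<Longrightarrow> (\<And>T. T \<in> \<t> \<Longrightarrow> ip S T = 0) \<Longrightarrow> S = 0"
  using \<t>_pos by fastforce

lemma wt_0:
  assumes "wt 0 Z"
  shows "fst Z \<in> \<t>" "snd Z \<in> \<t>"
proof -
  have "cplx_bracket (T, 0) Z = 0" if "T \<in> \<t>" for T using wt_bracket[OF assms that] by (simp add: form_simps)
  then have "bracket T (fst Z) = 0 \<and> bracket T (snd Z) = 0" if "T \<in> \<t>" for T
    using that by (simp add: cplx_bracket_def zero_prod_def bracket.zero_left)
  moreover have "fst Z \<in> \<g>" "snd Z \<in> \<g>" using wt_closed[OF assms] by auto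
  ultimately show "fst Z \<in> \<t>" "snd Z \<in> \<t>" using centralizer by auto
qed

lemma wt_nonroot: "wt a Z \<Longrightarrow> a \<in> \<t> \<Longrightarrow> a \<noteq> 0 \<Longrightarrow> a \<notin> rts \<Longrightarrow> Z = 0"
  unfolding rts_def by blast

text \<open>\<open>T = a - b\<close> separates the two weights. Skewness compares the products of
  \<open>J Z\<close> with \<open>W\<close>, and since \<open>J\<close> preserves weights,
  \<open>Z\<close> may be replaced by \<open>J Z\<close>.\<close>

lemma wt_orthogonal:
  assumes Z: "wt a Z" and W: "wt b W" and ab: "a \<in> \<t>" "b \<in> \<t>" "a \<noteq> b"
  shows "hp Z W = 0"
proof -
  define T where "T = a - b"
  have T: "T \<in> \<t>" "T \<noteq> 0" using ab \<t> by (auto simp: T_def subspace_diff)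
  have n: "ip a T \<noteq> ip b T" using \<t>_pos[OF T] unfolding T_def by (simp add: form_simps)
  have *: "hp (J Z) W = 0" if Z: "wt a Z" for Z
  proof -
    have "ip a T * hp (J Z) W = hp (cplx_bracket (T, 0) Z) W" by (simp add: wt_bracket[OF Z T(1)] hp.form_simps)
    also have "\<dots> = - hp Z (cplx_bracket (T, 0) W)"
      using hp_skew[OF \<t>_closed[OF T(1)] wt_closed[OF Z] wt_closed[OF W]] by simp
    also have "\<dots> = ip b T * hp (J Z) W" by (simp add: wt_bracket[OF W T(1)] hp.form_simps hp_J)
    finally show ?thesis using n by simp
  qed
  show ?thesis using *[OF wt_J[OF Z]] by (simp add: hp.form_simps)
qed

lemma finite_rts: "finite rts"
proof (rule ccontr)
  assume "infinite rts"
  then obtain F where F: "F \<subseteq> rts" "finite F" "card F = Suc (DIM('n cmat \<times> 'n cmat))"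
    using infinite_arbitrarily_large by metis
  have "\<forall>a\<in>F. \<exists>Z. Z \<noteq> 0 \<and> wt a Z" using F by (auto simp: rts_def)
  then obtain z where z: "\<And>a. a \<in> F \<Longrightarrow> z a \<noteq> 0" "\<And>a. a \<in> F \<Longrightarrow> wt a (z a)" by metis
  have zz: "hp (z a) (z a) \<noteq> 0" if "a \<in> F" for a using hp.pos[OF wt_closed[OF z(2)[OF that]] z(1)[OF that]] by simp
  have orth: "hp (z a) (z b) = 0" if "a \<in> F" "b \<in> F" "a \<noteq> b" for a b
    using wt_orthogonal[OF z(2)[OF that(1)] z(2)[OF that(2)]] that F rts_\<t> by blast
  have "inj_on z F" using zz orth by (metis inj_onI)
  then have "card (z ` F) = Suc (DIM('n cmat \<times> 'n cmat))" using F card_image by metis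
  moreover have "independent (z ` F)"
  proof (rule hp.orthogonal_independent)
    show "finite (z ` F)" using F by simp
    show "hp b b \<noteq> 0" if "b \<in> z ` F" for b using that zz by blast
    show "hp b c = 0" if "b \<in> z ` F" "c \<in> z ` F" "b \<noteq> c" for b c using that orth by blast
  qed
  then have "card (z ` F) \<le> DIM('n cmat \<times> 'n cmat)" using independent_bound by blast
  ultimately show False by simp
qed

text \<open>\<open>c *\<^sub>R cj e\<close> completes \<open>e\<close> to an \<open>sl(2)\<close>-triple whose semisimple element acts on the weight space
  of \<open>b\<close> by the real number \<open>2 * ip b a / ip a a\<close>, so complex scalars are never needed.\<close>

lemma sl2_triple:
  assumes e: "wt a e" "e \<noteq> 0" and a: "a \<in> \<t>" "a \<noteq> 0"
  obtains c where "c < 0"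
    "\<And>b Z. wt b Z \<Longrightarrow> cplx_bracket e (cplx_bracket (c *\<^sub>R cj e) Z) - cplx_bracket (c *\<^sub>R cj e) (cplx_bracket e Z) = (2 * ip b a / ip a a) *\<^sub>R Z"
proof -
  define X where "X = fst e" define Y where "Y = snd e"
  have XY: "X \<in> \<g>" "Y \<in> \<g>" using wt_closed[OF e(1)] by (auto simp: X_def Y_def)
  have br: "bracket T X = - ip a T *\<^sub>R Y" "bracket T Y = ip a T *\<^sub>R X" if "T \<in> \<t>" for T
    using wt_bracket[OF e(1) that] by (auto simp: cplx_bracket_def J_def X_def Y_def bracket.zero_left)
  have aa: "ip a a > 0" using \<t>_pos a by blast
  have "X \<noteq> 0"
  proof
    assume "X = 0"
    then have "Y = 0" using br(1)[OF a(1)] aa by (simp add: bracket.zero_right)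
    then show False using e \<open>X = 0\<close> by (auto simp: X_def Y_def prod_eq_iff)
  qed
  then have n: "ip X X > 0" using pos XY by blast
  define U where "U = bracket X Y"
  have ee: "cplx_bracket e (cj e) = (0, - 2 *\<^sub>R U)"
    by (simp add: cplx_bracket_def cj_def X_def[symmetric] Y_def[symmetric] U_def bracket.minus_right bracket_swap[of Y X] scaleR_2)
  have "wt (a + - a) (cplx_bracket e (cj e))" by (intro wt_add wt_cj e)
  then have "- 2 *\<^sub>R U \<in> \<t>" using wt_0[of "cplx_bracket e (cj e)"] by (simp add: ee)
  then have "(- 1 / 2) *\<^sub>R (- 2 *\<^sub>R U) \<in> \<t>" by (rule subspace_scale[OF \<t>])
  then have U: "U \<in> \<t>" by simp
  \<comment> \<open>Invariance of the form determines the products of \<open>U\<close> with all of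
    \<t>, and the form is definite there, so \<open>U\<close> is a multiple of
    \<open>a\<close>.\<close>
  have "U + ip X X *\<^sub>R a = 0"
  proof (rule \<t>_nondegenerate)
    show "U + ip X X *\<^sub>R a \<in> \<t>" using U a \<t> by (simp add: subspace_add subspace_scale)
    fix T assume T: "T \<in> \<t>"
    then have Tg: "T \<in> \<g>" using \<t>_sub by auto
    have "ip U T = ip X (bracket Y T)" unfolding U_def by (rule invariant[OF XY Tg])
    also have "\<dots> = - (ip a T * ip X X)" using br(2)[OF T] bracket_swap[of Y T] by (simp add: form_simps)
    finally show "ip (U + ip X X *\<^sub>R a) T = 0" by (simp add: form_simps)
  qed
  then have U': "U = - (ip X X *\<^sub>R a)" by (simp add: eq_neg_iff_add_eq_0)
  \<comment> \<open>The bracket of \<open>e\<close> and \<open>cj e\<close> is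
    \<open>2 * ip X X\<close> times \<open>(0, a)\<close>, which acts on weight \<open>b\<close> by
    \<open>- ip b a\<close>; \<open>c\<close> normalises the product of these factors.\<close>
  define c where "c = - 1 / (ip X X * ip a a)"
  have c: "c < 0" using n aa by (simp add: c_def divide_neg_pos)
  show thesis
  proof (rule that[OF c])
    fix b Z assume Z: "wt b Z"
    have h: "cplx_bracket e (c *\<^sub>R cj e) = (c * 2 * ip X X) *\<^sub>R (0, a)"
      by (simp add: cb.scaleR_right ee U')
    have "cplx_bracket e (cplx_bracket (c *\<^sub>R cj e) Z) - cplx_bracket (c *\<^sub>R cj e) (cplx_bracket e Z) = cplx_bracket (cplx_bracket e (c *\<^sub>R cj e)) Z"
      by (simp add: cb_jacobi[of e])
    also have "\<dots> = (c * 2 * ip X X) *\<^sub>R (- ip b a *\<^sub>R Z)"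
      unfolding h cb.scaleR_left wt_bracket'[OF Z a(1)] ..
    also have "\<dots> = (2 * ip b a / ip a a) *\<^sub>R Z" using n aa by (simp add: c_def)
    finally show "cplx_bracket e (cplx_bracket (c *\<^sub>R cj e) Z) - cplx_bracket (c *\<^sub>R cj e) (cplx_bracket e Z) = (2 * ip b a / ip a a) *\<^sub>R Z" .
  qed
qed

text \<open>The weights of the string are distinct while there are only finitely many roots. The
  weight 0 is added to them because a string may pass through it.\<close>

lemma string_finite:
  assumes a: "a \<in> \<t>" "a \<noteq> 0" and b: "b \<in> \<t>"
    and z: "\<And>k::nat. wt (b + real k *\<^sub>R a) (z k)" and z0: "z 0 \<noteq> 0"
  obtains p where "\<And>k. k \<le> p \<Longrightarrow> z k \<noteq> 0" "z (Suc p) = 0"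
proof -
  have "\<exists>k. z k = 0"
  proof (rule ccontr)
    assume n: "\<not> ?thesis"
    have "b + real k *\<^sub>R a \<in> insert 0 rts" for k
    proof (cases "b + real k *\<^sub>R a = 0")
      case False
      moreover have "b + real k *\<^sub>R a \<in> \<t>" using a b \<t> by (simp add: subspace_add subspace_scale)
      ultimately have "b + real k *\<^sub>R a \<in> rts" using wt_nonroot[OF z[of k]] n by blast
      then show ?thesis by blast
    qed simp
    then have "range (\<lambda>k::nat. b + real k *\<^sub>R a) \<subseteq> insert 0 rts" by blast
    then have "finite (range (\<lambda>k::nat. b + real k *\<^sub>R a))" using finite_rts by (meson finite_insert finite_subset)
    moreover have "inj (\<lambda>k::nat. b + real k *\<^sub>R a)" using a by (auto intro: injI)
    ultimately show False using finite_imageD infinite_UNIV_nat by blast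
  qed
  then have L: "z (LEAST k. z k = 0) = 0" by (rule LeastI_ex)
  then obtain p where p: "(LEAST k. z k = 0) = Suc p" using z0 by (metis not0_implies_Suc)
  have "z k \<noteq> 0" if "k \<le> p" for k using not_less_Least[of k "\<lambda>k. z k = 0"] p that by simp
  then show thesis using that L p by metis
qed

text \<open>Climb with \<open>e\<close> for \<open>p\<close> steps to the top of the string, then
  descend with \<open>f\<close>, the last nonzero vector being \<open>q\<close> steps down. The
  relation \<open>Ez\<close> forces \<open>c + 2 * p = q\<close>, so \<open>c\<close> is an integer.
  If it is nonnegative, the vector \<open>q - p = c + p\<close> steps below the top is nonzero and
  has weight \<open>b - c *\<^sub>R a\<close>.\<close>

lemma root_string:
  assumes a: "a \<in> rts" and b: "b \<in> rts"
  defines "c \<equiv> 2 * ip b a / ip a a"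
  shows "c \<in> \<int>" "c \<ge> 0 \<Longrightarrow> b - c *\<^sub>R a \<in> rts"
proof -
  obtain e where e: "wt a e" "e \<noteq> 0" using a by (auto simp: rts_def)
  obtain Z where Z: "wt b Z" "Z \<noteq> 0" using b by (auto simp: rts_def)
  have at: "a \<in> \<t>" "a \<noteq> 0" and bt: "b \<in> \<t>" using a b rts_\<t> rts_nonzero by auto
  have aa: "ip a a > 0" using a by (rule rts_pos)
  obtain c0 where "\<And>b Z. wt b Z \<Longrightarrow> cplx_bracket e (cplx_bracket (c0 *\<^sub>R cj e) Z) - cplx_bracket (c0 *\<^sub>R cj e) (cplx_bracket e Z) = (2 * ip b a / ip a a) *\<^sub>R Z"
    using sl2_triple[OF e at] by metis
  define f where "f = c0 *\<^sub>R cj e"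
  define E where "E = cplx_bracket e"
  define F where "F = cplx_bracket f"
  have EF: "E (F Z) = F (E Z) + (2 * ip b a / ip a a) *\<^sub>R Z" if "wt b Z" for b Z
    using \<open>\<And>b Z. wt b Z \<Longrightarrow> _\<close>[OF that] by (simp add: E_def F_def f_def algebra_simps)
  have f: "wt (- a) f" unfolding f_def by (intro wt_scale wt_cj e)
  define up where "up k = (E ^^ k) Z" for k
  have up: "wt (b + real k *\<^sub>R a) (up k)" for k
  proof (induction k)
    case (Suc k)
    have "wt (a + (b + real k *\<^sub>R a)) (E (up k))" unfolding E_def by (rule wt_add[OF e(1) Suc])
    then show ?case by (simp add: up_def scaleR_add_left add_ac)
  qed (simp add: up_def Z)
  obtain p where p: "\<And>k. k \<le> p \<Longrightarrow> up k \<noteq> 0" "up (Suc p) = 0"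
    using string_finite[OF at bt up] Z by (auto simp: up_def)
  define b0 where "b0 = b + real p *\<^sub>R a"
  have b0t: "b0 \<in> \<t>" using at bt \<t> by (simp add: b0_def subspace_add subspace_scale)
  define z where "z k = (F ^^ k) (up p)" for k
  have zS: "z (Suc k) = F (z k)" for k by (simp add: z_def)
  have z: "wt (b0 + real k *\<^sub>R (- a)) (z k)" for k
  proof (induction k)
    case 0
    then show ?case using up[of p] by (simp add: z_def b0_def)
  next
    case (Suc k)
    have "wt (- a + (b0 + real k *\<^sub>R (- a))) (F (z k))" unfolding F_def by (rule wt_add[OF f Suc])
    then show ?case by (simp add: zS scaleR_add_left algebra_simps)
  qed
  have z0: "z 0 \<noteq> 0" using p by (simp add: z_def)
  obtain q where q: "\<And>k. k \<le> q \<Longrightarrow> z k \<noteq> 0" "z (Suc q) = 0"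
    using string_finite[OF _ _ b0t z z0] at \<t> by (auto simp: subspace_neg)
  define l where "l = c + 2 * real p"
  have wc: "2 * ip (b0 + real k *\<^sub>R (- a)) a / ip a a = l - 2 * real k" for k
    using aa by (simp add: b0_def l_def c_def form_simps field_simps)
  have Ez: "E (z (Suc k)) = (real (Suc k) * (l - real k)) *\<^sub>R z k" for k
  proof (induction k)
    case 0
    have "E (z 0) = 0" using p by (simp add: z_def up_def)
    then show ?case using EF[OF z[of 0]] unfolding zS wc by (simp add: F_def cb.zero_right)
  next
    case (Suc k)
    have "E (z (Suc (Suc k))) = F (E (z (Suc k))) + (l - 2 * real (Suc k)) *\<^sub>R z (Suc k)"
      unfolding zS[of "Suc k"] using EF[OF z[of "Suc k"]] unfolding wc .
    also have "F (E (z (Suc k))) = (real (Suc k) * (l - real k)) *\<^sub>R z (Suc k)"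
      using arg_cong[OF Suc, of F] by (simp only: F_def cb.scaleR_right zS[unfolded F_def])
    finally show ?case unfolding scaleR_add_left[symmetric] by (simp add: algebra_simps)
  qed
  have "(real (Suc q) * (l - real q)) *\<^sub>R z q = 0"
    using Ez[of q] q(2) by (simp add: E_def cb.zero_right)
  then have lq: "l = real q" using q(1)[of q] by simp
  then have cq: "c = real q - 2 * real p" by (simp add: l_def)
  then show "c \<in> \<int>" by simp
  assume "c \<ge> 0"
  define m where "m = q - p"
  have m: "m \<le> q" "real m = c + real p" using \<open>c \<ge> 0\<close> cq by (auto simp: m_def)
  have "b0 + real m *\<^sub>R (- a) = b - c *\<^sub>R a" by (simp add: b0_def m algebra_simps)
  then have w: "wt (b - c *\<^sub>R a) (z m)" using z[of m] by simp
  \<comment> \<open>The reflected weight is as long as \<open>b\<close>, hence nonzero, as the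
    definition of a root demands.\<close>
  have "ip (b - c *\<^sub>R a) (b - c *\<^sub>R a) = ip b b"
    using aa by (simp add: form_simps c_def commute[of a b] field_simps)
  then have "b - c *\<^sub>R a \<noteq> 0" using rts_pos[OF b] by (auto simp: form_simps)
  moreover have "b - c *\<^sub>R a \<in> \<t>" using at bt \<t> by (simp add: subspace_diff subspace_scale)
  ultimately show "b - c *\<^sub>R a \<in> rts" using w q(1)[OF m(1)] wt_nonroot by blast
qed

lemma neg_rts: "a \<in> rts \<Longrightarrow> - a \<in> rts"
  unfolding rts_def using wt_cj cj_simps(4) subspace_neg[OF \<t>] neg_equal_0_iff_equal by blast

text \<open>\<open>root_string\<close> reaches the reflected root when the Cartan integer is
  nonnegative; otherwise it is applied to \<open>- a\<close>, which defines the same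
  reflection.\<close>

lemma reflect_rts:
  assumes a: "a \<in> rts" and b: "b \<in> rts"
  shows "b - (2 * ip b a / ip a a) *\<^sub>R a \<in> rts"
proof (cases "ip b a \<ge> 0")
  case True
  then show ?thesis using root_string(2)[OF a b] rts_pos[OF a] by simp
next
  case False
  then show ?thesis using root_string(2)[OF neg_rts[OF a] b] rts_pos[OF a]
    by (simp add: form_simps divide_nonpos_pos)
qed

text \<open>The \<open>sl(2)\<close> relation makes the squared norm of \<open>[e, x]\<close> a negative multiple of that of \<open>x\<close>.\<close>

lemma lowering_injective:
  assumes e: "wt a e" "e \<noteq> 0" and a: "a \<in> \<t>" "a \<noteq> 0" and x: "wt b x" "ip b a > 0"
    and low: "cplx_bracket (cj e) x = 0"
  shows "x = 0"
proof -
  obtain c where c: "c < 0"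
    "\<And>b Z. wt b Z \<Longrightarrow> cplx_bracket e (cplx_bracket (c *\<^sub>R cj e) Z) - cplx_bracket (c *\<^sub>R cj e) (cplx_bracket e Z) = (2 * ip b a / ip a a) *\<^sub>R Z"
    using sl2_triple[OF e a] by metis
  define k where "k = 2 * ip b a / ip a a"
  have k: "k > 0" using x \<t>_pos[OF a] by (simp add: k_def)
  have eg: "e \<in> \<g> \<times> \<g>" and xg: "x \<in> \<g> \<times> \<g>" using e x wt_closed by auto
  have eq: "- (c *\<^sub>R cplx_bracket (cj e) (cplx_bracket e x)) = k *\<^sub>R x"
    using c(2)[OF x(1)] by (simp add: low cb.scaleR_left cb.zero_right k_def)
  have "k * hp x x = hp (k *\<^sub>R x) x" by (simp add: hp.form_simps)
  also have "\<dots> = - c * hp (cplx_bracket (cj e) (cplx_bracket e x)) x"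
    unfolding eq[symmetric] by (simp add: hp.form_simps)
  also have "hp (cplx_bracket (cj e) (cplx_bracket e x)) x = - hp (cplx_bracket e x) (cplx_bracket e x)"
    using hp_skew[OF cj_closed[OF eg] cb_closed[OF eg xg] xg] by simp
  finally have "k * hp x x \<le> 0" using c(1) hp.form_nonneg[OF cb_closed[OF eg xg]] by (simp add: mult_nonpos_nonneg)
  then show ?thesis using k hp.pos[OF xg] by (fastforce simp: mult_le_0_iff)
qed

text \<open>The hypotheses on \<open>hp\<close> say that \<open>x\<close> is orthogonal to the
  complex line through \<open>e\<close>. The bracket of \<open>cj e\<close> with \<open>x\<close>
  has weight 0, and it is orthogonal to the complexified \<t> because \<open>e\<close> maps that
  space into its own line. So it vanishes and \<open>lowering_injective\<close> applies.\<close>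

lemma root_space_one_dim:
  assumes e: "wt a e" "e \<noteq> 0" and a: "a \<in> \<t>" "a \<noteq> 0" and x: "wt a x" and orth: "hp x e = 0" "hp x (J e) = 0"
  shows "x = 0"
proof (rule lowering_injective[OF e a x])
  show "ip a a > 0" using \<t>_pos a by blast
  have eg: "e \<in> \<g> \<times> \<g>" and xg: "x \<in> \<g> \<times> \<g>" using e x wt_closed by auto
  let ?y = "cplx_bracket (cj e) x"
  have "wt (- a + a) ?y" by (rule wt_add[OF wt_cj[OF e(1)] x])
  then have y: "fst ?y \<in> \<t>" "snd ?y \<in> \<t>" using wt_0[of ?y] by auto
  have "ip (fst ?y) T = 0 \<and> ip (snd ?y) T = 0" if T: "T \<in> \<t>" for T
  proof -
    have Tg: "(T, 0) \<in> \<g> \<times> \<g>" "(0, T) \<in> \<g> \<times> \<g>" using \<t>_closed[OF T] by auto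
    have "ip (fst ?y) T = hp ?y (T, 0)" by (simp add: hp_def form_simps)
    also have "\<dots> = - hp x (cplx_bracket e (T, 0))" using hp_skew[OF cj_closed[OF eg] xg Tg(1)] by simp
    also have "\<dots> = 0" using orth by (simp add: cb_swap[of "(T, 0)" e, symmetric] cb_swap[of e] wt_bracket[OF e(1) T] hp.form_simps)
    finally have 1: "ip (fst ?y) T = 0" .
    have "ip (snd ?y) T = hp ?y (0, T)" by (simp add: hp_def form_simps)
    also have "\<dots> = - hp x (cplx_bracket e (0, T))" using hp_skew[OF cj_closed[OF eg] xg Tg(2)] by simp
    also have "\<dots> = 0" using orth by (simp add: cb_swap[of e] wt_bracket'[OF e(1) T] hp.form_simps)
    finally show ?thesis using 1 by simp
  qed
  then have "fst ?y = 0" "snd ?y = 0" using \<t>_nondegenerate y by auto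
  then show "?y = 0" by (simp add: prod_eq_iff)
qed

text \<open>For \<open>z\<close> of weight \<open>2 *\<^sub>R a\<close> the bracket of
  \<open>cj e\<close> with \<open>z\<close> has weight \<open>a\<close> and is orthogonal to the
  line of \<open>e\<close>, since \<open>e\<close> commutes with itself. It is therefore zero,
  against \<open>lowering_injective\<close>.\<close>

lemma double_not_root:
  assumes "a \<in> rts"
  shows "2 *\<^sub>R a \<notin> rts"
proof
  assume "2 *\<^sub>R a \<in> rts"
  then obtain z where z: "wt (2 *\<^sub>R a) z" "z \<noteq> 0" by (auto simp: rts_def)
  obtain e where e: "wt a e" "e \<noteq> 0" using assms by (auto simp: rts_def)
  have a: "a \<in> \<t>" "a \<noteq> 0" using assms rts_\<t> rts_nonzero by auto
  have eg: "e \<in> \<g> \<times> \<g>" and zg: "z \<in> \<g> \<times> \<g>" using e z wt_closed by auto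
  let ?y = "cplx_bracket (cj e) z"
  have "wt (- a + 2 *\<^sub>R a) ?y" by (rule wt_add[OF wt_cj[OF e(1)] z(1)])
  then have y: "wt a ?y" by (simp add: scaleR_2)
  have "hp ?y e = 0" using hp_skew[OF cj_closed[OF eg] zg eg] by (simp add: cb_self hp.form_simps)
  moreover have "hp ?y (J e) = 0" using hp_skew[OF cj_closed[OF eg] zg J_closed[OF eg]] by (simp add: cb_J cb_self hp.form_simps)
  ultimately have "?y = 0" by (rule root_space_one_dim[OF e a y])
  moreover have "ip (2 *\<^sub>R a) a > 0" using \<t>_pos[OF a] by (simp add: form_simps)
  ultimately show False using lowering_injective[OF e a z(1)] z(2) by blast
qed

section \<open>Root space decomposition and irreducibility\<close>

definition root_parts :: "'n cmat set \<Rightarrow> 'n cmat set" where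
  "root_parts A = {fst Z | Z a. a \<in> A \<and> wt a Z}"

lemma root_parts_sub: "root_parts A \<subseteq> \<g>"
  using wt_closed by (fastforce simp: root_parts_def)

text \<open>The imaginary part of \<open>Z\<close> is the real part of \<open>- J Z\<close>, which
  has the same weight; hence real parts alone suffice in \<open>root_parts\<close>.\<close>

lemma fst_root_part: "a \<in> A \<Longrightarrow> wt a Z \<Longrightarrow> fst Z \<in> root_parts A"
  and snd_root_part: "a \<in> A \<Longrightarrow> wt a Z \<Longrightarrow> snd Z \<in> root_parts A"
proof -
  show *: "fst Z \<in> root_parts A" if "a \<in> A" "wt a Z" for Z using that unfolding root_parts_def by blast
  assume "a \<in> A" "wt a Z"
  then have "fst (- 1 *\<^sub>R J Z) \<in> root_parts A" by (intro * wt_scale wt_J)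
  then show "snd Z \<in> root_parts A" by (simp add: J_def)
qed

lemma wt_bracket_parts:
  assumes "wt a Z" "T \<in> \<t>"
  shows "bracket T (fst Z) = - ip a T *\<^sub>R snd Z" "bracket T (snd Z) = ip a T *\<^sub>R fst Z"
  using wt_bracket[OF assms] by (auto simp: cplx_bracket_def J_def bracket.zero_left)

text \<open>On the complexified orthogonal complement \<open>P\<close> of the span the operators
  \<open>op T\<close> have a common eigenvector. It is a weight vector, so its components lie in the
  span as well as in \<open>P\<close> and vanish.\<close>

lemma root_decomposition: "span (\<t> \<union> root_parts rts) = \<g>"
proof (rule ccontr)
  define S where "S = span (\<t> \<union> root_parts rts)"
  assume "span (\<t> \<union> root_parts rts) \<noteq> \<g>"
  have Sg: "S \<subseteq> \<g>" unfolding S_def using \<t>_sub root_parts_sub V by (intro span_minimal) auto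
  have S: "subspace S" by (simp add: S_def)
  have Sinv: "bracket T x \<in> S" if T: "T \<in> \<t>" and x: "x \<in> S" for T x
    using x unfolding S_def
  proof (induction rule: span_induct)
    case base
    show ?case unfolding mem_Collect_eq
      by (auto simp: subspace_def bracket.zero_right bracket.add_right bracket.scaleR_right span_zero span_add span_scale)
  next
    case (step x)
    then consider "x \<in> \<t>" | a Z where "a \<in> rts" "wt a Z" "x = fst Z" by (auto simp: root_parts_def)
    then show ?case
    proof cases
      case 1
      then show ?thesis using abelian[OF T] by (simp add: span_zero)
    next
      case 2
      then show ?thesis using snd_root_part wt_bracket_parts(1)[OF 2(2) T]
        by (metis UnCI span_base span_scale)
    qed
  qed
  define P where "P = {x\<in>\<g>. \<forall>y\<in>S. ip x y = 0}"
  have P: "subspace P" unfolding P_def using V by (auto simp: subspace_def form_simps)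
  have "S \<noteq> \<g>" using \<open>span (\<t> \<union> root_parts rts) \<noteq> \<g>\<close> by (simp add: S_def)
  then obtain x0 where x0: "x0 \<in> P" "x0 \<noteq> 0" using exists_orthogonal[OF S Sg] by (auto simp: P_def)
  have PS: "x = 0" if "x \<in> P" "x \<in> S" for x using that form_eq_0D by (auto simp: P_def)
  have Pinv: "bracket T x \<in> P" if T: "T \<in> \<t>" and x: "x \<in> P" for T x
  proof -
    have "ip (bracket T x) y = 0" if y: "y \<in> S" for y
      using skew[of T x y] Sinv[OF T y] x y T \<t>_sub Sg by (auto simp: P_def)
    then show ?thesis using x T \<t>_sub bracket_closed by (auto simp: P_def)
  qed
  \<comment> \<open>This is i ad T. Both \<open>J\<close> and ad T are skew for \<open>hp\<close>
    and they commute, so it is symmetric.\<close>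
  define op where "op T Z = J (cplx_bracket (T, 0) Z)" for T :: "'n cmat" and Z
  interpret \<t>: inner_form ip \<t> using bilin commute \<t> \<t>_pos by unfold_locales auto
  obtain B where B: "\<t>.orthonormal_basis B" using \<t>.exists_orthonormal_basis by blast
  then have Bf: "finite B" "B \<subseteq> \<t>" using span_superset by (auto simp: \<t>.orthonormal_basis_def)
  then obtain bs where bs: "set bs = B" using finite_list by blast
  have form: "inner_form hp (P \<times> P)"
    by (rule inner_form_hp[OF subspace_Times[OF P P]]) (auto simp: P_def)
  have ne: "P \<times> P \<noteq> {0}" using x0 P by (auto simp: zero_prod_def)
  have Pg: "Z \<in> \<g> \<times> \<g>" if "Z \<in> P \<times> P" for Z using that by (auto simp: P_def)
  have "\<exists>Z\<in>P \<times> P. Z \<noteq> 0 \<and> (\<forall>A\<in>set (map op bs). \<exists>\<mu>. A Z = \<mu> *\<^sub>R Z)"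
  proof (rule common_eigenvector[OF form ne])
    have "linear (op T)" for T by (rule linearI) (simp_all add: op_def cb.add_right cb.scaleR_right)
    then show "linear A" if "A \<in> set (map op bs)" for A using that by auto
    show "A Z \<in> P \<times> P" if "A \<in> set (map op bs)" "Z \<in> P \<times> P" for A Z
      using that Pinv Bf bs P by (auto simp: op_def J_def cplx_bracket_def bracket.zero_left subspace_neg)
    show "hp (A Z) W = hp Z (A W)" if "A \<in> set (map op bs)" "Z \<in> P \<times> P" "W \<in> P \<times> P" for A Z W
    proof -
      obtain T where T: "A = op T" "T \<in> \<t>" using \<open>A \<in> set (map op bs)\<close> bs Bf by auto
      have "hp (A Z) W = - hp (cplx_bracket (T, 0) Z) (J W)" by (simp add: T op_def hp_J)
      also have "\<dots> = hp Z (cplx_bracket (T, 0) (J W))"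
        using hp_skew[OF \<t>_closed[OF T(2)] Pg[OF that(2)] J_closed[OF Pg[OF that(3)]]] by simp
      finally show ?thesis by (simp add: T op_def cb_J)
    qed
    show "A (A' Z) = A' (A Z)" if "A \<in> set (map op bs)" "A' \<in> set (map op bs)" for A A' Z
    proof -
      obtain S where S: "A = op S" "S \<in> \<t>" using \<open>A \<in> set (map op bs)\<close> bs Bf by auto
      obtain T where T: "A' = op T" "T \<in> \<t>" using \<open>A' \<in> set (map op bs)\<close> bs Bf by auto
      note ST = S T
      have "cplx_bracket (S, 0) (T, 0) = 0" using abelian ST by (simp add: cplx_bracket_def zero_prod_def bracket.zero_left bracket.zero_right)
      then show ?thesis unfolding ST op_def cb_J by (simp add: cb_jacobi[of "(S, 0)" "(T, 0)"] cb.zero_left)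
    qed
  qed
  then obtain Z where Z: "Z \<in> P \<times> P" "Z \<noteq> 0" "\<And>T. T \<in> B \<Longrightarrow> \<exists>\<mu>. op T Z = \<mu> *\<^sub>R Z" using bs by auto
  then obtain \<mu> where \<mu>: "\<And>T. T \<in> B \<Longrightarrow> op T Z = \<mu> T *\<^sub>R Z" by metis
  \<comment> \<open>Applying \<open>J\<close> to \<open>op T Z = \<mu> T *\<^sub>R Z\<close> gives
    the bracket as \<open>- (\<mu> T *\<^sub>R J Z)\<close>, hence the sign in the vector
    \<open>R\<close> that represents these eigenvalues.\<close>
  define R where "R = (\<Sum>T\<in>B. (- \<mu> T) *\<^sub>R T)"
  have Rt: "R \<in> \<t>" unfolding R_def using Bf by (intro subspace_sum subspace_scale \<t>) auto
  have RB: "ip R T = - \<mu> T" if T: "T \<in> B" for T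
  proof -
    have "ip R T = (\<Sum>S\<in>B. - \<mu> S * ip S T)" by (simp add: R_def form_sum_left form_simps)
    also have "\<dots> = (\<Sum>S\<in>B. if S = T then - \<mu> T else 0)"
      using B T by (intro sum.cong) (auto simp: \<t>.orthonormal_basis_def)
    finally show ?thesis using Bf T by simp
  qed
  have base: "cplx_bracket (T, 0) Z = ip R T *\<^sub>R J Z" if T: "T \<in> B" for T
  proof -
    have "J (op T Z) = \<mu> T *\<^sub>R J Z" by (simp add: \<mu>[OF T])
    then have "cplx_bracket (T, 0) Z = - (\<mu> T *\<^sub>R J Z)" by (metis J_simps(1) minus_minus op_def)
    then show ?thesis by (simp add: RB[OF T])
  qed
  have "cplx_bracket (T, 0) Z = ip R T *\<^sub>R J Z" if T: "T \<in> \<t>" for T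
  proof -
    have "T \<in> span B" using B T by (simp add: \<t>.orthonormal_basis_def)
    then show ?thesis
    proof (induction rule: span_induct)
      case base
      have z: "(0, 0) = (0 :: 'n cmat \<times> 'n cmat)" by (simp add: zero_prod_def)
      have ad: "(x + y, 0 :: 'n cmat) = (x, 0) + (y, 0)" and sc: "(c *\<^sub>R x, 0 :: 'n cmat) = c *\<^sub>R (x, 0)" for x y :: "'n cmat" and c
        by simp_all
      show ?case
      proof (rule subspaceI; unfold mem_Collect_eq)
        show "cplx_bracket (0, 0) Z = ip R 0 *\<^sub>R J Z" by (simp only: z cb.zero_left form_simps scaleR_zero_left)
        show "cplx_bracket (x + y, 0) Z = ip R (x + y) *\<^sub>R J Z"
          if "cplx_bracket (x, 0) Z = ip R x *\<^sub>R J Z" "cplx_bracket (y, 0) Z = ip R y *\<^sub>R J Z" for x y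
          by (simp only: ad cb.add_left form_simps scaleR_add_left that)
        show "cplx_bracket (c *\<^sub>R x, 0) Z = ip R (c *\<^sub>R x) *\<^sub>R J Z"
          if "cplx_bracket (x, 0) Z = ip R x *\<^sub>R J Z" for c x
          by (simp only: sc cb.scaleR_left form_simps scaleR_scaleR real_scaleR_def that)
      qed
    next
      case (step T)
      then show ?case by (rule \<open>\<And>T. T \<in> B \<Longrightarrow> cplx_bracket (T, 0) Z = ip R T *\<^sub>R J Z\<close>)
    qed
  qed
  then have wR: "wt R Z" using Pg[OF Z(1)] by (auto simp: wt_def)
  have "fst Z \<in> S \<and> snd Z \<in> S"
  proof (cases "R = 0")
    case True
    then show ?thesis using wt_0[of Z] wR unfolding S_def by (blast intro: span_base)
  next
    case False
    then have "R \<in> rts" using Rt wR Z by (auto simp: rts_def)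
    then show ?thesis using fst_root_part[OF _ wR] snd_root_part[OF _ wR] unfolding S_def by (blast intro: span_base)
  qed
  then have "fst Z = 0" "snd Z = 0" using PS Z by auto
  then show False using Z by (simp add: prod_eq_iff)
qed

text \<open>\<open>x\<close> is a multiple of the bracket of \<open>a\<close> with the imaginary
  part, and skewness moves \<open>a\<close> onto \<open>T\<close>, with which it commutes.\<close>

lemma root_part_orthogonal:
  assumes "x \<in> root_parts rts" "T \<in> \<t>"
  shows "ip T x = 0"
proof -
  obtain a Z where a: "a \<in> rts" "wt a Z" "x = fst Z" using assms by (auto simp: root_parts_def)
  have Zg: "fst Z \<in> \<g>" "snd Z \<in> \<g>" using wt_closed[OF a(2)] by auto
  have at: "a \<in> \<t>" using a rts_\<t> by auto
  have "ip a a * ip T x = ip T (bracket a (snd Z))" using wt_bracket_parts(2)[OF a(2) at] by (simp add: a form_simps)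
  also have "\<dots> = - ip (bracket a T) (snd Z)" using skew[OF subsetD[OF \<t>_sub at] subsetD[OF \<t>_sub assms(2)] Zg(2)] by simp
  also have "\<dots> = 0" using abelian[OF at assms(2)] by (simp add: form_simps)
  finally show ?thesis using rts_pos[OF a(1)] by simp
qed

text \<open>The root spaces of an orthogonal component, together with the roots themselves, span an ideal.\<close>

lemma rts_irreducible:
  assumes AB: "A \<union> B = rts" "\<And>a b. a \<in> A \<Longrightarrow> b \<in> B \<Longrightarrow> ip a b = 0"
  shows "A = {} \<or> B = {}"
proof (rule ccontr)
  assume "\<not> ?thesis"
  then obtain a0 b0 where a0: "a0 \<in> A" and b0: "b0 \<in> B" by blast
  have At: "A \<subseteq> \<t>" and Bt: "B \<subseteq> \<t>" using AB rts_\<t> by auto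
  define I where "I = span (A \<union> root_parts A)"
  have I: "subspace I" by (simp add: I_def)
  have rA: "root_parts A \<subseteq> root_parts rts" using AB by (auto simp: root_parts_def)
  have Ig: "I \<subseteq> \<g>" unfolding I_def using At \<t>_sub root_parts_sub V by (intro span_minimal) auto
  have base: "a \<in> A \<Longrightarrow> a \<in> I" "a \<in> A \<Longrightarrow> wt a Z \<Longrightarrow> fst Z \<in> I" "a \<in> A \<Longrightarrow> wt a Z \<Longrightarrow> snd Z \<in> I" for a Z
    unfolding I_def by (blast intro: span_base fst_root_part snd_root_part)+
  \<comment> \<open>The alternative \<open>- b \<in> rts\<close> serves the later use with
    \<open>cj W\<close>, which has the opposite weight.\<close>
  have mixed: "fst (cplx_bracket W Z) \<in> I" if W: "wt b W" and b: "b \<in> rts \<or> - b \<in> rts" and Z: "wt a Z" and a: "a \<in> A" for b W a Z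
  proof -
    have w: "wt (b + a) (cplx_bracket W Z)" by (rule wt_add[OF W Z])
    have bt: "b \<in> \<t>" using b rts_\<t> \<t> subspace_neg by fastforce
    have br: "b \<in> rts" using b neg_rts[of "- b"] by auto
    have at: "a \<in> \<t>" using a At by auto
    have ar: "a \<in> rts" using a AB(1) by blast
    show ?thesis
    proof (cases "b + a = 0")
      case True
      then have ba: "b = - a" by (simp add: eq_neg_iff_add_eq_0)
      define U where "U = fst (cplx_bracket W Z)"
      have U: "U \<in> \<t>" using wt_0 w True by (simp add: U_def)
      have Wg: "fst W \<in> \<g>" "snd W \<in> \<g>" and Zg: "fst Z \<in> \<g>" "snd Z \<in> \<g>" using wt_closed[OF W] wt_closed[OF Z] by auto
      \<comment> \<open>The real part \<open>U\<close> of this bracket lies in \<t>. By invariance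
        its products with \<t> are those of \<open>- d *\<^sub>R a\<close>, which identifies it with
        a multiple of a root in \<open>A\<close>.\<close>
      define d where "d = - (ip (fst W) (snd Z) + ip (snd W) (fst Z))"
      have UT: "ip U T = - d * ip a T" if T: "T \<in> \<t>" for T
      proof -
        have Tg: "T \<in> \<g>" using T \<t>_sub by auto
        have "ip (bracket (fst W) (fst Z)) T = ip (fst W) (bracket (fst Z) T)"
          "ip (bracket (snd W) (snd Z)) T = ip (snd W) (bracket (snd Z) T)" using invariant Wg Zg Tg by auto
        then show ?thesis
          using wt_bracket_parts[OF Z T] bracket_swap[of "fst Z" T] bracket_swap[of "snd Z" T]
          by (simp add: U_def cplx_bracket_def form_simps d_def algebra_simps)
      qed
      have "U + d *\<^sub>R a = 0"
      proof (rule \<t>_nondegenerate)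
        show "U + d *\<^sub>R a \<in> \<t>" using U at \<t> by (simp add: subspace_add subspace_scale)
        show "ip (U + d *\<^sub>R a) T = 0" if "T \<in> \<t>" for T using UT[OF that] by (simp add: form_simps)
      qed
      then have "U = (- d) *\<^sub>R a" by (simp add: eq_neg_iff_add_eq_0)
      then show ?thesis unfolding U_def[symmetric] using base(1)[OF a] I by (simp add: subspace_scale subspace_neg)
    next
      case False
      show ?thesis
      proof (cases "b + a \<in> rts")
        case True
        then have "b + a \<in> A"
        proof -
          \<comment> \<open>If \<open>a\<close> were orthogonal to \<open>b + a\<close>, it could
            not be orthogonal to \<open>b\<close>, so \<open>b\<close> would be in \<open>A\<close>.
            Then \<open>b + a\<close> would be orthogonal to both summands, hence to itself.\<close>
          have "b + a \<notin> B"
          proof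
            assume baB: "b + a \<in> B"
            then have "ip a (b + a) = 0" using AB a by blast
            then have n: "ip a b \<noteq> 0" using rts_pos[OF ar] by (auto simp: form_simps)
            then have "b \<in> A" using AB a br by blast
            then have "ip b (b + a) = 0" "ip a (b + a) = 0" using AB a baB by auto
            then have "ip (b + a) (b + a) = 0" by (simp add: form_simps)
            then show False using rts_pos[OF True] by simp
          qed
          then show ?thesis using AB True by blast
        qed
        then show ?thesis using base(2) w by blast
      next
        case F: False
        have "b + a \<in> \<t>" using bt at \<t> by (simp add: subspace_add)
        then have "cplx_bracket W Z = 0" using wt_nonroot[OF w _ False F] by blast
        then show ?thesis using I by (simp add: subspace_0)
      qed
    qed
  qed
  have gen: "bracket X Y \<in> I" if X: "X \<in> \<t> \<union> root_parts rts" and Y: "Y \<in> A \<union> root_parts A" for X Y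
  proof -
    consider "X \<in> \<t>" "Y \<in> A" | a Z where "X \<in> \<t>" "a \<in> A" "wt a Z" "Y = fst Z"
      | b W where "b \<in> rts" "wt b W" "X = fst W" "Y \<in> A"
      | b W a Z where "b \<in> rts" "wt b W" "X = fst W" "a \<in> A" "wt a Z" "Y = fst Z"
      using X Y by (auto simp: root_parts_def)
    then show ?thesis
    proof cases
      case 1
      then show ?thesis using abelian At I by (auto simp: subspace_0)
    next
      case 2
      then show ?thesis using wt_bracket_parts(1)[OF 2(3,1)] base(3)[OF 2(2,3)] I subspace_scale by metis
    next
      case 3
      have Yt: "Y \<in> \<t>" using 3 At by auto
      have e: "bracket X Y = ip b Y *\<^sub>R snd W" using wt_bracket_parts(1)[OF 3(2) Yt] bracket_swap[of X Y] by (simp add: 3)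
      show ?thesis
      proof (cases "ip b Y = 0")
        case True
        then show ?thesis using e I by (simp add: subspace_0)
      next
        case False
        then have "b \<in> A" using AB 3 commute[of b Y] by auto
        then show ?thesis unfolding e using base(3) 3 I by (simp add: subspace_scale)
      qed
    next
      case 4
      have "fst (cplx_bracket W Z) \<in> I" by (rule mixed[OF 4(2) _ 4(5,4)]) (use 4 in simp)
      moreover have "fst (cplx_bracket (cj W) Z) \<in> I" by (rule mixed[OF wt_cj[OF 4(2)] _ 4(5,4)]) (use 4 in simp)
      \<comment> \<open>\<open>(fst W, 0)\<close> is half of \<open>W + cj W\<close>, so a bracket
        of real parts is the real part of a mean of two complex brackets.\<close>
      ultimately have "(1 / 2) *\<^sub>R (fst (cplx_bracket W Z) + fst (cplx_bracket (cj W) Z)) \<in> I"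
        using I by (intro subspace_scale subspace_add)
      moreover have "(1 / 2) *\<^sub>R (fst (cplx_bracket W Z) + fst (cplx_bracket (cj W) Z)) = bracket X Y"
        by (simp add: 4 cplx_bracket_def cj_def bracket.minus_left scaleR_2[symmetric])
      ultimately show ?thesis by simp
    qed
  qed
  have "bracket X Y \<in> I" if X: "X \<in> \<g>" and Y: "Y \<in> I" for X Y
  proof -
    have *: "bracket X Y \<in> I" if X: "X \<in> \<t> \<union> root_parts rts" for X
      using Y unfolding I_def
    proof (induction rule: span_induct)
      case base
      show ?case unfolding I_def[symmetric] using I
        by (auto simp: subspace_def bracket.zero_right bracket.add_right bracket.scaleR_right)
    next
      case (step Y)
      then show ?case using gen[OF X] by (simp add: I_def)
    qed
    have "X \<in> span (\<t> \<union> root_parts rts)" using X root_decomposition by simp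
    then show ?thesis
    proof (induction rule: span_induct)
      case base
      show ?case using I by (auto simp: subspace_def bracket.zero_left bracket.add_left bracket.scaleR_left)
    next
      case (step X)
      then show ?case by (rule *)
    qed
  qed
  then have "lie_ideal \<g> I" using I Ig by (auto simp: lie_ideal_def)
  then have "I = {0} \<or> I = \<g>" by (rule ideals)
  moreover have "I \<noteq> {0}" using base(1)[OF a0] a0 AB rts_nonzero by blast
  moreover have "I \<noteq> \<g>"
  proof
    assume "I = \<g>"
    then have b0I: "b0 \<in> span (A \<union> root_parts A)" using b0 Bt \<t>_sub by (auto simp: I_def)
    \<comment> \<open>All generators of \<open>I\<close> are orthogonal to \<open>b0\<close>: the
      roots in \<open>A\<close> by the splitting, the root vectors because they are orthogonal to
      \<t>. So \<open>b0\<close> is not in \<open>I\<close>.\<close>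
    have "ip b0 x = 0" if "x \<in> span (A \<union> root_parts A)" for x
      using that
    proof (induction rule: span_induct)
      case base
      show ?case by (auto simp: subspace_def form_simps)
    next
      case (step x)
      then consider "x \<in> A" | "x \<in> root_parts rts" using rA by blast
      then show ?case
      proof cases
        case 1
        then show ?thesis using AB(2)[of x b0] b0 commute[of b0 x] by simp
      next
        case 2
        then show ?thesis using root_part_orthogonal b0 Bt by blast
      qed
    qed
    then show False using rts_pos[of b0] b0 AB(1) b0I by fastforce
  qed
  ultimately show False by blast
qed

end

section \<open>The lexicographic order and the norm of the highest root\<close>

lemma coordinate_linear:
  assumes "independent (set Ts)" "x \<in> span (set Ts)" "y \<in> span (set Ts)"
  shows "coordinate Ts (x + y) k = coordinate Ts x k + coordinate Ts y k"
    "coordinate Ts (c *\<^sub>R x) k = c * coordinate Ts x k"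
    "coordinate Ts (- x) k = - coordinate Ts x k"
  using assms by (simp_all add: coordinate_def representation_add representation_scale representation_neg)

lemma positive_vector_scale:
  assumes "independent (set Ts)" "x \<in> span (set Ts)" "c > 0" "positive_vector Ts x"
  shows "positive_vector Ts (c *\<^sub>R x)"
proof -
  obtain k where "k < length Ts" "\<And>j. j < k \<Longrightarrow> coordinate Ts x j = 0" "coordinate Ts x k > 0"
    using assms(4) by (auto simp: positive_vector_def)
  then show ?thesis unfolding positive_vector_def using assms(3)
    by (intro exI[of _ k]) (simp add: coordinate_linear(2)[OF assms(1,2,2)])
qed

text \<open>The leading position of the sum is the smaller of the two leading positions; if they
  coincide, two positive coordinates are added.\<close>

lemma positive_vector_add:
  assumes T: "independent (set Ts)" and xy: "x \<in> span (set Ts)" "y \<in> span (set Ts)"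
    and "positive_vector Ts x" "positive_vector Ts y"
  shows "positive_vector Ts (x + y)"
proof -
  obtain k where k: "k < length Ts" "\<And>j. j < k \<Longrightarrow> coordinate Ts x j = 0" "coordinate Ts x k > 0"
    using assms(4) by (auto simp: positive_vector_def)
  obtain l where l: "l < length Ts" "\<And>j. j < l \<Longrightarrow> coordinate Ts y j = 0" "coordinate Ts y l > 0"
    using assms(5) by (auto simp: positive_vector_def)
  have "coordinate Ts x (min k l) \<ge> 0" "coordinate Ts y (min k l) \<ge> 0"
    "coordinate Ts x (min k l) > 0 \<or> coordinate Ts y (min k l) > 0"
    using k(2)[of l] k(3) l(2)[of k] l(3) by (cases k l rule: linorder_cases; simp)+
  then have "coordinate Ts x (min k l) + coordinate Ts y (min k l) > 0" by linarith
  then show ?thesis unfolding positive_vector_def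
    using k(1,2) l(2) by (intro exI[of _ "min k l"]) (simp add: coordinate_linear(1)[OF T xy])
qed

lemma positive_vector_total:
  assumes T: "independent (set Ts)" and x: "x \<in> span (set Ts)" "x \<noteq> 0"
  shows "positive_vector Ts x \<or> positive_vector Ts (- x)"
proof -
  have "\<exists>k. k < length Ts \<and> coordinate Ts x k \<noteq> 0"
  proof (rule ccontr)
    assume "\<not> ?thesis"
    then have "representation (set Ts) x b = 0" if "b \<in> set Ts" for b
      using that unfolding coordinate_def by (metis in_set_conv_nth)
    then have "(\<Sum>b\<in>set Ts. representation (set Ts) x b *\<^sub>R b) = 0" by (intro sum.neutral) simp
    then show False using sum_representation_eq[OF T x(1) finite_set subset_refl] x(2) by simp
  qed
  then obtain k where k: "k < length Ts \<and> coordinate Ts x k \<noteq> 0"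
    and least: "\<And>j. j < k \<Longrightarrow> \<not> (j < length Ts \<and> coordinate Ts x j \<noteq> 0)"
    using exists_least_iff[of "\<lambda>k. k < length Ts \<and> coordinate Ts x k \<noteq> 0"] by blast
  then have "\<forall>j<k. coordinate Ts x j = 0" by auto
  then show ?thesis unfolding positive_vector_def coordinate_linear(3)[OF T x(1) x(1)]
    using k by (cases "coordinate Ts x k > 0") (auto intro!: exI[of _ k])
qed

lemma positive_vector_0: "independent (set Ts) \<Longrightarrow> \<not> positive_vector Ts 0"
  by (simp add: positive_vector_def coordinate_def representation_zero)

section \<open>Passage from the matrix group to the abstract root system\<close>

theorem corollary3p1:
  fixes G H \<g> \<t> :: "(complex ^ 'n ^ 'n) set"
    and \<rho> :: real
    and Ts Rs :: "(complex ^ 'n ^ 'n) list"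
    and Rstar :: "complex ^ 'n ^ 'n"
  assumes "matrix_lie_group G" and "compact G" and "simply_connected G" and "simple_lie_group G"
    and "\<g> = lie_algebra G"
    and "\<rho> > 0"
    and "maximal_torus G H" and "\<t> = lie_algebra H"
    and "ordered_orthonormal_basis \<rho> \<g> \<t> Ts"
    and "distinct Rs" and "set Rs = simple_roots \<rho> \<g> \<t> Ts"
    and "highest_root \<rho> \<g> \<t> Ts Rstar"
  shows "is_maximum
           {4 * pi / lie_norm \<rho> \<g> (\<Sum>i<length Rs. real (n i) *\<^sub>R (2 *\<^sub>R root_P \<rho> \<g> (Rs ! i))) | n.
              relatively_prime (length Rs) n}
           (lie_norm \<rho> \<g> Rstar)"
proof -
  interpret G: compact_simple_group G using assms by unfold_locales
  have tor: "matrix_lie_group H" "H \<subseteq> G" "compact H" "\<And>A B. A \<in> H \<Longrightarrow> B \<in> H \<Longrightarrow> A ** B = B ** A"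
    using assms(7) by (auto simp: maximal_torus_def torus_in_def)
  interpret H: compact_matrix_group H using tor by unfold_locales
  have \<t>\<g>: "\<t> \<subseteq> \<g>" using tor(2) assms(5,8) by (auto simp: lie_algebra_def)
  obtain ip where form: "inner_form ip \<g>"
    and ip: "\<And>X Y. X \<in> \<g> \<Longrightarrow> Y \<in> \<g> \<Longrightarrow> lie_inner \<rho> \<g> X Y = ip X Y"
    and inv: "\<And>X Y Z. X \<in> \<g> \<Longrightarrow> Y \<in> \<g> \<Longrightarrow> Z \<in> \<g> \<Longrightarrow> ip (bracket X Y) Z = ip X (bracket Y Z)"
    using G.lie_inner_extension[OF assms(6)] assms(5) by metis
  interpret form: inner_form ip \<g> by (rule form)
  interpret C: cartan_algebra ip \<g> \<t>
  proof
    show "bracket X Y \<in> \<g>" if "X \<in> \<g>" "Y \<in> \<g>" for X Y using G.bracket_in that assms(5) by simp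
    show "ip (bracket X Y) Z = ip X (bracket Y Z)" if "X \<in> \<g>" "Y \<in> \<g>" "Z \<in> \<g>" for X Y Z by (rule inv[OF that])
    show "I = {0} \<or> I = \<g>" if "lie_ideal \<g> I" for I using G.ideal_trivial that assms(5) by simp
    show "\<t> \<subseteq> \<g>" by (rule \<t>\<g>)
    show "subspace \<t>" using H.subspace_lie_algebra assms(8) by simp
    show "bracket S T = 0" if "S \<in> \<t>" "T \<in> \<t>" for S T
      using H.lie_algebra_commute(2)[OF tor(4)] that assms(8) by simp
    show "X \<in> \<t>" if "X \<in> \<g>" "\<And>T. T \<in> \<t> \<Longrightarrow> bracket T X = 0" for X
    proof -
      have "bracket X T = 0" if "T \<in> lie_algebra H" for T
        using \<open>\<And>T. T \<in> \<t> \<Longrightarrow> bracket T X = 0\<close>[of T] that assms(8) bracket_swap[of T X] by simp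
      then show ?thesis using G.centralizer_torus[OF assms(7)] that(1) assms(5,8) by simp
    qed
  qed
  \<comment> \<open>Scaling by i r is \<open>r *\<^sub>R J\<close>, and \<open>lie_inner\<close>
    agrees with \<open>ip\<close> on \<t>.\<close>
  have roots: "roots \<rho> \<g> \<t> = C.rts"
  proof -
    have scale: "cplx_scale (\<i> * complex_of_real r) Z = r *\<^sub>R J Z" for r and Z :: "'n cmat \<times> 'n cmat"
      by (simp add: cplx_scale_def J_def)
    have "(\<forall>T\<in>\<t>. cplx_bracket (T, 0) Z = cplx_scale (\<i> * complex_of_real (lie_inner \<rho> \<g> R T)) Z) \<longleftrightarrow>
        (\<forall>T\<in>\<t>. cplx_bracket (T, 0) Z = ip R T *\<^sub>R J Z)" if "R \<in> \<t>" for R Z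
    proof -
      have "lie_inner \<rho> \<g> R T = ip R T" if "T \<in> \<t>" for T using ip \<t>\<g> that \<open>R \<in> \<t>\<close> by blast
      then show ?thesis by (simp add: scale)
    qed
    then show ?thesis unfolding roots_def C.rts_def C.wt_def by blast
  qed
  have Ts: "independent (set Ts)" "span (set Ts) = \<t>" using assms(9) by (auto simp: ordered_orthonormal_basis_def)
  interpret R: ordered_root_system ip \<t> C.rts "positive_vector Ts" Rstar
  proof
    note hyps = assms(12)[unfolded highest_root_def roots root_greater_def]
    show "bilinear ip" "\<And>x y. ip x y = ip y x" by (rule form.bilin form.commute)+
    show "subspace \<t>" "\<And>x. x \<in> \<t> \<Longrightarrow> x \<noteq> 0 \<Longrightarrow> ip x x > 0" by (rule C.\<t> C.\<t>_pos; assumption?)+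
    show "finite C.rts" "C.rts \<subseteq> \<t>" "0 \<notin> C.rts" using C.finite_rts C.rts_\<t> C.rts_nonzero by auto
    show "2 * ip b a / ip a a \<in> \<int>" if "a \<in> C.rts" "b \<in> C.rts" for a b by (rule C.root_string(1)[OF that])
    show "b - (2 * ip b a / ip a a) *\<^sub>R a \<in> C.rts" if "a \<in> C.rts" "b \<in> C.rts" for a b by (rule C.reflect_rts[OF that])
    show "2 *\<^sub>R a \<notin> C.rts" if "a \<in> C.rts" for a by (rule C.double_not_root[OF that])
    show "A = {} \<or> B = {}" if "A \<union> B = C.rts" "\<And>a b. a \<in> A \<Longrightarrow> b \<in> B \<Longrightarrow> ip a b = 0" for A B
      by (rule C.rts_irreducible[OF that])
    show "positive_vector Ts x \<or> positive_vector Ts (- x)" if "x \<in> \<t>" "x \<noteq> 0" for x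
      using positive_vector_total[OF Ts(1)] that Ts(2) by blast
    show "positive_vector Ts (x + y)" if "x \<in> \<t>" "y \<in> \<t>" "positive_vector Ts x" "positive_vector Ts y" for x y
      using positive_vector_add[OF Ts(1)] that Ts(2) by blast
    show "positive_vector Ts (c *\<^sub>R x)" if "x \<in> \<t>" "c > 0" "positive_vector Ts x" for x c
      using positive_vector_scale[OF Ts(1)] that Ts(2) by blast
    show "\<not> positive_vector Ts 0" by (rule positive_vector_0[OF Ts(1)])
    show "Rstar \<in> C.rts" using hyps by blast
    show "positive_vector Ts (Rstar - a)" if "a \<in> C.rts" "a \<noteq> Rstar" for a using hyps that by blast
  qed
  have \<Delta>: "set Rs = R.\<Delta>"
    unfolding assms(11) by (auto simp: simple_roots_def positive_roots_def roots R.\<Delta>_def)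
  have norm: "lie_norm \<rho> \<g> X = sqrt (ip X X)" if "X \<in> \<g>" for X
    by (simp add: lie_norm_def ip that)
  have Rs: "Rs ! i \<in> \<g>" if "i < length Rs" for i
    using nth_mem[OF that] \<Delta> R.simple_root R.root_V \<t>\<g> by blast
  have Rstar: "Rstar \<in> \<g>" using R.root_V[OF R.highest(1)] \<t>\<g> by blast
  define v where "v n = (\<Sum>i<length Rs. real (n i) *\<^sub>R (2 *\<^sub>R ((2 * pi / (sqrt (ip (Rs ! i) (Rs ! i)))\<^sup>2) *\<^sub>R Rs ! i)))" for n :: "nat \<Rightarrow> nat"
  have v: "(\<Sum>i<length Rs. real (n i) *\<^sub>R (2 *\<^sub>R root_P \<rho> \<g> (Rs ! i))) = v n" for n :: "nat \<Rightarrow> nat"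
    unfolding v_def root_P_def using norm[OF Rs] by (intro sum.cong) auto
  \<comment> \<open>\<open>lie_norm\<close> is identified with the norm of \<open>ip\<close> on \<g>
    only, so the vectors in the denominators have to be placed there.\<close>
  have "v n \<in> \<g>" for n
    unfolding v_def by (intro subspace_sum subspace_scale form.V Rs) simp
  then have "lie_norm \<rho> \<g> (v n) = sqrt (ip (v n) (v n))" for n by (rule norm)
  then show ?thesis
    unfolding v norm[OF Rstar] using R.highest_norm_is_maximum[OF assms(10) \<Delta>] by (simp add: v_def)
qed

end
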